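(* Let $t_1<t_2<\cdots<t_7$ be real numbers, let $f_j(x)=x_0+t_jx_1+t_j^2x_2+t_j^3x_3+t_j^4x_4$ for $j=1,\dots,7$, let $H_j=\{f_j=0\}\subset\mathbb{P}^4=\mathbb{P}^4(\mathbb{R})$, and let $CC\subset\mathbb{P}^4$ be the chamber which is the image of $\{x\in\mathbb{R}^5\setminus\{0\}: f_j(x)\ge 0,\ j=1,\dots,7\}$. Put $D_j=CC\cap H_j$, with indices read modulo 7. Then: (i) $D_1,\dots,D_7$ are the facets of $CC$, each $D_j$ is a (pentagonal) dumpling, so that the boundary of $CC$ is a 3-sphere tessellated by seven dumplings, and the cyclic shift $D_k\mapsto D_{k+1}$ (mod 7) is induced by a combinatorial automorphism of this tessellation; (ii) for every $k$, $D_k$ and $D_{k+1}$ share a pentagon; the 2-skeleton of the tessellation consists of these seven pentagons $D_k\cap D_{k+1}$, seven triangles and seven quadrilaterals; (iii) the seven special edges of the dumplings form a circle $C$, and the union of the seven triangles and seven quadrilaterals (the 2-skeleton with the seven pentagons $D_k\cap D_{k+1}$ removed) is a Möbius strip with boundary $C$; (iv) $C$ also bounds a disc which is a union of 2-faces of the tessellation; in particular $C$ is an unknotted circle in the 3-sphere $\partial CC$.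
   Context: A chamber of a hyperplane arrangement is the closure of a connected component of the complement of the union of the hyperplanes. A (pentagonal) dumpling is a 3-polytope of the combinatorial type obtained from a pentagonal prism (pentagon times $[0,1]$) by crushing one rectangular face $\sigma\times[0,1]$ onto $\sigma$ via the projection $(x,t)\mapsto x$; it is bounded by two pentagons, two triangles and two quadrilaterals. Its special edge is the edge that is the intersection of its two pentagonal faces. *)

theory Defs
  imports "HOL-Analysis.Analysis"
begin

text \<open>The projective space of \<open>'a\<close>, i.e. nonzero vectors modulo nonzero scalars, with the quotient
  topology; \<open>(real^5) pspace\<close> is the real projective 4-space. The class map \<open>abs_pspace\<close> is
  only meaningful on nonzero vectors.\<close>

quotient_type (overloaded) 'a pspace = "'a::euclidean_space" / partial:
  "\<lambda>x y::'a. x \<noteq> 0 \<and> y \<noteq> 0 \<and> (\<exists>c::real. c \<noteq> 0 \<and> y = c *\<^sub>R x)"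
proof (rule part_equivpI)
  obtain b :: 'a where "b \<in> Basis" using nonempty_Basis by blast
  then have "b \<noteq> 0" by (rule nonzero_Basis)
  then show "\<exists>x::'a. x \<noteq> 0 \<and> x \<noteq> 0 \<and> (\<exists>c::real. c \<noteq> 0 \<and> x = c *\<^sub>R x)"
    by (intro exI[of _ b]) (auto intro: exI[of _ 1])
next
  show "symp (\<lambda>x y::'a. x \<noteq> 0 \<and> y \<noteq> 0 \<and> (\<exists>c::real. c \<noteq> 0 \<and> y = c *\<^sub>R x))"
  proof (rule sympI)
    fix x y :: 'a
    assume "x \<noteq> 0 \<and> y \<noteq> 0 \<and> (\<exists>c::real. c \<noteq> 0 \<and> y = c *\<^sub>R x)"
    then obtain c :: real where c: "x \<noteq> 0" "y \<noteq> 0" "c \<noteq> 0" "y = c *\<^sub>R x" by blast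
    then have "x = inverse c *\<^sub>R y" by simp
    with c show "y \<noteq> 0 \<and> x \<noteq> 0 \<and> (\<exists>c::real. c \<noteq> 0 \<and> x = c *\<^sub>R y)"
      by (metis inverse_nonzero_iff_nonzero)
  qed
next
  show "transp (\<lambda>x y::'a. x \<noteq> 0 \<and> y \<noteq> 0 \<and> (\<exists>c::real. c \<noteq> 0 \<and> y = c *\<^sub>R x))"
  proof (rule transpI)
    fix x y z :: 'a
    assume "x \<noteq> 0 \<and> y \<noteq> 0 \<and> (\<exists>c::real. c \<noteq> 0 \<and> y = c *\<^sub>R x)"
      and "y \<noteq> 0 \<and> z \<noteq> 0 \<and> (\<exists>c::real. c \<noteq> 0 \<and> z = c *\<^sub>R y)"
    then obtain c d :: real
      where "x \<noteq> 0" "z \<noteq> 0" "c \<noteq> 0" "d \<noteq> 0" "y = c *\<^sub>R x" "z = d *\<^sub>R y" by blast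
    then show "x \<noteq> 0 \<and> z \<noteq> 0 \<and> (\<exists>c::real. c \<noteq> 0 \<and> z = c *\<^sub>R x)"
      by (auto intro!: exI[of _ "d * c"])
  qed
qed

instantiation pspace :: (euclidean_space) topological_space
begin

definition open_pspace :: "'a pspace set \<Rightarrow> bool" where
  "open_pspace U \<longleftrightarrow> open {x::'a. x \<noteq> 0 \<and> abs_pspace x \<in> U}"

instance
proof
  have "{x::'a. x \<noteq> 0 \<and> abs_pspace x \<in> UNIV} = - {0}" by auto
  then show "open (UNIV :: 'a pspace set)" by (simp add: open_pspace_def open_Compl)
next
  fix S T :: "'a pspace set"
  assume "open S" "open T"
  moreover have "{x::'a. x \<noteq> 0 \<and> abs_pspace x \<in> S \<inter> T} =
      {x. x \<noteq> 0 \<and> abs_pspace x \<in> S} \<inter> {x. x \<noteq> 0 \<and> abs_pspace x \<in> T}" by auto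
  ultimately show "open (S \<inter> T)" by (simp add: open_pspace_def open_Int)
next
  fix K :: "'a pspace set set"
  assume "\<forall>S\<in>K. open S"
  moreover have "{x::'a. x \<noteq> 0 \<and> abs_pspace x \<in> \<Union>K} =
      (\<Union>S\<in>K. {x. x \<noteq> 0 \<and> abs_pspace x \<in> S})" by auto
  ultimately show "open (\<Union>K)" by (auto simp: open_pspace_def)
qed

end

text \<open>\<open>R\<close> is a copy of \<open>Q\<close> as a convex polytope in the affine chart \<open>h \<bullet> x \<noteq> 0\<close>, identified with
  the affine hyperplane \<open>h \<bullet> x = 1\<close>.\<close>

definition affine_model :: "'a::euclidean_space pspace set \<Rightarrow> 'a set \<Rightarrow> bool" where
  "affine_model Q R \<longleftrightarrow> polytope R \<and> (\<exists>h. R \<subseteq> {x. h \<bullet> x = 1}) \<and> Q = abs_pspace ` R"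

definition proj_polytope :: "int \<Rightarrow> 'a::euclidean_space pspace set \<Rightarrow> bool" where
  "proj_polytope d Q \<longleftrightarrow> (\<exists>R. affine_model Q R \<and> aff_dim R = d)"

text \<open>As in the library, the empty set and the polytope itself are faces.\<close>

definition proj_face :: "'a::euclidean_space pspace set \<Rightarrow> 'a pspace set \<Rightarrow> bool" where
  "proj_face F Q \<longleftrightarrow> (\<exists>R G. affine_model Q R \<and> G face_of R \<and> F = abs_pspace ` G)"

definition proj_facet :: "'a::euclidean_space pspace set \<Rightarrow> 'a pspace set \<Rightarrow> bool" where
  "proj_facet F Q \<longleftrightarrow> (\<exists>R G. affine_model Q R \<and> G facet_of R \<and> F = abs_pspace ` G)"

definition proj_polygon :: "nat \<Rightarrow> 'a::euclidean_space pspace set \<Rightarrow> bool" where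
  "proj_polygon n F \<longleftrightarrow>
    proj_polytope 2 F \<and> card {v. proj_face v F \<and> proj_polytope 0 v} = n"

definition open_cell :: "'a::euclidean_space pspace set \<Rightarrow> 'a pspace set" where
  "open_cell F = F - \<Union>{G. proj_face G F \<and> G \<noteq> F}"

definition comb_iso :: "('a set \<Rightarrow> 'b set) \<Rightarrow> 'a set set \<Rightarrow> 'b set set \<Rightarrow> bool" where
  "comb_iso \<phi> \<A> \<B> \<longleftrightarrow>
    bij_betw \<phi> \<A> \<B> \<and> (\<forall>A\<in>\<A>. \<forall>A'\<in>\<A>. \<phi> A \<subseteq> \<phi> A' \<longleftrightarrow> A \<subseteq> A')"

text \<open>Abstract polytopes are given by their nonempty faces, each face by its set of vertices.\<close>

definition pentagon_faces :: "nat set set" where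
  "pentagon_faces = {{i} | i. i < 5} \<union> {{i, (i + 1) mod 5} | i. i < 5} \<union> {{0..<5}}"

definition interval_faces :: "nat set set" where
  "interval_faces = {{0}, {1}, {0, 1}}"

definition prism_faces :: "(nat \<times> nat) set set" where
  "prism_faces = {A \<times> B | A B. A \<in> pentagon_faces \<and> B \<in> interval_faces}"

text \<open>The crushed rectangle is \<open>\<sigma> \<times> [0,1]\<close> with \<open>\<sigma>\<close> the edge \<open>{0, 1}\<close> of the pentagon.\<close>

definition crush :: "nat \<times> nat \<Rightarrow> nat \<times> nat" where
  "crush = (\<lambda>(i, s). if i \<in> {0, 1} then (i, 0) else (i, s))"

definition dumpling_faces :: "(nat \<times> nat) set set" where
  "dumpling_faces = (\<lambda>F. crush ` F) ` prism_faces"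

definition dumpling :: "'a::euclidean_space pspace set \<Rightarrow> bool" where
  "dumpling P \<longleftrightarrow> proj_polytope 3 P \<and>
    (\<exists>\<phi>. comb_iso \<phi> {F. proj_face F P \<and> F \<noteq> {}} dumpling_faces)"

text \<open>For a dumpling, this is the intersection of exactly two pentagons.\<close>

definition special_edge :: "'a::euclidean_space pspace set \<Rightarrow> 'a pspace set" where
  "special_edge P = \<Inter>{F. proj_face F P \<and> proj_polygon 5 F}"

definition tessellation ::
  "int \<Rightarrow> 'a::euclidean_space pspace set set \<Rightarrow> 'a pspace set \<Rightarrow> bool" where
  "tessellation d \<T> X \<longleftrightarrow> finite \<T> \<and> (\<forall>P\<in>\<T>. proj_polytope d P) \<and> \<Union>\<T> = X \<and>
    (\<forall>P\<in>\<T>. \<forall>Q\<in>\<T>. P \<noteq> Q \<longrightarrow>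
      proj_face (P \<inter> Q) P \<and> proj_face (P \<inter> Q) Q \<and> P \<inter> Q \<noteq> P \<and> P \<inter> Q \<noteq> Q)"

definition cells :: "'a::euclidean_space pspace set set \<Rightarrow> 'a pspace set set" where
  "cells \<T> = {F. F \<noteq> {} \<and> (\<exists>P\<in>\<T>. proj_face F P)}"

definition cells_of_dim ::
  "int \<Rightarrow> 'a::euclidean_space pspace set set \<Rightarrow> 'a pspace set set" where
  "cells_of_dim d \<T> = {F \<in> cells \<T>. proj_polytope d F}"

definition polygon_cells ::
  "nat \<Rightarrow> 'a::euclidean_space pspace set set \<Rightarrow> 'a pspace set set" where
  "polygon_cells n \<T> = {F \<in> cells_of_dim 2 \<T>. proj_polygon n F}"

definition skeleton ::
  "int \<Rightarrow> 'a::euclidean_space pspace set set \<Rightarrow> 'a pspace set" where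
  "skeleton d \<T> = \<Union>(\<Union>e\<in>{..d}. cells_of_dim e \<T>)"

definition circle :: "'a::topological_space set \<Rightarrow> bool" where
  "circle C \<longleftrightarrow> C homeomorphic (sphere 0 1 :: (real^2) set)"

definition three_sphere :: "'a::topological_space set \<Rightarrow> bool" where
  "three_sphere S \<longleftrightarrow> S homeomorphic (sphere 0 1 :: (real^4) set)"

definition disc_with_boundary :: "'a::topological_space set \<Rightarrow> 'a set \<Rightarrow> bool" where
  "disc_with_boundary \<Delta> C \<longleftrightarrow>
    (\<exists>h h'. homeomorphism (cball 0 1 :: (real^2) set) \<Delta> h h' \<and> h ` sphere 0 1 = C)"

text \<open>\<open>M\<close> is homeomorphic to the quotient of \<open>[0,1] \<times> [-1,1]\<close> by \<open>(0, s) \<sim> (1, -s)\<close>, and \<open>C\<close>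
  corresponds to the image of \<open>[0,1] \<times> {-1, 1}\<close>.\<close>

definition moebius_strip_with_boundary :: "'a::topological_space set \<Rightarrow> 'a set \<Rightarrow> bool" where
  "moebius_strip_with_boundary M C \<longleftrightarrow>
    (\<exists>q :: real \<times> real \<Rightarrow> 'a.
      quotient_map (top_of_set ({0..1} \<times> {-1..1})) (top_of_set M) q \<and>
      (\<forall>x\<in>{0..1} \<times> {-1..1}. \<forall>y\<in>{0..1} \<times> {-1..1}.
        q x = q y \<longleftrightarrow> x = y \<or> ({fst x, fst y} = {0, 1} \<and> snd y = - snd x)) \<and>
      q ` ({0..1} \<times> {-1, 1}) = C)"

definition unknotted_circle_in :: "'a::topological_space set \<Rightarrow> 'a set \<Rightarrow> bool" where
  "unknotted_circle_in C S \<longleftrightarrow>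
    (\<exists>h h'. homeomorphism S (sphere 0 1 :: (real^4) set) h h' \<and>
      h ` C = {x \<in> sphere 0 1. x $ 2 = 0 \<and> x $ 3 = 0} \<and> C \<subseteq> S)"

definition chamber :: "'a::topological_space set set \<Rightarrow> 'a set \<Rightarrow> bool" where
  "chamber \<H> K \<longleftrightarrow> (\<exists>U \<in> components (- \<Union>\<H>). K = closure U)"

text \<open>The coordinates \<open>x\<^sub>0, \<dots>, x\<^sub>4\<close> are indexed by the elements 0, 1, 2, 3, 4 of the type \<open>5\<close>.\<close>

definition form :: "real \<Rightarrow> real^5 \<Rightarrow> real" where
  "form s x = x $ 0 + s * x $ 1 + s ^ 2 * x $ 2 + s ^ 3 * x $ 3 + s ^ 4 * x $ 4"

definition hyp :: "(nat \<Rightarrow> real) \<Rightarrow> nat \<Rightarrow> (real^5) pspace set" where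
  "hyp t j = abs_pspace ` {x. x \<noteq> 0 \<and> form (t j) x = 0}"

definition CC :: "(nat \<Rightarrow> real) \<Rightarrow> (real^5) pspace set" where
  "CC t = abs_pspace ` {x. x \<noteq> 0 \<and> (\<forall>j\<in>{1..7}. form (t j) x \<ge> 0)}"

definition DD :: "(nat \<Rightarrow> real) \<Rightarrow> nat \<Rightarrow> (real^5) pspace set" where
  "DD t j = CC t \<inter> hyp t j"

text \<open>The successor modulo 7 on the index set \<open>{1..7}\<close>.\<close>

definition nxt :: "nat \<Rightarrow> nat" where
  "nxt k = k mod 7 + 1"

definition dumpling_tess :: "(nat \<Rightarrow> real) \<Rightarrow> (real^5) pspace set set" where
  "dumpling_tess t = DD t ` {1..7}"

definition special_curve :: "(nat \<Rightarrow> real) \<Rightarrow> (real^5) pspace set" where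
  "special_curve t = (\<Union>k\<in>{1..7}. special_edge (DD t k))"

end

theory Submission
  imports Defs
begin

text \<open>
  Read cyclically, any six of the seven functionals \<open>f\<^sub>i\<close> satisfy a linear relation with alternating signs:
  divided differences of order 5 annihilate polynomials of degree 4, and six is even, so that the
  signs survive a cyclic rotation. These seven relations alone determine the face lattice: \<open>J\<close> is contained
  in the zero set of a nonzero point of the cone iff it contains no \<open>{i, i+2, i+4}\<close>. The vertices are
  \<open>V\<^sub>k\<close> with zeros \<open>k, k+1, k+2, k+3\<close> and \<open>U\<^sub>k\<close> with zeros \<open>k, k+1, k+3, k+4\<close>,
  and the special edges join \<open>V\<^sub>k\<close> and \<open>V\<^sub>k\<^sub>+\<^sub>1\<close>.

  Modulo the centre \<open>c\<close> of the chamber its boundary becomes the sphere of rays of a 4-space. There the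
  heptagon of special edges projects to a fan that winds once around the origin of the plane with
  coordinates \<open>f\<^sub>0 - f\<^sub>3\<close>, \<open>f\<^sub>1 - f\<^sub>5\<close>, so the heptagon is the graph of a piecewise linear map over
  this plane, and a shear flattens it to a round circle. The Moebius strip and the disc are
  parametrised by piecewise linear weights on the vertices; such weights are determined by the point
  because the faces involved are simplices or quadrilaterals cut along a diagonal.
\<close>

section \<open>Projective polytopes\<close>

text \<open>The nodes are ordered linearly, but the relations between the functionals have a cyclic
  symmetry. Hence everything geometric is derived from the relations alone, indices are residues
  modulo 7 (the index 7 becomes 0), and a claim about \<open>k\<close>, \<open>k+1\<close>, ... is
  checked at one arbitrary \<open>k\<close>. The centre \<open>c\<close> is the constant polynomial
  1, on which all functionals take the value 1: differences of functionals live on the quotient by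
  \<open>c\<close>, and moving along \<open>c\<close> raises all functionals at the same rate, so
  that each ray of the quotient meets the boundary in exactly one point. The topological claims
  demand explicit maps, and unknottedness even a homeomorphism of the whole boundary. All of them
  come from continuous maps on compact sets, so that only identifications and images need an
  argument. The shear is bijective whatever function of the plane it subtracts; geometry enters
  where the heptagon must be shown to be a graph, that is, where each planar vector must have
  exactly one expression by nonnegative weights on two neighbouring vertices.\<close>

lemma abs_pspace_eq_iff:
  fixes x y :: "'a::euclidean_space"
  assumes "x \<noteq> 0" "y \<noteq> 0"
  shows "abs_pspace x = abs_pspace y \<longleftrightarrow> (\<exists>c. c \<noteq> 0 \<and> y = c *\<^sub>R x)"
proof -
  let ?r = "\<lambda>x y::'a. x \<noteq> 0 \<and> y \<noteq> 0 \<and> (\<exists>c::real. c \<noteq> 0 \<and> y = c *\<^sub>R x)"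
  have "?r z z" if "z \<noteq> 0" for z using that by (auto intro!: exI[of _ 1])
  with Quotient3_rel[OF Quotient3_pspace, of x y] assms show ?thesis by auto
qed

lemma abs_pspace_scaleR:
  fixes x :: "'a::euclidean_space"
  assumes "x \<noteq> 0" "c \<noteq> 0"
  shows "abs_pspace (c *\<^sub>R x) = abs_pspace x"
  using assms abs_pspace_eq_iff[of x "c *\<^sub>R x"] by auto

lemma inj_on_abs_pspace:
  fixes X :: "'a::euclidean_space set"
  assumes "X \<subseteq> {x. h \<bullet> x = 1}"
  shows "inj_on abs_pspace X"
proof (rule inj_onI)
  fix x y assume "x \<in> X" "y \<in> X" and eq: "abs_pspace x = abs_pspace y"
  then have h: "h \<bullet> x = 1" "h \<bullet> y = 1" using assms by auto
  then have "x \<noteq> 0" "y \<noteq> 0" by auto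
  with eq obtain c where c: "y = c *\<^sub>R x" using abs_pspace_eq_iff by blast
  with h have "c = 1" by simp
  with c show "x = y" by simp
qed

text \<open>The central projection onto the hyperplane \<open>h \<bullet> x = 1\<close>; where
  \<open>h \<bullet> x = 0\<close> it has the default value 0.\<close>

definition dehom :: "'a::euclidean_space \<Rightarrow> 'a \<Rightarrow> 'a" where
  "dehom h x = (1 / (h \<bullet> x)) *\<^sub>R x"

text \<open>\<open>h'\<close> has no zero on the convex set \<open>R\<close>, hence one sign on it,
  and the central projection then only reweights the two ends of a segment. Faces are defined by
  open segments, so this is what makes them independent of the chart.\<close>

lemma dehom_open_segment:
  fixes h' :: "'a::euclidean_space"
  assumes R: "convex R" "R \<subseteq> {x. h \<bullet> x = 1}" and nz: "\<And>x. x \<in> R \<Longrightarrow> h' \<bullet> x \<noteq> 0"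
    and ab: "a \<in> R" "b \<in> R" and x: "x \<in> open_segment a b"
  shows "dehom h' x \<in> open_segment (dehom h' a) (dehom h' b)"
proof -
  define \<alpha> \<beta> where "\<alpha> = h' \<bullet> a" and "\<beta> = h' \<bullet> b"
  have nz': "\<alpha> \<noteq> 0" "\<beta> \<noteq> 0" using ab nz by (auto simp: \<alpha>_def \<beta>_def)
  obtain u where u: "0 < u" "u < 1" "x = (1 - u) *\<^sub>R a + u *\<^sub>R b" and ne: "a \<noteq> b"
    using x by (auto simp: in_segment)
  have same: "0 < \<alpha> * \<beta>"
  proof (rule ccontr)
    assume "\<not> 0 < \<alpha> * \<beta>"
    then have neg: "\<alpha> * \<beta> < 0" using nz' by (simp add: less_le)
    \<comment> \<open>The parameter at which \<open>h'\<close>, being affine along the segment,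
      would vanish.\<close>
    define s where "s = \<alpha> / (\<alpha> - \<beta>)"
    have "\<alpha> \<noteq> \<beta>" using neg by (auto simp: not_square_less_zero)
    have s: "0 \<le> s" "s \<le> 1" using neg
      by (auto simp: s_def divide_simps mult_less_0_iff split: if_splits)
    have "(1 - s) *\<^sub>R a + s *\<^sub>R b \<in> R" using R(1) ab s by (simp add: convexD_alt)
    moreover have "h' \<bullet> ((1 - s) *\<^sub>R a + s *\<^sub>R b) = 0"
      using \<open>\<alpha> \<noteq> \<beta>\<close> unfolding inner_add_right inner_scaleR_right \<alpha>_def[symmetric] \<beta>_def[symmetric]
      by (simp add: s_def field_simps)
    ultimately show False using nz by blast
  qed
  define \<gamma> where "\<gamma> = (1 - u) * \<alpha> + u * \<beta>"
  have g: "h' \<bullet> x = \<gamma>" by (simp add: u(3) inner_add_right \<alpha>_def \<beta>_def \<gamma>_def)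
  have "x \<in> R" using R(1) ab u by (simp add: convexD_alt)
  then have g0: "\<gamma> \<noteq> 0" using nz g by force
  have "0 < \<alpha> * \<gamma>" "0 < \<beta> * \<gamma>"
  proof -
    have sq: "0 < \<alpha> * \<alpha>" "0 < \<beta> * \<beta>" using nz' not_real_square_gt_zero by blast+
    have "\<alpha> * \<gamma> = (1-u) * (\<alpha> * \<alpha>) + u * (\<alpha> * \<beta>)" "\<beta> * \<gamma> = (1-u) * (\<alpha> * \<beta>) + u * (\<beta> * \<beta>)"
      by (auto simp: \<gamma>_def algebra_simps)
    then show "0 < \<alpha> * \<gamma>" "0 < \<beta> * \<gamma>"
      using u same sq by (metis add_pos_pos diff_gt_0_iff_gt mult_pos_pos)+
  qed
  \<comment> \<open>The weights \<open>1 - u\<close> and \<open>u\<close> are multiplied by the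
    values of \<open>h'\<close> at the two ends and divided by the sum \<gamma> of the
    results.\<close>
  define v where "v = u * \<beta> / \<gamma>"
  have v0: "0 < v" using u \<open>0 < \<beta> * \<gamma>\<close> by (auto simp: v_def zero_less_divide_iff zero_less_mult_iff mult_less_0_iff)
  have v1: "1 - v = (1 - u) * \<alpha> / \<gamma>" using g0 by (simp add: v_def \<gamma>_def field_simps)
  then have "0 < 1 - v" using u \<open>0 < \<alpha> * \<gamma>\<close> by (auto simp: zero_less_divide_iff zero_less_mult_iff mult_less_0_iff)
  moreover have "dehom h' x = (1 - v) *\<^sub>R dehom h' a + v *\<^sub>R dehom h' b"
  proof -
    have "dehom h' x = (1/\<gamma>) *\<^sub>R ((1 - u) *\<^sub>R a + u *\<^sub>R b)" by (simp only: dehom_def g u(3)[symmetric])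
    also have "\<dots> = ((1 - u) * \<alpha> / \<gamma>) *\<^sub>R (1/\<alpha>) *\<^sub>R a + (u * \<beta> / \<gamma>) *\<^sub>R (1/\<beta>) *\<^sub>R b"
      using nz' by (simp add: scaleR_add_right)
    finally show ?thesis unfolding v1 by (simp add: v_def dehom_def \<alpha>_def \<beta>_def)
  qed
  moreover have "dehom h' a \<noteq> dehom h' b"
  proof
    assume eq: "dehom h' a = dehom h' b"
    have "h \<bullet> dehom h' a = 1 / \<alpha>" "h \<bullet> dehom h' b = 1 / \<beta>"
      using ab R(2) by (auto simp: dehom_def \<alpha>_def \<beta>_def)
    with eq have "\<alpha> = \<beta>" by simp
    with eq nz' ne show False by (simp add: dehom_def \<alpha>_def \<beta>_def)
  qed
  ultimately show ?thesis using v0 by (auto simp: in_segment)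
qed

lemma affine_model_dehom:
  fixes h' :: "'a::euclidean_space"
  assumes R: "R \<subseteq> {x. h \<bullet> x = 1}" and R': "R' \<subseteq> {x. h' \<bullet> x = 1}"
    and eq: "abs_pspace ` R = abs_pspace ` R'" and x: "x \<in> R"
  shows "h' \<bullet> x \<noteq> 0" "dehom h' x \<in> R'" "dehom h (dehom h' x) = x"
    "abs_pspace (dehom h' x) = abs_pspace x"
proof -
  have hx: "h \<bullet> x = 1" "x \<noteq> 0" using R x by auto
  obtain y where y: "y \<in> R'" "abs_pspace x = abs_pspace y" using eq x by (metis imageE imageI)
  have hy: "h' \<bullet> y = 1" "y \<noteq> 0" using R' y by auto
  obtain c where c: "c \<noteq> 0" "y = c *\<^sub>R x" using hx hy y abs_pspace_eq_iff by blast
  have e: "h' \<bullet> x = 1 / c" using hy c by (simp add: field_simps)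
  show "h' \<bullet> x \<noteq> 0" using e c by simp
  have d: "dehom h' x = y" by (simp add: dehom_def e c)
  show "dehom h' x \<in> R'" using d y by simp
  show "dehom h (dehom h' x) = x" unfolding d using hx c by (simp add: dehom_def)
  show "abs_pspace (dehom h' x) = abs_pspace x" using d y by simp
qed

lemma dim_dehom_image:
  assumes "\<And>x. x \<in> G \<Longrightarrow> h' \<bullet> x \<noteq> 0"
  shows "dim (dehom h' ` G) = dim G"
proof -
  have "span (dehom h' ` G) = span G"
  proof
    show "span (dehom h' ` G) \<subseteq> span G"
      by (rule span_minimal) (auto simp: dehom_def span_base span_mul)
    have "x \<in> span (dehom h' ` G)" if "x \<in> G" for x
    proof -
      have "x = (h' \<bullet> x) *\<^sub>R dehom h' x" using assms[OF that] by (simp add: dehom_def)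
      then show ?thesis using that by (metis imageI span_base span_mul)
    qed
    then show "span G \<subseteq> span (dehom h' ` G)" by (intro span_minimal) auto
  qed
  then show ?thesis by (metis dim_span)
qed

text \<open>The affine hull avoids the origin, so adjoining 0 raises the affine dimension by one and
  turns it into the linear dimension. The latter is unchanged when points are rescaled, so it
  compares different charts.\<close>

lemma aff_dim_hyperplane_section:
  fixes G :: "'a::euclidean_space set"
  assumes "G \<subseteq> {x. h \<bullet> x = 1}"
  shows "aff_dim G = int (dim G) - 1"
proof -
  have "affine hull G \<subseteq> {x. h \<bullet> x = 1}"
    by (rule hull_minimal) (use assms in \<open>auto simp: affine_hyperplane\<close>)
  then have "0 \<notin> affine hull G" by auto
  moreover have "aff_dim (insert 0 G) = int (dim (insert 0 G))"
    by (rule aff_dim_zero) (simp add: hull_inc)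
  ultimately show ?thesis by (simp add: aff_dim_insert dim_insert span_zero)
qed

text \<open>The inverse map is \<open>dehom h\<close>, and both maps send open segments into open
  segments.\<close>

lemma dehom_face_of:
  fixes h' :: "'a::euclidean_space"
  assumes R: "convex R" "R \<subseteq> {x. h \<bullet> x = 1}" and R': "convex R'" "R' \<subseteq> {x. h' \<bullet> x = 1}"
    and eq: "abs_pspace ` R = abs_pspace ` R'" and G: "G face_of R"
  shows "dehom h' ` G face_of R'" "abs_pspace ` dehom h' ` G = abs_pspace ` G"
    "aff_dim (dehom h' ` G) = aff_dim G"
proof -
  note a = affine_model_dehom[OF R(2) R'(2) eq]
  note b = affine_model_dehom[OF R'(2) R(2) eq[symmetric]]
  have GR: "G \<subseteq> R" using G by (rule face_of_imp_subset)
  have seg: "dehom h p \<in> open_segment (dehom h u) (dehom h v)"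
    if "p \<in> open_segment u v" "u \<in> R'" "v \<in> R'" for p u v
    using dehom_open_segment[OF R' b(1) that(2,3,1)] .
  have inR': "p \<in> R'" if "p \<in> open_segment u v" "u \<in> R'" "v \<in> R'" for p u v
    using that R'(1) by (meson convex_contains_open_segment subsetD)
  have "convex (dehom h' ` G)"
    unfolding convex_contains_open_segment
  proof (intro ballI subsetI)
    fix u v p assume uv: "u \<in> dehom h' ` G" "v \<in> dehom h' ` G" and p: "p \<in> open_segment u v"
    then have uvR: "u \<in> R'" "v \<in> R'" using GR a by auto
    have "dehom h u \<in> G" "dehom h v \<in> G" using uv GR a(3) by auto
    then have "dehom h p \<in> G" using seg[OF p uvR] face_of_imp_convex[OF G]
      by (meson convex_contains_open_segment subsetD)
    moreover have "p = dehom h' (dehom h p)" using b(3) inR'[OF p uvR] by simp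
    ultimately show "p \<in> dehom h' ` G" by blast
  qed
  moreover have "u \<in> dehom h' ` G \<and> v \<in> dehom h' ` G"
    if "u \<in> R'" "v \<in> R'" "p \<in> dehom h' ` G" "p \<in> open_segment u v" for u v p
  proof -
    have "dehom h p \<in> G" using that GR a(3) by auto
    then have "dehom h u \<in> G" "dehom h v \<in> G"
      using face_ofD[OF G seg[OF that(4,1,2)]] b(2) that by auto
    then show ?thesis using b(3) that by (metis imageI)
  qed
  ultimately show "dehom h' ` G face_of R'"
    unfolding face_of_def using GR a(2) by blast
  show "abs_pspace ` dehom h' ` G = abs_pspace ` G"
    unfolding image_image by (rule image_cong) (use a(4) GR in auto)
  have "dehom h' ` G \<subseteq> {x. h' \<bullet> x = 1}" using a(2) GR R' by blast
  moreover have "dim (dehom h' ` G) = dim G" by (rule dim_dehom_image) (use a(1) GR in auto)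
  ultimately show "aff_dim (dehom h' ` G) = aff_dim G"
    using aff_dim_hyperplane_section[of G h] aff_dim_hyperplane_section[of "dehom h' ` G" h'] GR R(2)
    by auto
qed

lemma affine_models_faces:
  assumes "affine_model Q R" "affine_model Q R'" "G face_of R"
  shows "\<exists>G'. G' face_of R' \<and> abs_pspace ` G' = abs_pspace ` G \<and> aff_dim G' = aff_dim G"
proof -
  obtain h h' where "polytope R" "R \<subseteq> {x. h \<bullet> x = 1}" "polytope R'" "R' \<subseteq> {x. h' \<bullet> x = 1}"
    "abs_pspace ` R = abs_pspace ` R'"
    using assms(1,2) unfolding affine_model_def by auto
  with dehom_face_of[of R h R' h' G] assms(3) show ?thesis
    by (metis polytope_imp_convex)
qed

lemma affine_models_aff_dim:
  assumes "affine_model Q R" "affine_model Q R'"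
  shows "aff_dim R' = aff_dim R"
proof -
  have c: "convex R" "convex R'" using assms polytope_imp_convex unfolding affine_model_def by auto
  obtain h h' where h: "R \<subseteq> {x. h \<bullet> x = 1}" "R' \<subseteq> {x. h' \<bullet> x = 1}" 
    and eq: "abs_pspace ` R = abs_pspace ` R'"
    using assms unfolding affine_model_def by auto
  have "dehom h' ` R = R'"
  proof
    show "dehom h' ` R \<subseteq> R'" using affine_model_dehom[OF h eq] by auto
    show "R' \<subseteq> dehom h' ` R"
      using affine_model_dehom[OF h(2,1) eq[symmetric]] by (metis imageI subsetI)
  qed
  then show ?thesis using dehom_face_of(3)[OF c(1) h(1) c(2) h(2) eq face_of_refl[OF c(1)]] by simp
qed

text \<open>The definition admits any affine model; since \<open>dehom\<close> carries faces from
  one model to another, a single model decides.\<close>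

lemma proj_face_iff:
  assumes "affine_model Q R"
  shows "proj_face F Q \<longleftrightarrow> (\<exists>G. G face_of R \<and> F = abs_pspace ` G)"
  unfolding proj_face_def using assms affine_models_faces[of Q _ R] by metis

lemma proj_polytope_iff:
  assumes "affine_model Q R"
  shows "proj_polytope d Q \<longleftrightarrow> aff_dim R = d"
  unfolding proj_polytope_def using assms affine_models_aff_dim by blast

lemma proj_facet_iff:
  assumes "affine_model Q R"
  shows "proj_facet F Q \<longleftrightarrow> (\<exists>G. G facet_of R \<and> F = abs_pspace ` G)"
proof
  assume "proj_facet F Q"
  then obtain R' G where R': "affine_model Q R'" "G facet_of R'" "F = abs_pspace ` G"
    unfolding proj_facet_def by blast
  then obtain G' where "G' face_of R" "abs_pspace ` G' = abs_pspace ` G" "aff_dim G' = aff_dim G"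
    using affine_models_faces[OF R'(1) assms] by (metis facet_of_imp_face_of)
  then show "\<exists>G. G facet_of R \<and> F = abs_pspace ` G"
    using R' affine_models_aff_dim[OF assms R'(1)] unfolding facet_of_def
    by (intro exI[of _ G']) auto
qed (use assms proj_facet_def in blast)

lemma continuous_on_abs_pspace: "continuous_on (- {0::'a::euclidean_space}) abs_pspace"
  unfolding continuous_on_open_invariant
proof (intro allI impI)
  fix B :: "'a pspace set" assume "open B"
  then have "open {x::'a. x \<noteq> 0 \<and> abs_pspace x \<in> B}" by (simp add: open_pspace_def)
  moreover have "{x::'a. x \<noteq> 0 \<and> abs_pspace x \<in> B} \<inter> - {0} = abs_pspace -` B \<inter> - {0}" by auto
  ultimately show "\<exists>A. open A \<and> A \<inter> - {0::'a} = abs_pspace -` B \<inter> - {0}" by blast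
qed

text \<open>An arbitrary representative serves, because \<open>dehom h\<close> takes the same value
  on all nonzero multiples of a vector.\<close>

definition chart :: "'a::euclidean_space \<Rightarrow> 'a pspace \<Rightarrow> 'a" where
  "chart h p = dehom h (rep_pspace p)"

lemma chart_abs:
  fixes x :: "'a::euclidean_space"
  assumes "x \<noteq> 0"
  shows "chart h (abs_pspace x) = dehom h x"
proof -
  let ?r = "\<lambda>x y::'a. x \<noteq> 0 \<and> y \<noteq> 0 \<and> (\<exists>c::real. c \<noteq> 0 \<and> y = c *\<^sub>R x)"
  have "?r (rep_pspace (abs_pspace x)) x"
    by (rule rep_abs_rsp_left[OF Quotient3_pspace]) (use assms in \<open>auto intro!: exI[of _ 1]\<close>)
  then obtain c where "c \<noteq> 0" "x = c *\<^sub>R rep_pspace (abs_pspace x)" by blast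
  moreover have "dehom h (c *\<^sub>R y) = dehom h y" for y
    using \<open>c \<noteq> 0\<close> by (simp add: dehom_def)
  ultimately have "dehom h x = dehom h (rep_pspace (abs_pspace x))" by metis
  then show ?thesis by (simp add: chart_def)
qed

lemma homeomorphism_chart:
  assumes "X \<subseteq> {x. h \<bullet> x = 1}"
  shows "homeomorphism X (abs_pspace ` X) abs_pspace (chart h)"
proof (rule homeomorphismI)
  have nz: "x \<noteq> 0" if "x \<in> X" for x using assms that by auto
  show "continuous_on X abs_pspace"
    by (rule continuous_on_subset[OF continuous_on_abs_pspace]) (use nz in auto)
  have ch: "chart h (abs_pspace x) = x" if "x \<in> X" for x
    using that assms nz[OF that] by (auto simp: chart_abs dehom_def)
  then show "chart h ` abs_pspace ` X \<subseteq> X" "\<And>x. x \<in> X \<Longrightarrow> chart h (abs_pspace x) = x" 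
    "\<And>y. y \<in> abs_pspace ` X \<Longrightarrow> abs_pspace (chart h y) = y" by auto
  show "continuous_on (abs_pspace ` X) (chart h)"
    unfolding continuous_on_open_invariant
  proof (intro allI impI)
    fix B :: "'a set" assume B: "open B"
    have c: "continuous_on {x. h \<bullet> x \<noteq> 0} (dehom h)"
      unfolding dehom_def by (intro continuous_intros) auto
    have o: "open {x. h \<bullet> x \<noteq> 0}"
      by (simp add: open_Collect_neq continuous_on_inner continuous_on_const continuous_on_id)
    have oP: "open ({x. h \<bullet> x \<noteq> 0} \<inter> dehom h -` B)"
      using continuous_open_preimage[OF c o B] .
    \<comment> \<open>The open set of vectors mapped here is closed under nonzero scaling, so it is
      the full preimage of \<open>A\<close>, and \<open>A\<close> is open in the quotient
      topology.\<close>
    define A where "A = abs_pspace ` ({x. h \<bullet> x \<noteq> 0} \<inter> dehom h -` B)"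
    have "{x. x \<noteq> 0 \<and> abs_pspace x \<in> A} = {x. h \<bullet> x \<noteq> 0} \<inter> dehom h -` B"
    proof (intro set_eqI iffI)
      fix x assume "x \<in> {x. x \<noteq> 0 \<and> abs_pspace x \<in> A}"
      then obtain y where y: "x \<noteq> 0" "h \<bullet> y \<noteq> 0" "dehom h y \<in> B" "abs_pspace x = abs_pspace y"
        by (auto simp: A_def)
      then have "y \<noteq> 0" by auto
      then obtain c where c: "c \<noteq> 0" "y = c *\<^sub>R x" using y abs_pspace_eq_iff by blast
      have "dehom h x = dehom h y" using y \<open>y \<noteq> 0\<close> by (metis chart_abs)
      then show "x \<in> {x. h \<bullet> x \<noteq> 0} \<inter> dehom h -` B" using y c by auto
    qed (auto simp: A_def)
    then have "open A" using oP by (simp add: open_pspace_def)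
    moreover have "A \<inter> abs_pspace ` X = chart h -` B \<inter> abs_pspace ` X"
    proof (intro set_eqI iffI)
      fix p assume "p \<in> A \<inter> abs_pspace ` X"
      then obtain x y where x: "x \<in> X" "p = abs_pspace x" 
        and y: "h \<bullet> y \<noteq> 0" "dehom h y \<in> B" "p = abs_pspace y"
        by (auto simp: A_def)
      then have "y \<noteq> 0" by auto
      with y x have "chart h p \<in> B" by (simp add: chart_abs)
      then show "p \<in> chart h -` B \<inter> abs_pspace ` X" using x by auto
    next
      fix p assume p: "p \<in> chart h -` B \<inter> abs_pspace ` X"
      then obtain x where x: "x \<in> X" "p = abs_pspace x" by auto
      then have "h \<bullet> x \<noteq> 0" "dehom h x \<in> B" using p assms nz by (auto simp: chart_abs)
      then show "p \<in> A \<inter> abs_pspace ` X" using x unfolding A_def by auto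
    qed
    ultimately show "\<exists>A. open A \<and> A \<inter> abs_pspace ` X = chart h -` B \<inter> abs_pspace ` X" by blast
  qed
qed auto

section \<open>Indices modulo 7\<close>

lemma UNIV_7: "(UNIV::7 set) = {0,1,2,3,4,5,6}"
  by (rule sym, rule card_subset_eq) simp_all

lemma mod7 [simp]: "(7::7) = 0" "(8::7) = 1" "(9::7) = 2" "(10::7) = 3" "(11::7) = 4" "(12::7) = 5" "(13::7) = 6"
  by simp_all

text \<open>Together with \<open>mod7\<close> this keeps every index in the form
  \<open>k + n\<close> with one reduced numeral, where equality is decided by
  simplification.\<close>

lemma add7 [simp]:
  "(k::7) + numeral m + numeral n = k + numeral (m + n)" "k + 1 + numeral n = k + numeral (Num.One + n)"
  "k + numeral m + 1 = k + numeral (m + Num.One)" "k + 1 + 1 = k + 2"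
  by (simp_all only: add.assoc numeral_plus_numeral one_plus_numeral numeral_plus_one one_add_one)

lemma all7: "(\<forall>k::7. P k) \<longleftrightarrow> P 0 \<and> P 1 \<and> P 2 \<and> P 3 \<and> P 4 \<and> P 5 \<and> P 6"
proof -
  have "(\<forall>k::7. P k) \<longleftrightarrow> (\<forall>k\<in>UNIV. P k)" by simp
  then show ?thesis unfolding UNIV_7 by simp
qed

lemma ex7: "(\<exists>k::7. P k) \<longleftrightarrow> P 0 \<or> P 1 \<or> P 2 \<or> P 3 \<or> P 4 \<or> P 5 \<or> P 6"
  using all7[of "\<lambda>k. \<not> P k"] by blast

text \<open>Listing the residues from an arbitrary \<open>k\<close> onwards lets one check serve for
  all seven rotations.\<close>

lemma all7_shift:
  "(\<forall>i::7. P i) \<longleftrightarrow> P k \<and> P (k+1) \<and> P (k+2) \<and> P (k+3) \<and> P (k+4) \<and> P (k+5) \<and> P (k+6)"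
proof -
  have "(\<forall>i. P i) \<longleftrightarrow> (\<forall>i. P (k + i))" by (metis add.commute diff_add_cancel)
  then show ?thesis by (simp only: all7) simp
qed

lemma cases7:
  fixes i k :: 7
  obtains "i = k" | "i = k+1" | "i = k+2" | "i = k+3" | "i = k+4" | "i = k+5" | "i = k+6"
proof -
  have "\<forall>i. i = k \<or> i = k+1 \<or> i = k+2 \<or> i = k+3 \<or> i = k+4 \<or> i = k+5 \<or> i = k+6"
    by (simp only: all7_shift[of _ k]) simp
  then show ?thesis using that by blast
qed

lemma sum7: "(\<Sum>k\<in>(UNIV::7 set). g k) = g 0 + g 1 + g 2 + g 3 + g 4 + g 5 + g 6"
  for g :: "7 \<Rightarrow> 'b::comm_monoid_add"
  unfolding UNIV_7 by (simp add: add.assoc)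

lemma sum7_shift: 
  "(\<Sum>i\<in>(UNIV::7 set). g i) = g k + g (k+1) + g (k+2) + g (k+3) + g (k+4) + g (k+5) + g (k+6)"
  for g :: "7 \<Rightarrow> 'b::comm_monoid_add"
proof -
  have "bij ((+) k)" by (rule bijI) (auto simp: surj_def intro: exI[of _ "_ - k"])
  then have "(\<Sum>i\<in>UNIV. g i) = (\<Sum>i\<in>UNIV. g (k + i))"
    using sum.reindex_bij_betw[of "(+) k" UNIV UNIV g] by simp
  then show ?thesis by (simp add: sum7)
qed

definition good :: "7 set \<Rightarrow> bool" where
  "good Z \<longleftrightarrow> (\<forall>i. \<not> (i \<in> Z \<and> i + 2 \<in> Z \<and> i + 4 \<in> Z))"

text \<open>The zero sets of the vertices \<open>V k\<close> and \<open>U k\<close>, which are the maximal good sets.\<close>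

definition zV :: "7 \<Rightarrow> 7 set" where "zV k = {k, k+1, k+2, k+3}"
definition zU :: "7 \<Rightarrow> 7 set" where "zU k = {k, k+1, k+3, k+4}"

lemma sub_zV: "Z \<subseteq> zV k \<longleftrightarrow> k + 4 \<notin> Z \<and> k + 5 \<notin> Z \<and> k + 6 \<notin> Z"
proof -
  have "Z \<subseteq> zV k \<longleftrightarrow> (\<forall>i. i \<in> Z \<longrightarrow> i \<in> zV k)" by blast
  then show ?thesis by (simp add: all7_shift[of _ k] zV_def)
qed

lemma sub_zU: "Z \<subseteq> zU k \<longleftrightarrow> k + 2 \<notin> Z \<and> k + 5 \<notin> Z \<and> k + 6 \<notin> Z"
proof -
  have "Z \<subseteq> zU k \<longleftrightarrow> (\<forall>i. i \<in> Z \<longrightarrow> i \<in> zU k)" by blast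
  then show ?thesis by (simp add: all7_shift[of _ k] zU_def)
qed

lemma good_iff: "good Z \<longleftrightarrow> (\<exists>k. Z \<subseteq> zV k \<or> Z \<subseteq> zU k)"
proof
  assume g: "good Z"
  show "\<exists>k. Z \<subseteq> zV k \<or> Z \<subseteq> zU k"
  proof (rule ccontr)
    assume n: "\<not> ?thesis"
    have V: "k + 4 \<in> Z \<or> k + 5 \<in> Z \<or> k + 6 \<in> Z" for k using n sub_zV[of Z k] by blast
    have U: "k + 2 \<in> Z \<or> k + 5 \<in> Z \<or> k + 6 \<in> Z" for k using n sub_zU[of Z k] by blast
    have G: "\<not> (k \<in> Z \<and> k + 2 \<in> Z \<and> k + 4 \<in> Z)" for k using g unfolding good_def by blast
    \<comment> \<open>Instantiated at all seven residues, this is a propositional statement about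
      the seven memberships in \<open>Z\<close>.\<close>
    show False
      using V[of 0] V[of 1] V[of 2] V[of 3] V[of 4] V[of 5] V[of 6]
        U[of 0] U[of 1] U[of 2] U[of 3] U[of 4] U[of 5] U[of 6]
        G[of 0] G[of 1] G[of 2] G[of 3] G[of 4] G[of 5] G[of 6]
      by simp sat
  qed
next
  assume "\<exists>k. Z \<subseteq> zV k \<or> Z \<subseteq> zU k"
  then obtain k where "Z \<subseteq> zV k \<or> Z \<subseteq> zU k" by blast
  then show "good Z"
    unfolding good_def sub_zV sub_zU by (simp only: all7_shift[of _ k]) (auto simp: add.assoc)
qed

text \<open>A good set is the intersection of the maximal good sets that contain it; geometrically,
  a face is determined by its vertices.\<close>

lemma good_separate:
  assumes "good J" "i \<notin> J"
  shows "\<exists>k. (J \<subseteq> zV k \<and> i \<notin> zV k) \<or> (J \<subseteq> zU k \<and> i \<notin> zU k)"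
proof -
  have g: "\<not> (i + j \<in> J \<and> i + j + 2 \<in> J \<and> i + j + 4 \<in> J)" for j
    using assms(1) unfolding good_def by blast
  have V: "i + j + 4 \<in> J \<or> i + j + 5 \<in> J \<or> i + j + 6 \<in> J" if "\<not> ?thesis" "i \<notin> zV (i + j)" for j
    using that sub_zV[of J "i+j"] by blast
  have U: "i + j + 2 \<in> J \<or> i + j + 5 \<in> J \<or> i + j + 6 \<in> J" if "\<not> ?thesis" "i \<notin> zU (i + j)" for j
    using that sub_zU[of J "i+j"] by blast
  show ?thesis
  proof (rule ccontr)
    assume n: "\<not> ?thesis"
    \<comment> \<open>The offsets are exactly those whose translate misses \<open>i\<close>: 1, 2, 3
      for \<open>zV\<close> and 1, 2, 5 for \<open>zU\<close>.\<close>
    show False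
      using assms(2) V[OF n, of 1] V[OF n, of 2] V[OF n, of 3]
        U[OF n, of 1] U[OF n, of 2] U[OF n, of 5]
        g[of 1] g[of 2] g[of 3] g[of 4] g[of 5] g[of 6]
      by (simp add: zV_def zU_def add.commute[of i]) blast
  qed
qed

lemma good_mono:
  assumes "good Z" "Y \<subseteq> Z"
  shows "good Y"
  unfolding good_def
proof
  fix i
  show "\<not> (i \<in> Y \<and> i + 2 \<in> Y \<and> i + 4 \<in> Y)"
    using assms(2) assms(1)[unfolded good_def, rule_format, of i] by auto
qed

lemma good_empty: "good {}" by (simp add: good_def)

lemma card_zV: "card (zV k) = 4" and card_zU: "card (zU k) = 4"
  by (auto simp: zV_def zU_def)

lemma good_zV: "good (zV k)" and good_zU: "good (zU k)"
  unfolding good_iff by (rule exI[of _ k], simp)+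

section \<open>Seven functionals in alternating position\<close>

text \<open>\<open>l m\<close> are the coefficients of the relation between the six functionals other than \<open>a m\<close>; the value
  \<open>l m 0\<close> is irrelevant.\<close>

locale alternating =
  fixes a :: "7 \<Rightarrow> real^5" and l :: "7 \<Rightarrow> 7 \<Rightarrow> real" and c :: "real^5"
  assumes l_pos: "l m i > 0"
    and alt: "l m 1 * (a (m+1) \<bullet> x) + l m 3 * (a (m+3) \<bullet> x) + l m 5 * (a (m+5) \<bullet> x)
            = l m 2 * (a (m+2) \<bullet> x) + l m 4 * (a (m+4) \<bullet> x) + l m 6 * (a (m+6) \<bullet> x)"
    and a_c: "a i \<bullet> c = 1"
    and a_inj: "(\<And>i. a i \<bullet> x = 0) \<Longrightarrow> x = 0"
begin

abbreviation f :: "7 \<Rightarrow> real^5 \<Rightarrow> real" where "f i x \<equiv> a i \<bullet> x"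

lemma l_ne [simp]: "l m i \<noteq> 0" using l_pos[of m i] by simp

lemma f_single_zero:
  assumes "\<And>i. i \<noteq> m \<Longrightarrow> i \<noteq> p \<Longrightarrow> f i x = 0" "p \<noteq> m"
  shows "f p x = 0"
proof -
  have z: "f (m+j) x = 0" if "j \<noteq> 0" "m + j \<noteq> p" for j
    using assms(1)[of "m+j"] that by simp
  show ?thesis
    by (cases p m rule: cases7) (use alt[of m x] z assms(2) in simp_all)
qed

text \<open>Any five of the functionals are independent: the relation that omits \<open>q\<close>
  contains \<open>f p\<close> as its only unknown term, and conversely. For \<open>p = q\<close> the
  relation that omits \<open>p + 1\<close> serves.\<close>

lemma f_zero5:
  assumes "\<And>i. i \<noteq> p \<Longrightarrow> i \<noteq> q \<Longrightarrow> f i x = 0"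
  shows "x = 0"
proof (rule a_inj)
  fix i
  have "f p x = 0" if "p \<noteq> q" using f_single_zero[of q p x] assms that by blast
  moreover have "f q x = 0" if "p \<noteq> q" using f_single_zero[of p q x] assms that by blast
  moreover have "f p x = 0" if "p = q" using f_single_zero[of "p+1" p x] assms that by simp
  ultimately have "f p x = 0" "p \<noteq> q \<Longrightarrow> f q x = 0" by blast+
  then show "f i x = 0" using assms[of i] by (cases "i = p"; cases "i = q") auto
qed

lemma vanish4_ex: "\<exists>x. x \<noteq> 0 \<and> f i x = 0 \<and> f j x = 0 \<and> f k x = 0 \<and> f m x = 0"
proof -
  let ?S = "{a i, a j, a k, a m}"
  have "dim ?S \<le> card ?S" by (rule dim_le_card') simp
  also have "\<dots> \<le> 4" by (intro card_insert_le_m1) auto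
  finally have "dim ?S < DIM(real^5)" by simp
  then obtain x where "x \<noteq> 0" "\<And>y. y \<in> span ?S \<Longrightarrow> orthogonal x y"
    using orthogonal_to_subspace_exists by blast
  then show ?thesis by (metis inner_commute insert_iff orthogonal_def span_base)
qed

text \<open>The sum of the functionals is positive on every nonzero point of the cone, so the whole
  chamber lies in the chart given by \<open>hv\<close>; the factor 1/7 gives \<open>c\<close> the
  height 1.\<close>

definition hv :: "real^5" where "hv = (1/7) *\<^sub>R (\<Sum>i\<in>UNIV. a i)"

lemma hv: "hv \<bullet> x = (\<Sum>i\<in>UNIV. f i x) / 7"
  by (simp add: hv_def inner_sum_left)

lemma hv_c: "hv \<bullet> c = 1" by (simp add: hv a_c)

lemma vertex_normalize:
  assumes "x \<noteq> 0" "\<And>i. i \<in> Z \<Longrightarrow> f i x = 0" "(\<forall>i. i \<notin> Z \<longrightarrow> 0 < f i x) \<or> (\<forall>i. i \<notin> Z \<longrightarrow> f i x < 0)"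
  shows "\<exists>x. (\<forall>i. i \<in> Z \<longrightarrow> f i x = 0) \<and> (\<forall>i. i \<notin> Z \<longrightarrow> 0 < f i x) \<and> hv \<bullet> x = 1"
proof -
  have "\<exists>y. y \<noteq> 0 \<and> (\<forall>i. i \<in> Z \<longrightarrow> f i y = 0) \<and> (\<forall>i. i \<notin> Z \<longrightarrow> 0 < f i y)"
    using assms by (elim disjE) (auto intro: exI[of _ x] exI[of _ "-x"])
  then obtain y where y: "y \<noteq> 0" "\<And>i. i \<in> Z \<Longrightarrow> f i y = 0" "\<And>i. i \<notin> Z \<Longrightarrow> 0 < f i y"
    by blast
  have ge: "0 \<le> f i y" for i using y(2,3)[of i] by (cases "i \<in> Z") auto
  have "hv \<bullet> y \<noteq> 0"
  proof
    assume "hv \<bullet> y = 0"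
    then have "(\<Sum>i\<in>UNIV. f i y) = 0" by (simp add: hv)
    then have "f i y = 0" for i using ge by (subst (asm) sum_nonneg_eq_0_iff) auto
    with a_inj y(1) show False by blast
  qed
  moreover have "0 \<le> hv \<bullet> y" unfolding hv using ge by (simp add: sum_nonneg)
  ultimately have "0 < hv \<bullet> y" by simp
  with y show ?thesis by (intro exI[of _ "(1 / (hv \<bullet> y)) *\<^sub>R y"]) auto
qed

lemma same_sign:
  fixes s t p q :: real
  assumes "s * p = t * q" "0 < s" "0 < t"
  shows "(0 < p \<longleftrightarrow> 0 < q) \<and> (p < 0 \<longleftrightarrow> q < 0)"
proof -
  have "0 < s * p \<longleftrightarrow> 0 < p" "s * p < 0 \<longleftrightarrow> p < 0" "0 < t * q \<longleftrightarrow> 0 < q" "t * q < 0 \<longleftrightarrow> q < 0"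
    using assms(2,3) by (auto simp: zero_less_mult_iff mult_less_0_iff)
  then show ?thesis using assms(1) by simp
qed

text \<open>Three values remain. The relations omitting \<open>k+6\<close> and \<open>k+4\<close>
  each retain two of them, in positions of opposite parity and therefore on opposite sides; hence
  all three have the same sign.\<close>

lemma V_ex: "\<exists>x. (\<forall>i. i \<in> zV k \<longrightarrow> f i x = 0) \<and> (\<forall>i. i \<notin> zV k \<longrightarrow> 0 < f i x) \<and> hv \<bullet> x = 1"
proof -
  obtain x where x: "x \<noteq> 0" "f k x = 0" "f (k+1) x = 0" "f (k+2) x = 0" "f (k+3) x = 0"
    using vanish4_ex by blast
  have e: "l (k+6) 5 * f (k+4) x = l (k+6) 6 * f (k+5) x" "l (k+4) 1 * f (k+5) x = l (k+4) 2 * f (k+6) x"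
    using alt[of "k+6" x] alt[of "k+4" x] x by simp_all
  have "f (k+4) x \<noteq> 0"
  proof
    assume "f (k+4) x = 0"
    with x e have "f i x = 0" for i by (cases i k rule: cases7) auto
    with a_inj x(1) show False by blast
  qed
  then have "(\<forall>i. i \<notin> zV k \<longrightarrow> 0 < f i x) \<or> (\<forall>i. i \<notin> zV k \<longrightarrow> f i x < 0)"
    using same_sign[OF e(1) l_pos l_pos] same_sign[OF e(2) l_pos l_pos]
    by (simp add: zV_def all7_shift[of _ k]) linarith
  then show ?thesis
    using x by (intro vertex_normalize[of x]) (auto simp: zV_def)
qed

text \<open>The same sign argument with the relations omitting \<open>k+2\<close> and
  \<open>k+6\<close>: the pairs they retain stand in positions 3, 4 and 3, 6.\<close>

lemma U_ex: "\<exists>x. (\<forall>i. i \<in> zU k \<longrightarrow> f i x = 0) \<and> (\<forall>i. i \<notin> zU k \<longrightarrow> 0 < f i x) \<and> hv \<bullet> x = 1"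
proof -
  obtain x where x: "x \<noteq> 0" "f k x = 0" "f (k+1) x = 0" "f (k+3) x = 0" "f (k+4) x = 0"
    using vanish4_ex by blast
  have e: "l (k+2) 3 * f (k+5) x = l (k+2) 4 * f (k+6) x" "l (k+6) 3 * f (k+2) x = l (k+6) 6 * f (k+5) x"
    using alt[of "k+2" x] alt[of "k+6" x] x by simp_all
  have "f (k+5) x \<noteq> 0"
  proof
    assume "f (k+5) x = 0"
    with x e have "f i x = 0" for i by (cases i k rule: cases7) auto
    with a_inj x(1) show False by blast
  qed
  then have "(\<forall>i. i \<notin> zU k \<longrightarrow> 0 < f i x) \<or> (\<forall>i. i \<notin> zU k \<longrightarrow> f i x < 0)"
    using same_sign[OF e(1) l_pos l_pos] same_sign[OF e(2) l_pos l_pos]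
    by (simp add: zU_def all7_shift[of _ k]) linarith
  then show ?thesis
    using x by (intro vertex_normalize[of x]) (auto simp: zU_def)
qed

definition V :: "7 \<Rightarrow> real^5" where
  "V k = (SOME x. (\<forall>i. i \<in> zV k \<longrightarrow> f i x = 0) \<and> (\<forall>i. i \<notin> zV k \<longrightarrow> 0 < f i x) \<and> hv \<bullet> x = 1)"
definition U :: "7 \<Rightarrow> real^5" where
  "U k = (SOME x. (\<forall>i. i \<in> zU k \<longrightarrow> f i x = 0) \<and> (\<forall>i. i \<notin> zU k \<longrightarrow> 0 < f i x) \<and> hv \<bullet> x = 1)"

lemma f_V: "i \<in> zV k \<Longrightarrow> f i (V k) = 0" "i \<notin> zV k \<Longrightarrow> 0 < f i (V k)" and hv_V: "hv \<bullet> V k = 1"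
  using someI_ex[OF V_ex[of k]] by (auto simp: V_def)

lemma f_U: "i \<in> zU k \<Longrightarrow> f i (U k) = 0" "i \<notin> zU k \<Longrightarrow> 0 < f i (U k)" and hv_U: "hv \<bullet> U k = 1"
  using someI_ex[OF U_ex[of k]] by (auto simp: U_def)

text \<open>The affine model of the chamber in the chart \<open>hv\<close>: a compact section of the
  cone.\<close>

definition R :: "(real^5) set" where "R = {x. (\<forall>i. 0 \<le> f i x) \<and> hv \<bullet> x = 1}"
definition FC :: "7 set \<Rightarrow> (real^5) set" where "FC J = {x \<in> R. \<forall>j\<in>J. f j x = 0}"
definition Z :: "real^5 \<Rightarrow> 7 set" where "Z x = {i. f i x = 0}"

lemma Z_V: "Z (V k) = zV k" and Z_U: "Z (U k) = zU k"
proof -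
  have "f i (V k) = 0 \<longleftrightarrow> i \<in> zV k" "f i (U k) = 0 \<longleftrightarrow> i \<in> zU k" for i
    using f_V[of i k] f_U[of i k] by (cases "i \<in> zV k"; cases "i \<in> zU k"; simp)+
  then show "Z (V k) = zV k" "Z (U k) = zU k" by (auto simp: Z_def)
qed

lemma V_in_R: "V k \<in> R" and U_in_R: "U k \<in> R"
proof -
  have "0 \<le> f i (V k)" "0 \<le> f i (U k)" for i
    using f_V[of i k] f_U[of i k] by (cases "i \<in> zV k"; cases "i \<in> zU k"; simp)+
  then show "V k \<in> R" "U k \<in> R" by (simp_all add: R_def hv_V hv_U)
qed

lemma FC_iff: "x \<in> FC J \<longleftrightarrow> x \<in> R \<and> J \<subseteq> Z x"
  by (auto simp: FC_def Z_def)

lemma R_nonneg: "x \<in> R \<Longrightarrow> 0 \<le> f i x" by (simp add: R_def)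
lemma R_hv: "x \<in> R \<Longrightarrow> hv \<bullet> x = 1" by (simp add: R_def)
lemma R_nz: "x \<in> R \<Longrightarrow> x \<noteq> 0" by (auto simp: R_def)

lemma convex_R: "convex R"
  unfolding R_def convex_def by (auto simp: inner_add_right)

lemma closed_R: "closed R"
proof -
  have "R = (\<Inter>i. {x. 0 \<le> f i x}) \<inter> {x. hv \<bullet> x = 1}" by (auto simp: R_def)
  then show ?thesis
    using closed_halfspace_ge[of 0] by (auto intro!: closed_Int closed_INT closed_hyperplane)
qed

text \<open>The map to the seven values is linear and injective, hence bounded below; on
  \<open>R\<close> the seven values are nonnegative with sum 7, so each is at most 7.\<close>

lemma bounded_R: "bounded R"
proof -
  let ?F = "\<lambda>x. (\<chi> i. f i x) :: real^7"
  have lin: "linear ?F" by (rule linearI) (auto simp: vec_eq_iff inner_add_right)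
  have "inj ?F"
    using a_inj by (subst linear_injective_0[OF lin]) (auto simp: vec_eq_iff)
  then obtain B where B: "B > 0" "\<And>x. B * norm x \<le> norm (?F x)"
    using linear_inj_bounded_below_pos[OF lin] by blast
  have "norm x \<le> 49 / B" if "x \<in> R" for x
  proof -
    have s: "(\<Sum>i\<in>UNIV. f i x) = 7" using R_hv[OF that] by (simp add: hv)
    have "f i x \<le> 7" for i
      using member_le_sum[of i UNIV "\<lambda>i. f i x"] R_nonneg[OF that] s by simp
    then have "(\<Sum>i\<in>UNIV. \<bar>?F x $ i\<bar>) \<le> (\<Sum>i\<in>(UNIV::7 set). 7)"
      using R_nonneg[OF that] by (intro sum_mono) simp
    then have "norm (?F x) \<le> 49" using norm_le_l1_cart[of "?F x"] by simp
    with B(2)[of x] have "B * norm x \<le> 49" by linarith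
    with B(1) show ?thesis by (simp add: field_simps)
  qed
  then show ?thesis by (auto simp: bounded_iff)
qed

lemma compact_R: "compact R"
  using closed_R bounded_R compact_eq_bounded_closed by blast

text \<open>If \<open>i\<close>, \<open>i+2\<close>, \<open>i+4\<close> are zeros, one side of the
  relation omitting \<open>i+6\<close> vanishes, so the nonnegative terms of the other side vanish
  too. Six zeros force \<open>x = 0\<close>.\<close>

lemma good_Z:
  assumes "x \<in> R"
  shows "good (Z x)"
  unfolding good_def
proof (intro allI notI)
  fix i assume z: "i \<in> Z x \<and> i + 2 \<in> Z x \<and> i + 4 \<in> Z x"
  note ge = R_nonneg[OF assms]
  have "l (i+6) 2 * f (i+1) x + l (i+6) 4 * f (i+3) x + l (i+6) 6 * f (i+5) x = 0"
    using alt[of "i+6" x] z by (simp add: Z_def)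
  moreover have "0 \<le> l (i+6) 2 * f (i+1) x" "0 \<le> l (i+6) 4 * f (i+3) x" "0 \<le> l (i+6) 6 * f (i+5) x"
    using ge l_pos by (simp_all add: less_imp_le)
  ultimately have "l (i+6) 2 * f (i+1) x = 0" "l (i+6) 4 * f (i+3) x = 0" "l (i+6) 6 * f (i+5) x = 0"
    by linarith+
  then have "f (i+1) x = 0" "f (i+3) x = 0" "f (i+5) x = 0" by simp_all
  then have "f j x = 0" if "j \<noteq> i + 6" for j
    using z that by (cases j i rule: cases7) (simp_all add: Z_def)
  then have "x = 0" by (rule f_zero5)
  with R_nz[OF assms] show False by simp
qed

lemma FC_face_of: "FC J face_of R"
  unfolding face_of_def
proof (intro conjI ballI impI)
  show "FC J \<subseteq> R" by (auto simp: FC_def)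
  show "convex (FC J)" using convex_R unfolding FC_def convex_def by (auto simp: inner_add_right)
  fix p q x assume *: "p \<in> R" "q \<in> R" "x \<in> FC J" "x \<in> open_segment p q"
  then obtain u where u: "0 < u" "u < 1" "x = (1 - u) *\<^sub>R p + u *\<^sub>R q" by (auto simp: in_segment)
  have "f j p = 0 \<and> f j q = 0" if "j \<in> J" for j
  proof -
    have "(1 - u) * f j p + u * f j q = 0"
      using *(3) that u(3) by (auto simp: FC_def inner_add_right)
    moreover have "0 \<le> (1 - u) * f j p" "0 \<le> u * f j q"
      using R_nonneg *(1,2) u by simp_all
    ultimately have "(1 - u) * f j p = 0" "u * f j q = 0" by linarith+
    then show ?thesis using u by simp
  qed
  then show "p \<in> FC J" "q \<in> FC J" using *(1,2) by (auto simp: FC_def)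
qed

text \<open>The average of seven points of \<open>FC J\<close>, the \<open>i\<close>-th of which has
  \<open>f i\<close> positive if \<open>i\<close> is outside \<open>J\<close>. This is the converse
  of \<open>good_Z\<close>.\<close>

lemma exact_point:
  assumes "good J"
  shows "\<exists>x\<in>R. Z x = J"
proof -
  have "\<exists>w. w \<in> FC J \<and> (i \<notin> J \<longrightarrow> 0 < f i w)" for i
  proof (cases "i \<in> J")
    case True
    then show ?thesis using assms unfolding good_iff FC_iff
      by (metis V_in_R U_in_R Z_V Z_U)
  next
    case False
    then show ?thesis using good_separate[OF assms False] unfolding FC_iff
      by (metis V_in_R U_in_R Z_V Z_U f_V(2) f_U(2))
  qed
  then obtain w where w: "\<And>i. w i \<in> FC J" "\<And>i. i \<notin> J \<Longrightarrow> 0 < f i (w i)" by metis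
  define x where "x = (\<Sum>i\<in>UNIV. (1/7) *\<^sub>R w i)"
  have wR: "w i \<in> R" for i using w(1) by (simp add: FC_def)
  have fx: "f j x = (\<Sum>i\<in>UNIV. f j (w i)) / 7" for j
    by (simp add: x_def inner_sum_right sum_divide_distrib)
  have "x \<in> R"
    unfolding x_def by (rule convex_sum[OF _ convex_R]) (use wR in auto)
  moreover have "Z x = J"
  proof (intro set_eqI iffI)
    fix j assume "j \<in> J"
    then have "f j (w i) = 0" for i using w(1)[of i] by (auto simp: FC_def)
    then show "j \<in> Z x" by (simp add: Z_def fx)
  next
    fix j assume j: "j \<in> Z x"
    then have "(\<Sum>i\<in>UNIV. f j (w i)) = 0" by (simp add: Z_def fx)
    then have "f j (w j) = 0" using R_nonneg[OF wR] by (subst (asm) sum_nonneg_eq_0_iff) auto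
    then show "j \<in> J" using w(2)[of j] by force
  qed
  ultimately show ?thesis by blast
qed

lemma FC_subset_iff:
  assumes "good J"
  shows "FC J \<subseteq> FC J' \<longleftrightarrow> J' \<subseteq> J"
proof
  obtain x where x: "x \<in> R" "Z x = J" using exact_point[OF assms] by auto
  then have "x \<in> FC J" by (simp add: FC_iff)
  moreover assume "FC J \<subseteq> FC J'"
  ultimately have "x \<in> FC J'" by auto
  then show "J' \<subseteq> J" using x by (simp add: FC_iff)
next
  assume "J' \<subseteq> J"
  then show "FC J \<subseteq> FC J'" by (auto simp: FC_def)
qed

lemma FC_nonempty:
  assumes "good J"
  shows "FC J \<noteq> {}"
proof -
  obtain x where x: "x \<in> R" "Z x = J" using exact_point[OF assms] by auto
  then have "x \<in> FC J" by (simp add: FC_iff)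
  then show ?thesis by auto
qed

lemma FC_eq_iff:
  assumes "good J" "good J'"
  shows "FC J = FC J' \<longleftrightarrow> J = J'"
proof -
  have "FC J = FC J' \<longleftrightarrow> FC J \<subseteq> FC J' \<and> FC J' \<subseteq> FC J" by auto
  also have "\<dots> \<longleftrightarrow> J = J'" unfolding FC_subset_iff[OF assms(1)] FC_subset_iff[OF assms(2)] by auto
  finally show ?thesis .
qed

lemma FC_Int: "FC J \<inter> FC J' = FC (J \<union> J')" by (auto simp: FC_def)

lemma FC_empty: "FC {} = R" by (auto simp: FC_def)

lemma face_of_R_iff: "G face_of R \<and> G \<noteq> {} \<longleftrightarrow> (\<exists>J. good J \<and> G = FC J)"
proof
  assume G: "G face_of R \<and> G \<noteq> {}"
  have cG: "convex G" and GR: "G \<subseteq> R" using G face_of_imp_convex face_of_imp_subset by blast+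
  obtain x where x: "x \<in> rel_interior G" using G cG rel_interior_eq_empty by blast
  have xG: "x \<in> G" and xR: "x \<in> R" using x GR rel_interior_subset by blast+
  \<comment> \<open>A face is recovered from the zero set of a relative interior point
    \<open>x\<close>. Segments of \<open>G\<close> ending in \<open>x\<close> can be prolonged,
    which forces the zeros of \<open>x\<close> on all of \<open>G\<close>; conversely a segment from
    a point with these zeros to \<open>x\<close> can be prolonged inside \<open>R\<close>, so the
    face property applies.\<close>
  have "G = FC (Z x)"
  proof
    show "G \<subseteq> FC (Z x)"
    proof
      fix y assume y: "y \<in> G"
      then obtain e where e: "e > 1" "(1 - e) *\<^sub>R y + e *\<^sub>R x \<in> G"
        using x convex_rel_interior_iff[OF cG] G by blast
      have "f j y = 0" if "j \<in> Z x" for j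
      proof -
        have "0 \<le> (1 - e) * f j y"
          using R_nonneg[of "(1 - e) *\<^sub>R y + e *\<^sub>R x" j] e GR that by (auto simp: Z_def inner_add_right)
        moreover have "0 \<le> f j y" using R_nonneg y GR by blast
        ultimately show ?thesis using e(1) by (simp add: zero_le_mult_iff)
      qed
      then show "y \<in> FC (Z x)" using y GR by (auto simp: FC_def)
    qed
    show "FC (Z x) \<subseteq> G"
    proof
      fix y assume y: "y \<in> FC (Z x)"
      show "y \<in> G"
      proof (cases "y = x")
        case False
        \<comment> \<open>The length of a step beyond \<open>x\<close>, away from \<open>y\<close>,
          that keeps the functionals positive at \<open>x\<close> nonnegative.\<close>
        have "\<exists>e>0. \<forall>i. i \<notin> Z x \<longrightarrow> e * f i y \<le> f i x"
        proof -
          have "\<exists>e>0. i \<notin> Z x \<longrightarrow> e * f i y \<le> f i x" for i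
          proof (cases "f i y = 0 \<or> i \<in> Z x")
            case True
            then show ?thesis using R_nonneg[OF xR, of i] by (intro exI[of _ 1]) auto
          next
            case False
            then have "0 < f i y" "0 < f i x"
              using R_nonneg[OF xR, of i] R_nonneg[of y i] y by (auto simp: FC_def Z_def less_le)
            then show ?thesis by (intro exI[of _ "f i x / f i y"]) simp
          qed
          then obtain e where e: "\<And>i. 0 < e i" "\<And>i. i \<notin> Z x \<longrightarrow> e i * f i y \<le> f i x" by metis
          have y0: "0 \<le> f i y" for i using y R_nonneg by (simp add: FC_def)
          have "Min (range e) * f i y \<le> e i * f i y" for i
            using y0 by (intro mult_right_mono) auto
          moreover have "0 < Min (range e)" using e(1) by auto
          ultimately show ?thesis using e(2) by (meson order_trans)
        qed
        then obtain e where e: "0 < e" "\<And>i. i \<notin> Z x \<Longrightarrow> e * f i y \<le> f i x" by blast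
        define z where "z = (1 + e) *\<^sub>R x - e *\<^sub>R y"
        have yR: "y \<in> R" using y by (simp add: FC_def)
        have "0 \<le> f i z" for i
        proof (cases "i \<in> Z x")
          case True
          then show ?thesis using y by (auto simp: z_def FC_def Z_def inner_diff_right)
        next
          case False
          have "0 \<le> e * f i x" using e(1) R_nonneg[OF xR] by simp
          then show ?thesis using e(2)[OF False]
            by (simp add: z_def inner_diff_right distrib_right)
        qed
        then have zR: "z \<in> R" using xR yR by (auto simp: R_def z_def inner_diff_right)
        have "x = (1 - 1/(1+e)) *\<^sub>R y + (1/(1+e)) *\<^sub>R z"
        proof -
          have "(1/(1+e)) *\<^sub>R z = x - (e/(1+e)) *\<^sub>R y"
            using e(1) by (simp add: z_def scaleR_diff_right)
          moreover have "1 - 1/(1+e) = e/(1+e)" using e(1) by (simp add: field_simps)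
          ultimately show ?thesis by simp
        qed
        moreover have "z \<noteq> y"
        proof
          assume "z = y"
          then have "(1 + e) *\<^sub>R (x - y) = 0" by (simp add: z_def algebra_simps)
          with False e(1) show False by simp
        qed
        ultimately have "x \<in> open_segment y z"
          unfolding in_segment using e(1) by (intro conjI exI[of _ "1/(1+e)"]) auto
        then show ?thesis using face_ofD[OF _ _ yR zR xG] G by blast
      qed (use xG in simp)
    qed
  qed
  then show "\<exists>J. good J \<and> G = FC J" using good_Z[OF xR] by blast
qed (use FC_face_of FC_nonempty in blast)

section \<open>The faces of the chamber\<close>

text \<open>An extreme point is a face \<open>FC J\<close> with one point, and \<open>J\<close> lies
  in the zero set of some \<open>V k\<close> or \<open>U k\<close>, which is then that
  point.\<close>

lemma R_hull: "R = convex hull (range V \<union> range U)"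
proof
  have "{x. x extreme_point_of R} \<subseteq> range V \<union> range U"
  proof
    fix x assume "x \<in> {x. x extreme_point_of R}"
    then have "{x} face_of R" by (simp add: face_of_singleton)
    then obtain J where J: "good J" "{x} = FC J" using face_of_R_iff[of "{x}"] by auto
    then obtain k where "J \<subseteq> zV k \<or> J \<subseteq> zU k" unfolding good_iff by blast
    then have "V k \<in> FC J \<or> U k \<in> FC J" by (auto simp: FC_iff V_in_R Z_V U_in_R Z_U)
    then show "x \<in> range V \<union> range U" unfolding J(2)[symmetric] by blast
  qed
  then show "R \<subseteq> convex hull (range V \<union> range U)"
    using Krein_Milman_Minkowski[OF compact_R convex_R] hull_mono by metis
  show "convex hull (range V \<union> range U) \<subseteq> R"
    by (rule hull_minimal) (use V_in_R U_in_R convex_R in auto)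
qed

lemma polytope_FC: "polytope (FC J)"
proof -
  have "polytope R"
    unfolding polytope_def by (rule exI[of _ "range V \<union> range U"]) (use R_hull in auto)
  then show ?thesis using FC_face_of by (rule face_of_polytope_polytope)
qed

lemma compact_FC: "compact (FC J)" using polytope_FC polytope_imp_compact by blast
lemma convex_FC: "convex (FC J)" using polytope_FC polytope_imp_convex by blast

lemma FC_hull: "FC J = convex hull ({V k |k. J \<subseteq> zV k} \<union> {U k |k. J \<subseteq> zU k})"
proof
  have "FC J face_of convex hull (range V \<union> range U)" using FC_face_of R_hull by simp
  then obtain S' where S': "S' \<subseteq> range V \<union> range U" "FC J = convex hull S'"
    by (rule face_of_convex_hull_subset[rotated]) (auto intro: finite_imp_compact)
  have "S' \<subseteq> {V k |k. J \<subseteq> zV k} \<union> {U k |k. J \<subseteq> zU k}"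
  proof
    fix x assume "x \<in> S'"
    then have "x \<in> FC J" "x \<in> range V \<union> range U" using S' hull_inc by auto
    then show "x \<in> {V k |k. J \<subseteq> zV k} \<union> {U k |k. J \<subseteq> zU k}"
      by (auto simp: FC_iff Z_V Z_U)
  qed
  then show "FC J \<subseteq> convex hull ({V k |k. J \<subseteq> zV k} \<union> {U k |k. J \<subseteq> zU k})"
    unfolding S'(2) by (rule hull_mono)
  show "convex hull ({V k |k. J \<subseteq> zV k} \<union> {U k |k. J \<subseteq> zU k}) \<subseteq> FC J"
    by (rule hull_minimal) (auto simp: FC_iff V_in_R U_in_R Z_V Z_U convex_FC)
qed

lemma FC_face_of_FC: "J \<subseteq> J' \<Longrightarrow> FC J' face_of FC J"
  by (rule face_of_subset[OF FC_face_of]) (auto simp: FC_def)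

text \<open>Indices are added one at a time; each addition gives a proper face and so lowers the
  dimension by at least one.\<close>

lemma aff_dim_FC_step:
  assumes "good J'" "J \<subseteq> J'"
  shows "aff_dim (FC J') + int (card (J' - J)) \<le> aff_dim (FC J)"
proof -
  have "finite S \<Longrightarrow> S \<inter> J = {} \<Longrightarrow> good (J \<union> S) \<Longrightarrow> aff_dim (FC (J \<union> S)) + int (card S) \<le> aff_dim (FC J)" for S
  proof (induction S rule: finite_induct)
    case (insert s S)
    have g: "good (J \<union> S)" using good_mono[OF insert.prems(2)] by blast
    have "FC (J \<union> insert s S) \<noteq> FC (J \<union> S)"
      unfolding FC_eq_iff[OF insert.prems(2) g] using insert by blast
    then have "aff_dim (FC (J \<union> insert s S)) < aff_dim (FC (J \<union> S))"
      by (intro face_of_aff_dim_lt FC_face_of_FC convex_FC) auto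
    then show ?case using insert g by auto
  qed simp
  from this[of "J' - J"] show ?thesis using assms by (simp add: Un_absorb1 Int_commute)
qed

text \<open>\<open>J\<close> lies on a chain of good sets from the empty set to one with four
  elements. The dimension starts at 4 or less, ends at 0 or more and falls at each of the four
  steps, so every step costs exactly one.\<close>

lemma aff_dim_FC:
  assumes "good J"
  shows "aff_dim (FC J) = 4 - int (card J)"
proof -
  obtain k where k: "J \<subseteq> zV k \<or> J \<subseteq> zU k" using assms unfolding good_iff by blast
  then obtain W where W: "J \<subseteq> W" "good W" "card W = 4"
    using good_zV good_zU card_zV card_zU by metis
  have "0 \<le> aff_dim (FC W)" using FC_nonempty[OF W(2)] aff_dim_geq[of "FC W"] aff_dim_empty[of "FC W"] by linarith
  moreover have "card (W - J) = 4 - card J" "card J \<le> 4"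
    using W by (simp_all add: card_Diff_subset) (metis card_mono finite)
  ultimately have "4 - int (card J) \<le> aff_dim (FC J)"
    using aff_dim_FC_step[OF W(2,1)] by simp
  moreover have "aff_dim R \<le> 4"
  proof -
    have "hv \<noteq> 0" using hv_c by auto
    have "aff_dim R \<le> aff_dim {x. hv \<bullet> x = 1}" by (rule aff_dim_subset) (auto simp: R_def)
    then show ?thesis using \<open>hv \<noteq> 0\<close> by simp
  qed
  moreover have "aff_dim (FC J) + int (card J) \<le> aff_dim R"
    using aff_dim_FC_step[OF assms, of "{}"] by (simp add: FC_empty)
  ultimately show ?thesis by linarith
qed

definition P :: "7 set \<Rightarrow> (real^5) pspace set" where "P J = abs_pspace ` FC J"

lemma FC_chart: "FC J \<subseteq> {x. hv \<bullet> x = 1}" by (auto simp: FC_def R_def)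

lemma inj_on_abs_R: "inj_on abs_pspace R"
  using inj_on_abs_pspace[of R hv] by (auto simp: R_def)

lemma affine_model_P: "affine_model (P J) (FC J)"
  unfolding affine_model_def P_def using polytope_FC FC_chart by blast

lemma abs_in_P: "x \<in> R \<Longrightarrow> abs_pspace x \<in> P J \<longleftrightarrow> J \<subseteq> Z x"
proof -
  assume x: "x \<in> R"
  have "abs_pspace x \<in> abs_pspace ` FC J \<longleftrightarrow> x \<in> FC J"
    by (rule inj_on_image_mem_iff[OF inj_on_abs_R x]) (auto simp: FC_def)
  then show ?thesis using x by (simp add: P_def FC_iff)
qed

lemma P_subset_iff: "good J \<Longrightarrow> P J \<subseteq> P J' \<longleftrightarrow> J' \<subseteq> J"
  unfolding P_def using FC_subset_iff[of J J'] inj_on_image_subset_iff[OF inj_on_abs_R, of "FC J" "FC J'"]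
  by (auto simp: FC_def)

lemma P_eq_iff: "good J \<Longrightarrow> good J' \<Longrightarrow> P J = P J' \<longleftrightarrow> J = J'"
  using P_subset_iff[of J J'] P_subset_iff[of J' J] by auto

lemma P_Int: "P J \<inter> P J' = P (J \<union> J')"
  unfolding P_def FC_Int[symmetric]
  by (rule inj_on_image_Int[OF inj_on_abs_R, symmetric]) (auto simp: FC_def)

lemma P_nonempty: "good J \<Longrightarrow> P J \<noteq> {}" using FC_nonempty by (simp add: P_def)

lemma proj_polytope_P: "good J \<Longrightarrow> proj_polytope d (P J) \<longleftrightarrow> d = 4 - int (card J)"
  using proj_polytope_iff[OF affine_model_P] aff_dim_FC by auto

lemma proj_face_P:
  "proj_face F (P J) \<longleftrightarrow> F = {} \<or> (\<exists>J'. good J' \<and> J \<subseteq> J' \<and> F = P J')"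
proof -
  have "G face_of FC J \<longleftrightarrow> G = {} \<or> (\<exists>J'. good J' \<and> J \<subseteq> J' \<and> G = FC J')" for G
  proof
    assume G: "G face_of FC J"
    then have "G face_of R" using face_of_trans FC_face_of by blast
    moreover have "G \<subseteq> FC J" using G face_of_imp_subset by blast
    ultimately show "G = {} \<or> (\<exists>J'. good J' \<and> J \<subseteq> J' \<and> G = FC J')"
      using face_of_R_iff[of G] FC_subset_iff by metis
  next
    assume "G = {} \<or> (\<exists>J'. good J' \<and> J \<subseteq> J' \<and> G = FC J')"
    then show "G face_of FC J" using FC_face_of_FC by auto
  qed
  then show ?thesis unfolding proj_face_iff[OF affine_model_P] by (auto simp: P_def)
qed

lemma good_card1: "good {j}" and good_card2: "good {i, j}"
proof -
  show "good {i, j}" for i j :: 7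
    by (cases j i rule: cases7) (auto simp: good_def)
  from this[of j j] show "good {j}" by simp
qed

lemma proj_facet_P: "proj_facet F (P {}) \<longleftrightarrow> (\<exists>j. F = P {j})"
proof -
  have "G facet_of R \<longleftrightarrow> (\<exists>j. G = FC {j})" for G
  proof
    assume G: "G facet_of R"
    then obtain J where J: "good J" "G = FC J" using face_of_R_iff[of G] facet_of_def by blast
    have "aff_dim G = aff_dim R - 1" using G by (simp add: facet_of_def)
    then have "card J = 1" using aff_dim_FC[OF J(1)] aff_dim_FC[OF good_empty] J(2)
      by (simp add: FC_empty)
    then show "\<exists>j. G = FC {j}" using J card_1_singletonE by metis
  next
    assume "\<exists>j. G = FC {j}"
    then show "G facet_of R"
      using FC_face_of FC_nonempty aff_dim_FC aff_dim_FC[OF good_empty] good_card1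
      by (auto simp: facet_of_def FC_empty)
  qed
  then show ?thesis
    unfolding proj_facet_iff[OF affine_model_P] by (auto simp: P_def FC_empty)
qed

end

section \<open>Vertex counts of the 2-faces\<close>

lemma zV_eq_iff [simp]: "zV i = zV j \<longleftrightarrow> i = j"
  by (cases j i rule: cases7) (simp_all add: set_eq_iff all7_shift[of _ i] zV_def)

lemma zU_eq_iff [simp]: "zU i = zU j \<longleftrightarrow> i = j"
  by (cases j i rule: cases7) (simp_all add: set_eq_iff all7_shift[of _ i] zU_def)

lemma zV_neq_zU [simp]: "zV i \<noteq> zU j" "zU j \<noteq> zV i"
  by (cases j i rule: cases7; simp add: set_eq_iff all7_shift[of _ i] zU_def zV_def)+

text \<open>Vertices are represented by their zero sets, which turns counting the vertices of a face
  into a finite computation with residues.\<close>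

definition vs :: "7 set \<Rightarrow> 7 set set" where
  "vs J = {W. (\<exists>k. W = zV k \<or> W = zU k) \<and> J \<subseteq> W}"

lemma vs_iff: "W \<in> vs J \<longleftrightarrow> good W \<and> card W = 4 \<and> J \<subseteq> W"
proof
  assume "good W \<and> card W = 4 \<and> J \<subseteq> W"
  moreover then obtain k where "W \<subseteq> zV k \<or> W \<subseteq> zU k" unfolding good_iff by blast
  ultimately show "W \<in> vs J" unfolding vs_def using card_zV card_zU
    by (metis (mono_tags, lifting) card_subset_eq finite mem_Collect_eq)
qed (auto simp: vs_def card_zV card_zU good_zV good_zU)

lemma vs_eq: "vs J = zV ` {k. J \<subseteq> zV k} \<union> zU ` {k. J \<subseteq> zU k}"
  by (auto simp: vs_def)

lemma vs_pair1: "vs {j, j+1} = {zV j, zV (j+6), zV (j+5), zU j, zU (j+4)}"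
proof -
  have "k \<in> {k. {j, j+1} \<subseteq> zV k} \<longleftrightarrow> k \<in> {j, j+6, j+5}" "k \<in> {k. {j, j+1} \<subseteq> zU k} \<longleftrightarrow> k \<in> {j, j+4}" for k
    by (cases k j rule: cases7; simp add: zV_def zU_def)+
  then have "{k. {j, j+1} \<subseteq> zV k} = {j, j+6, j+5}" "{k. {j, j+1} \<subseteq> zU k} = {j, j+4}" by blast+
  then show ?thesis unfolding vs_eq by (simp add: insert_commute)
qed

lemma vs_pair2: "vs {j, j+2} = {zV j, zV (j+6), zU (j+6)}"
proof -
  have "k \<in> {k. {j, j+2} \<subseteq> zV k} \<longleftrightarrow> k \<in> {j, j+6}" "k \<in> {k. {j, j+2} \<subseteq> zU k} \<longleftrightarrow> k \<in> {j+6}" for k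
    by (cases k j rule: cases7; simp add: zV_def zU_def)+
  then have "{k. {j, j+2} \<subseteq> zV k} = {j, j+6}" "{k. {j, j+2} \<subseteq> zU k} = {j+6}" by blast+
  then show ?thesis unfolding vs_eq by (simp add: insert_commute)
qed

lemma vs_pair3: "vs {j, j+3} = {zV j, zU j, zU (j+6), zU (j+3)}"
proof -
  have "k \<in> {k. {j, j+3} \<subseteq> zV k} \<longleftrightarrow> k \<in> {j}" "k \<in> {k. {j, j+3} \<subseteq> zU k} \<longleftrightarrow> k \<in> {j, j+6, j+3}" for k
    by (cases k j rule: cases7; simp add: zV_def zU_def)+
  then have "{k. {j, j+3} \<subseteq> zV k} = {j}" "{k. {j, j+3} \<subseteq> zU k} = {j, j+6, j+3}" by blast+
  then show ?thesis unfolding vs_eq by (simp add: insert_commute)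
qed

lemma card_vs_pair: "card (vs {j, j+1}) = 5" "card (vs {j, j+2}) = 3" "card (vs {j, j+3}) = 4"
  by (simp_all add: vs_pair1 vs_pair2 vs_pair3)

text \<open>Up to rotation a 2-face is given by the cyclic distance of its two indices; by
  \<open>card_vs_pair\<close> the distances 1, 2, 3 belong to pentagons, triangles and
  quadrilaterals.\<close>

lemma pair_cases:
  assumes "card (J::7 set) = 2"
  obtains j where "J = {j, j+1}" | j where "J = {j, j+2}" | j where "J = {j, j+3}"
proof -
  obtain i j where ij: "J = {i, j}" "i \<noteq> j" using assms by (metis card_2_iff)
  have "J = {i,i+1} \<or> J = {i,i+2} \<or> J = {i,i+3} \<or> J = {j,j+1} \<or> J = {j,j+2} \<or> J = {j,j+3}"
    using ij by (cases j i rule: cases7) auto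
  then show ?thesis using that by blast
qed

lemma pair_eq_iff: 
  "{i, i+1} = {j, j+1::7} \<longleftrightarrow> i = j" "{i, i+2} = {j, j+2::7} \<longleftrightarrow> i = j" "{i, i+3} = {j, j+3::7} \<longleftrightarrow> i = j"
  by (cases j i rule: cases7; simp add: doubleton_eq_iff)+

lemma card_vs_2:
  assumes "card J = 2"
  shows "card (vs J) = 5 \<longleftrightarrow> (\<exists>j. J = {j, j+1})" "card (vs J) = 3 \<longleftrightarrow> (\<exists>j. J = {j, j+2})"
    "card (vs J) = 4 \<longleftrightarrow> (\<exists>j. J = {j, j+3})"
proof -
  have "{i, i+1} \<noteq> {j, j+2::7}" "{i, i+1} \<noteq> {j, j+3::7}" "{i, i+2} \<noteq> {j, j+3::7}" for i j
    by (cases j i rule: cases7; auto simp: doubleton_eq_iff)+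
  note n = this this[symmetric]
  show "card (vs J) = 5 \<longleftrightarrow> (\<exists>j. J = {j, j+1})" "card (vs J) = 3 \<longleftrightarrow> (\<exists>j. J = {j, j+2})"
    "card (vs J) = 4 \<longleftrightarrow> (\<exists>j. J = {j, j+3})"
    by (rule pair_cases[OF assms]; force simp: card_vs_pair n)+
qed

section \<open>Cells, skeleton, special edges and cyclic symmetry of the tessellation\<close>

context alternating
begin

lemma proj_polygon_P:
  assumes "good J"
  shows "proj_polygon n (P J) \<longleftrightarrow> card J = 2 \<and> card (vs J) = n"
proof -
  have "{v. proj_face v (P J) \<and> proj_polytope 0 v} = P ` vs J"
  proof (intro set_eqI iffI)
    fix v assume v: "v \<in> {v. proj_face v (P J) \<and> proj_polytope 0 v}"
    moreover have "\<not> proj_polytope 0 ({} :: (real^5) pspace set)"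
      by (auto simp: proj_polytope_def affine_model_def)
    ultimately obtain J' where "good J'" "J \<subseteq> J'" "v = P J'" using proj_face_P[of v J] by auto
    then show "v \<in> P ` vs J" using v proj_polytope_P by (force simp: vs_iff)
  next
    fix v assume "v \<in> P ` vs J"
    then obtain W where W: "good W" "card W = 4" "J \<subseteq> W" "v = P W" by (auto simp: vs_iff)
    have "proj_face v (P J)" unfolding proj_face_P using W by (intro disjI2 exI[of _ W]) simp
    moreover have "proj_polytope 0 v" unfolding W(4) proj_polytope_P[OF W(1)] using W(2) by simp
    ultimately show "v \<in> {v. proj_face v (P J) \<and> proj_polytope 0 v}" by simp
  qed
  moreover have "inj_on P (vs J)" by (rule inj_onI) (simp add: P_eq_iff vs_iff)
  ultimately show ?thesis
    using proj_polytope_P[OF assms, of 2] by (auto simp: proj_polygon_def card_image)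
qed

abbreviation tess :: "(real^5) pspace set set" where "tess \<equiv> range (\<lambda>j. P {j})"

lemma cells_tess: "cells tess = {P J |J. good J \<and> J \<noteq> {}}"
proof (intro set_eqI iffI)
  fix F assume "F \<in> cells tess"
  then obtain j where "F \<noteq> {}" "proj_face F (P {j})" by (auto simp: cells_def)
  then show "F \<in> {P J |J. good J \<and> J \<noteq> {}}" unfolding proj_face_P by auto
next
  fix F assume "F \<in> {P J |J. good J \<and> J \<noteq> {}}"
  then obtain J j where J: "good J" "F = P J" "j \<in> J" by auto
  then have "proj_face F (P {j})" unfolding proj_face_P by auto
  then show "F \<in> cells tess" using J P_nonempty by (auto simp: cells_def)
qed

lemma cells_of_dim_tess: "cells_of_dim e tess = {P J |J. good J \<and> J \<noteq> {} \<and> e = 4 - int (card J)}"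
  unfolding cells_of_dim_def cells_tess
proof (intro set_eqI iffI)
  fix F assume "F \<in> {F \<in> {P J |J. good J \<and> J \<noteq> {}}. proj_polytope e F}"
  then obtain J where "good J" "J \<noteq> {}" "F = P J" "proj_polytope e F" by auto
  then show "F \<in> {P J |J. good J \<and> J \<noteq> {} \<and> e = 4 - int (card J)}" 
    using proj_polytope_P[of J e] by auto
next
  fix F assume "F \<in> {P J |J. good J \<and> J \<noteq> {} \<and> e = 4 - int (card J)}"
  then obtain J where "good J" "J \<noteq> {}" "F = P J" "e = 4 - int (card J)" by auto
  then show "F \<in> {F \<in> {P J |J. good J \<and> J \<noteq> {}}. proj_polytope e F}"
    using proj_polytope_P[of J e] by auto
qed

lemma cells2: "cells_of_dim 2 tess = P ` {J. card J = 2}"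
proof -
  have "good J" if "card J = 2" for J using that by (metis card_2_iff good_card2)
  moreover have "(2 = 4 - int (card J)) = (card J = 2)" for J :: "7 set" by linarith
  ultimately show ?thesis unfolding cells_of_dim_tess by auto
qed

lemma polygon_cells_tess: "polygon_cells n tess = P ` {J. card J = 2 \<and> card (vs J) = n}"
proof -
  have "good J" if "card J = 2" for J using that by (metis card_2_iff good_card2)
  then show ?thesis unfolding polygon_cells_def cells2 using proj_polygon_P by auto
qed

lemma polygon_cells3: "polygon_cells 3 tess = range (\<lambda>j. P {j, j+2})"
proof -
  have "{J. card J = 2 \<and> card (vs J) = 3} = range (\<lambda>j. {j, j+2})"
  proof (intro set_eqI iffI)
    fix J assume "J \<in> {J. card J = 2 \<and> card (vs J) = 3}"
    then have "card J = 2" "card (vs J) = 3" by simp_all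
    then show "J \<in> range (\<lambda>j. {j, j+2})" using card_vs_2(2)[of J] by (simp add: image_iff)
  next
    fix J assume "J \<in> range (\<lambda>j. {j, j+2} :: 7 set)"
    then obtain j where "J = {j, j+2}" by (rule rangeE)
    then show "J \<in> {J. card J = 2 \<and> card (vs J) = 3}" by (simp add: card_vs_pair)
  qed
  then show ?thesis unfolding polygon_cells_tess by (simp only: image_image)
qed

lemma polygon_cells4: "polygon_cells 4 tess = range (\<lambda>j. P {j, j+3})"
proof -
  have "{J. card J = 2 \<and> card (vs J) = 4} = range (\<lambda>j. {j, j+3})"
  proof (intro set_eqI iffI)
    fix J assume "J \<in> {J. card J = 2 \<and> card (vs J) = 4}"
    then have "card J = 2" "card (vs J) = 4" by simp_all
    then show "J \<in> range (\<lambda>j. {j, j+3})" using card_vs_2(3)[of J] by (simp add: image_iff)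
  next
    fix J assume "J \<in> range (\<lambda>j. {j, j+3} :: 7 set)"
    then obtain j where "J = {j, j+3}" by (rule rangeE)
    then show "J \<in> {J. card J = 2 \<and> card (vs J) = 4}" by (simp add: card_vs_pair)
  qed
  then show ?thesis unfolding polygon_cells_tess by (simp only: image_image)
qed

lemma inj_P_pair: "inj (\<lambda>j. P {j, j+1})" "inj (\<lambda>j. P {j, j+2})" "inj (\<lambda>j. P {j, j+3})"
  by (rule injI; simp add: P_eq_iff good_card2 pair_eq_iff)+

lemma card_polygon_cells: "card (polygon_cells 3 tess) = 7" "card (polygon_cells 4 tess) = 7"
  unfolding polygon_cells3 polygon_cells4 using inj_P_pair by (simp_all add: card_image)

lemma cells2_split:
  "cells_of_dim 2 tess = range (\<lambda>j. P {j, j+1}) \<union> polygon_cells 3 tess \<union> polygon_cells 4 tess"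
proof
  show "cells_of_dim 2 tess \<subseteq> range (\<lambda>j. P {j, j+1}) \<union> polygon_cells 3 tess \<union> polygon_cells 4 tess"
  proof
    fix F assume "F \<in> cells_of_dim 2 tess"
    then obtain J where J: "card J = 2" "F = P J" by (auto simp: cells2)
    show "F \<in> range (\<lambda>j. P {j, j+1}) \<union> polygon_cells 3 tess \<union> polygon_cells 4 tess"
      unfolding polygon_cells3 polygon_cells4 by (rule pair_cases[OF J(1)]) (auto simp: J(2))
  qed
  show "range (\<lambda>j. P {j, j+1}) \<union> polygon_cells 3 tess \<union> polygon_cells 4 tess \<subseteq> cells_of_dim 2 tess"
    unfolding polygon_cells3 polygon_cells4 cells2 by auto
qed

text \<open>Translates unions of faces into conditions on the zero sets of points of
  \<open>R\<close>, the form in which the skeleton, the strip, the curve and the disc are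
  handled.\<close>

lemma Union_P: "\<Union>(P ` \<J>) = abs_pspace ` {x \<in> R. \<exists>J\<in>\<J>. J \<subseteq> Z x}"
proof -
  have "P J = abs_pspace ` {x \<in> R. J \<subseteq> Z x}" for J
    unfolding P_def by (rule arg_cong[where f = "image abs_pspace"]) (auto simp: FC_iff)
  then have "\<Union>(P ` \<J>) = abs_pspace ` (\<Union>J\<in>\<J>. {x \<in> R. J \<subseteq> Z x})" by (simp add: image_UN)
  also have "(\<Union>J\<in>\<J>. {x \<in> R. J \<subseteq> Z x}) = {x \<in> R. \<exists>J\<in>\<J>. J \<subseteq> Z x}" by auto
  finally show ?thesis .
qed

lemma skeleton2: "skeleton 2 tess = abs_pspace ` {x \<in> R. 2 \<le> card (Z x)}"
proof -
  have "(\<Union>e\<in>{..2}. cells_of_dim e tess) = P ` {J. good J \<and> 2 \<le> card J}"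
  proof (intro set_eqI iffI)
    fix F assume "F \<in> P ` {J. good J \<and> 2 \<le> card J}"
    then obtain J where "good J" "2 \<le> card J" "F = P J" by auto
    then show "F \<in> (\<Union>e\<in>{..2}. cells_of_dim e tess)"
      unfolding cells_of_dim_tess by (intro UN_I[of "4 - int (card J)"]) auto
  qed (auto simp: cells_of_dim_tess)
  then have e0: "skeleton 2 tess = \<Union>(P ` {J. good J \<and> 2 \<le> card J})" by (simp add: skeleton_def)
  have e1: "\<Union>(P ` {J. good J \<and> 2 \<le> card J}) = abs_pspace ` {x \<in> R. \<exists>J\<in>{J. good J \<and> 2 \<le> card J}. J \<subseteq> Z x}" by (rule Union_P)
  have e2: "{x \<in> R. \<exists>J\<in>{J. good J \<and> 2 \<le> card J}. J \<subseteq> Z x} = {x \<in> R. 2 \<le> card (Z x)}"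
  proof (intro set_eqI iffI)
    fix x assume "x \<in> {x \<in> R. \<exists>J\<in>{J. good J \<and> 2 \<le> card J}. J \<subseteq> Z x}"
    then obtain J where J: "x \<in> R" "2 \<le> card J" "J \<subseteq> Z x" by auto
    then have "card J \<le> card (Z x)" by (intro card_mono) auto
    with J show "x \<in> {x \<in> R. 2 \<le> card (Z x)}" by auto
  qed (use good_Z in auto)
  show ?thesis unfolding e0 e1 e2 ..
qed

lemma skeleton2_cells: "skeleton 2 tess = \<Union>(cells_of_dim 2 tess)"
proof -
  have "{x \<in> R. 2 \<le> card (Z x)} = {x \<in> R. \<exists>J\<in>{J. card J = 2}. J \<subseteq> Z x}"
  proof (intro set_eqI iffI)
    fix x assume x: "x \<in> {x \<in> R. 2 \<le> card (Z x)}"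
    then obtain J where "J \<subseteq> Z x" "card J = 2" by (metis (mono_tags) mem_Collect_eq obtain_subset_with_card_n)
    with x show "x \<in> {x \<in> R. \<exists>J\<in>{J. card J = 2}. J \<subseteq> Z x}" by auto
  next
    fix x assume "x \<in> {x \<in> R. \<exists>J\<in>{J. card J = 2}. J \<subseteq> Z x}"
    then obtain J where J: "x \<in> R" "card J = 2" "J \<subseteq> Z x" by auto
    then have "card J \<le> card (Z x)" by (intro card_mono) auto
    with J show "x \<in> {x \<in> R. 2 \<le> card (Z x)}" by auto
  qed
  then show ?thesis unfolding skeleton2 cells2 Union_P by simp
qed

text \<open>The smallest face through a point is that of its own zero set, so removing the proper
  faces leaves the points whose zero set is \<open>J\<close> exactly.\<close>

lemma open_cell_P:
  assumes "good J"
  shows "open_cell (P J) = abs_pspace ` {x \<in> R. Z x = J}"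
proof (intro set_eqI iffI)
  fix p assume p: "p \<in> open_cell (P J)"
  then obtain x where x: "x \<in> R" "p = abs_pspace x" "J \<subseteq> Z x"
    by (auto simp: open_cell_def P_def FC_iff)
  have "p \<in> P (Z x)" using x abs_in_P by blast
  moreover have "proj_face (P (Z x)) (P J)" using x good_Z proj_face_P by blast
  ultimately have "P (Z x) = P J" using p unfolding open_cell_def by blast
  then have "Z x = J" using P_eq_iff good_Z x assms by blast
  then show "p \<in> abs_pspace ` {x \<in> R. Z x = J}" using x by blast
next
  fix p assume "p \<in> abs_pspace ` {x \<in> R. Z x = J}"
  then obtain x where x: "x \<in> R" "p = abs_pspace x" "Z x = J" by blast
  have "F = P J" if "proj_face F (P J)" "p \<in> F" for F
  proof -
    have "F \<noteq> {}" using that(2) by auto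
    moreover have "F = {} \<or> (\<exists>J'. good J' \<and> J \<subseteq> J' \<and> F = P J')"
      using that(1) unfolding proj_face_P .
    ultimately obtain J' where J': "good J'" "J \<subseteq> J'" "F = P J'" by auto
    then have "J' \<subseteq> J" using that(2) x abs_in_P[OF x(1), of J'] by simp
    with J' show ?thesis by auto
  qed
  moreover have "p \<in> P J" using x abs_in_P[OF x(1), of J] by simp
  ultimately show "p \<in> open_cell (P J)" unfolding open_cell_def by auto
qed

lemma strip_cells:
  "\<Union>(polygon_cells 3 tess \<union> polygon_cells 4 tess) = abs_pspace ` {x \<in> R. \<exists>j. {j, j+2} \<subseteq> Z x \<or> {j, j+3} \<subseteq> Z x}"
proof -
  have "polygon_cells 3 tess \<union> polygon_cells 4 tess = P ` (range (\<lambda>j. {j, j+2}) \<union> range (\<lambda>j. {j, j+3}))"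
    unfolding polygon_cells3 polygon_cells4 image_Un image_image ..
  then have e1: "\<Union>(polygon_cells 3 tess \<union> polygon_cells 4 tess) =
      abs_pspace ` {x \<in> R. \<exists>J\<in>range (\<lambda>j. {j, j+2}) \<union> range (\<lambda>j. {j, j+3}). J \<subseteq> Z x}"
    by (simp only: Union_P)
  have e2: "{x \<in> R. \<exists>J\<in>range (\<lambda>j. {j, j+2}) \<union> range (\<lambda>j. {j, j+3}). J \<subseteq> Z x} =
      {x \<in> R. \<exists>j. {j, j+2} \<subseteq> Z x \<or> {j, j+3} \<subseteq> Z x}"
    by (rule Collect_cong) (simp add: bex_Un ex_disj_distrib conj_disj_distribL)
  show ?thesis unfolding e1 e2 ..
qed

text \<open>A third index beside \<open>j\<close> and \<open>j+1\<close> is always at cyclic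
  distance 2 or 3 from one of them. So deleting the open pentagons from the 2-skeleton leaves
  precisely the triangles and quadrilaterals: every edge of a pentagon also lies on one of
  these.\<close>

lemma nonadjacent_pair:
  assumes "good Y"
  shows "(\<exists>j. {j, j+2} \<subseteq> Y \<or> {j, j+3} \<subseteq> Y) \<longleftrightarrow> 2 \<le> card Y \<and> (\<forall>j. Y \<noteq> {j, j+1})"
proof
  assume "\<exists>j. {j, j+2} \<subseteq> Y \<or> {j, j+3} \<subseteq> Y"
  then obtain j where j0: "{j, j+2} \<subseteq> Y \<or> {j, j+3} \<subseteq> Y" by (rule exE)
  define J where "J = (if {j, j+2} \<subseteq> Y then {j, j+2} else {j, j+3})"
  have j: "J = {j, j+2} \<or> J = {j, j+3}" "J \<subseteq> Y" using j0 by (auto simp: J_def)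
  from j(1) have "card J = 2" by (elim disjE) simp_all
  then have "2 \<le> card Y" using card_mono[OF _ j(2)] by simp
  moreover have "Y \<noteq> {i, i+1}" for i
  proof
    assume "Y = {i, i+1}"
    then have "{j, j+2} \<subseteq> {i, i+1} \<or> {j, j+3} \<subseteq> {i, i+1}" using j0 by simp
    then show False by (cases j i rule: cases7) simp_all
  qed
  ultimately show "2 \<le> card Y \<and> (\<forall>j. Y \<noteq> {j, j+1})" by simp
next
  assume Y: "2 \<le> card Y \<and> (\<forall>j. Y \<noteq> {j, j+1})"
  then obtain J where J: "J \<subseteq> Y" "card J = 2" using obtain_subset_with_card_n[of 2 Y] by auto
  show "\<exists>j. {j, j+2} \<subseteq> Y \<or> {j, j+3} \<subseteq> Y"
  proof (rule pair_cases[OF J(2)])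
    fix j assume j: "J = {j, j+1}"
    have "Y \<noteq> J" using conjunct2[OF Y, rule_format, of j] j by simp
    then obtain i where "i \<in> Y" "i \<notin> J" using J(1) by auto
    then have i: "i \<in> Y" "i \<noteq> j" "i \<noteq> j+1" using j by simp_all
    have jY: "j \<in> Y" "j + 1 \<in> Y" using j J by simp_all
    consider "i = j+2" | "i = j+3" | "i = j+4" | "i = j+5" | "i = j+6"
      using i(2,3) by (cases i j rule: cases7) simp_all
    then show ?thesis
    proof cases
      case 1
      with i jY have "{j, j+2} \<subseteq> Y" by simp
      then show ?thesis by (intro exI[of _ j] disjI1)
    next
      case 2
      with i jY have "{j, j+3} \<subseteq> Y" by simp
      then show ?thesis by (intro exI[of _ j] disjI2)
    next
      case 3
      then have "{j+1, (j+1)+3} \<subseteq> Y" using i jY by simp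
      then show ?thesis by (intro exI[of _ "j+1"] disjI2)
    next
      case 4
      then have "{j+5, (j+5)+2} \<subseteq> Y" using i jY by simp
      then show ?thesis by (intro exI[of _ "j+5"] disjI1)
    next
      case 5
      then have "{j+6, (j+6)+2} \<subseteq> Y" using i jY by simp
      then show ?thesis by (intro exI[of _ "j+6"] disjI1)
    qed
  next
    fix j assume "J = {j, j+2}"
    then have "{j, j+2} \<subseteq> Y" using J by simp
    then show ?thesis by (intro exI[of _ j] disjI1)
  next
    fix j assume "J = {j, j+3}"
    then have "{j, j+3} \<subseteq> Y" using J by simp
    then show ?thesis by (intro exI[of _ j] disjI2)
  qed
qed

lemma strip_skeleton:
  "\<Union>(polygon_cells 3 tess \<union> polygon_cells 4 tess) = skeleton 2 tess - (\<Union>j. open_cell (P {j, j+1}))"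
proof -
  have e: "(\<Union>j. open_cell (P {j, j+1})) = abs_pspace ` {x \<in> R. \<exists>j. Z x = {j, j+1}}"
    using open_cell_P[OF good_card2] by auto
  have e1: "skeleton 2 tess - (\<Union>j. open_cell (P {j, j+1})) =
      abs_pspace ` ({x \<in> R. 2 \<le> card (Z x)} - {x \<in> R. \<exists>j. Z x = {j, j+1}})"
    unfolding skeleton2 e by (rule inj_on_image_set_diff[OF inj_on_abs_R, symmetric]) auto
  have e2: "{x \<in> R. 2 \<le> card (Z x)} - {x \<in> R. \<exists>j. Z x = {j, j+1}} 
      = {x \<in> R. \<exists>j. {j, j+2} \<subseteq> Z x \<or> {j, j+3} \<subseteq> Z x}"
    using nonadjacent_pair[OF good_Z] by auto
  show ?thesis unfolding e1 e2 strip_cells ..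
qed

text \<open>The only pentagons of the facet \<open>k+1\<close> belong to the two adjacent pairs
  containing \<open>k+1\<close>, and intersecting faces unites their index sets.\<close>

lemma special_edge_P: "special_edge (P {k+1}) = P {k, k+1, k+2}"
proof -
  have "{F. proj_face F (P {k+1}) \<and> proj_polygon 5 F} = {P {k, k+1}, P {k+1, k+2}}"
  proof (intro set_eqI iffI)
    fix F assume F: "F \<in> {F. proj_face F (P {k+1}) \<and> proj_polygon 5 F}"
    moreover have "\<not> proj_polygon n ({} :: (real^5) pspace set)" for n
      by (auto simp: proj_polygon_def proj_polytope_def affine_model_def)
    ultimately obtain J where J: "good J" "k+1 \<in> J" "F = P J" "proj_polygon 5 (P J)"
      using proj_face_P[of F "{k+1}"] by auto
    then obtain j where j: "J = {j, j+1}" using proj_polygon_P card_vs_2(1) by blast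
    have "J = {k, k+1} \<or> J = {k+1, k+2}" using J(2) j by (cases j k rule: cases7) auto
    with J show "F \<in> {P {k, k+1}, P {k+1, k+2}}" by auto
  next
    fix F assume "F \<in> {P {k, k+1}, P {k+1, k+2}}"
    moreover have "proj_polygon 5 (P {j, j+1})" for j
      using proj_polygon_P[OF good_card2] card_vs_pair(1) by simp
    from this[of k] this[of "k+1"] have "proj_polygon 5 (P {k, k+1})" "proj_polygon 5 (P {k+1, k+2})"
      by simp_all
    ultimately show "F \<in> {F. proj_face F (P {k+1}) \<and> proj_polygon 5 F}"
      using good_card2 unfolding proj_face_P by blast
  qed
  then have "special_edge (P {k+1}) = P ({k, k+1} \<union> {k+1, k+2})"
    by (simp add: special_edge_def P_Int)
  also have "{k, k+1} \<union> {k+1, k+2} = {k, k+1, k+2}" by auto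
  finally show ?thesis .
qed

lemma good_triple: "good {k, k+1, k+2}"
  by (rule good_mono[OF good_zV[of k]]) (auto simp: zV_def)

lemma special_edge_cell: "special_edge (P {k}) \<in> cells_of_dim 1 tess"
proof -
  have "special_edge (P {k}) = P {k+6, k, k+1}" "good {k+6, k, k+1}" 
    using special_edge_P[of "k+6"] good_triple[of "k+6"] by simp_all
  moreover have "card {k+6, k, k+1} = 3" by simp
  ultimately show ?thesis unfolding cells_of_dim_tess mem_Collect_eq
    by (intro exI[of _ "{k+6, k, k+1}"]) simp
qed

lemma inj_special_edge: "inj (\<lambda>k. special_edge (P {k}))"
proof (rule injI)
  fix i j assume eq: "special_edge (P {i}) = special_edge (P {j})"
  have "P {i+6, i+6+1, i+6+2} = P {j+6, j+6+1, j+6+2}"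
    using eq special_edge_P[of "i+6"] special_edge_P[of "j+6"] by simp
  then have "{i+6, i+6+1, i+6+2} = {j+6, j+6+1, j+6+2}" unfolding P_eq_iff[OF good_triple good_triple] .
  then show "i = j" by (cases j i rule: cases7) (auto simp: set_eq_iff all7_shift[of _ i])
qed

definition Cset :: "(real^5) set" where "Cset = {x \<in> R. \<exists>k. {k, k+1, k+2} \<subseteq> Z x}"

lemma special_curve_P: "(\<Union>k. special_edge (P {k})) = abs_pspace ` Cset"
proof -
  have "(\<exists>k. p \<in> special_edge (P {k})) \<longleftrightarrow> (\<exists>k. p \<in> special_edge (P {k+1}))" for p
    by (metis diff_add_cancel)
  then have "(\<Union>k. special_edge (P {k})) = \<Union>(P ` range (\<lambda>k. {k, k+1, k+2}))"
    unfolding special_edge_P by auto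
  then show ?thesis unfolding Union_P Cset_def by simp
qed

lemma tessellation_tess: "tessellation 3 tess (\<Union>j. P {j})"
  unfolding tessellation_def
proof (intro conjI ballI impI)
  fix X Y assume XY: "X \<in> tess" "Y \<in> tess" "X \<noteq> Y"
  then obtain i j where ij: "X = P {i}" "Y = P {j}" "i \<noteq> j" by auto
  then have I: "X \<inter> Y = P {i, j}" by (simp add: P_Int insert_commute)
  have "proj_face (P {i, j}) (P {i})" "proj_face (P {i, j}) (P {j})"
    unfolding proj_face_P by (rule disjI2, rule exI[of _ "{i, j}"], simp add: good_card2)+
  then show "proj_face (X \<inter> Y) X" "proj_face (X \<inter> Y) Y" by (simp_all only: I ij(1,2)[symmetric])
  show "X \<inter> Y \<noteq> X" "X \<inter> Y \<noteq> Y" 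
  proof -
    have "P {i, j} \<noteq> P {i}" "P {i, j} \<noteq> P {j}"
      using ij(3) by (simp_all add: P_eq_iff[OF good_card2 good_card1])
    then show "X \<inter> Y \<noteq> X" "X \<inter> Y \<noteq> Y" by (simp_all only: I ij(1,2)[symmetric] not_False_eq_True)
  qed
qed (use proj_polytope_P[OF good_card1] in auto)

lemma good_shift: "good ((\<lambda>i. i + 1) ` J) \<longleftrightarrow> good J"
proof -
  have m: "i + 1 \<in> (\<lambda>i. i + 1) ` J \<longleftrightarrow> i \<in> J" for i :: 7 by (rule inj_image_mem_iff) (auto intro: injI)
  have "good ((\<lambda>i. i + 1) ` J) \<longleftrightarrow> (\<forall>i. \<not> (i + 1 \<in> (\<lambda>i. i + 1) ` J \<and> (i + 2) + 1 \<in> (\<lambda>i. i + 1) ` J \<and> (i + 4) + 1 \<in> (\<lambda>i. i + 1) ` J))"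
  proof -
    have sh: "(\<forall>i. Q i) \<longleftrightarrow> (\<forall>i::7. Q (i + 1))" for Q by (metis diff_add_cancel)
    show ?thesis unfolding good_def by (subst sh) (simp add: add.commute add.left_commute)
  qed
  also have "\<dots> \<longleftrightarrow> good J" unfolding good_def m by (rule refl)
  finally show ?thesis .
qed

lemma tess_automorphism:
  "\<exists>\<phi>. comb_iso \<phi> (cells tess) (cells tess) \<and> (\<forall>k. \<phi> (P {k}) = P {k + 1})"
proof -
  define s :: "7 set \<Rightarrow> 7 set" where "s = image (\<lambda>i. i + 1)"
  \<comment> \<open>The zero set is recovered from the cell, uniquely by \<open>P_eq_iff\<close>,
    and then rotated.\<close>
  define \<phi> where "\<phi> F = P (s (THE J. good J \<and> F = P J))" for F
  have phi: "\<phi> (P J) = P (s J)" if "good J" for J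
  proof -
    have "(THE J'. good J' \<and> P J = P J') = J" by (rule the_equality) (use that P_eq_iff in auto)
    then show ?thesis by (simp add: \<phi>_def)
  qed
  have gs: "good (s J) \<longleftrightarrow> good J" for J using good_shift by (simp add: s_def)
  have inj: "inj (\<lambda>i::7. i + 1)" by (rule injI) simp
  have sub: "s J \<subseteq> s J' \<longleftrightarrow> J \<subseteq> J'" for J J' unfolding s_def using inj by (rule inj_image_subset_iff)
  have surj: "\<exists>J. s J = J'" for J'
    by (rule exI[of _ "(\<lambda>i. i - 1) ` J'"]) (simp add: s_def image_image)
  have "comb_iso \<phi> (cells tess) (cells tess)"
    unfolding comb_iso_def bij_betw_def
  proof (intro conjI ballI)
    show inc: "\<phi> A \<subseteq> \<phi> A' \<longleftrightarrow> A \<subseteq> A'" if AA: "A \<in> cells tess" "A' \<in> cells tess" for A A'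
    proof -
      obtain J J' where J: "good J" "A = P J" "good J'" "A' = P J'" using AA unfolding cells_tess by auto
      have "\<phi> A \<subseteq> \<phi> A' \<longleftrightarrow> s J' \<subseteq> s J" using J phi P_subset_iff[of "s J"] gs by simp
      also have "\<dots> \<longleftrightarrow> A \<subseteq> A'" using sub J P_subset_iff[OF J(1)] by simp
      finally show ?thesis .
    qed
    show "inj_on \<phi> (cells tess)" 
    proof (rule inj_onI)
      fix A A' assume "A \<in> cells tess" "A' \<in> cells tess" "\<phi> A = \<phi> A'"
      with inc[of A A'] inc[of A' A] show "A = A'" by auto
    qed
    show "\<phi> ` cells tess = cells tess"
    proof
      show "\<phi> ` cells tess \<subseteq> cells tess" unfolding cells_tess using phi gs by (auto simp: s_def)
      show "cells tess \<subseteq> \<phi> ` cells tess"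
      proof
        fix F assume "F \<in> cells tess"
        then obtain J' where J': "good J'" "J' \<noteq> {}" "F = P J'" unfolding cells_tess by auto
        obtain J where J: "s J = J'" using surj by blast
        then have "good J" "J \<noteq> {}" using J' gs by (auto simp: s_def)
        then show "F \<in> \<phi> ` cells tess" using J' J phi[of J] unfolding cells_tess by force
      qed
    qed
  qed
  moreover have "\<phi> (P {k}) = P {k + 1}" for k using phi[OF good_card1] by (simp add: s_def)
  ultimately show ?thesis by blast
qed

end

text \<open>The zero set of the vertex of the facet \<open>P {0}\<close> that corresponds to a vertex of the abstract dumpling.\<close>

definition lz :: "nat \<times> nat \<Rightarrow> 7 set" where
  "lz p = (if p = (0, 0) then {5, 6, 0, 1} else if p = (Suc 0, 0) then {6, 0, 1, 2}
    else if p = (2, 0) then {0, 1, 2, 3} else if p = (3, 0) then {0, 1, 3, 4}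
    else if p = (4, 0) then {4, 5, 0, 1} else if p = (2, Suc 0) then {6, 0, 2, 3}
    else if p = (3, Suc 0) then {3, 4, 6, 0} else {4, 5, 6, 0})"

text \<open>Eight labels instead of ten: over the crushed edge \<open>{0, 1}\<close> only the second
  coordinate 0 survives.\<close>

definition L8 :: "(nat \<times> nat) set" where
  "L8 = {(0, 0), (Suc 0, 0), (2, 0), (3, 0), (4, 0), (2, Suc 0), (3, Suc 0), (4, Suc 0)}"

text \<open>Sends a face of \<open>P {0}\<close>, given by its zero set, to the labels of its
  vertices; this is the isomorphism onto the abstract dumpling.\<close>

definition labels :: "7 set \<Rightarrow> (nat \<times> nat) set" where "labels D = {p \<in> L8. D \<subseteq> lz p}"

lemma Collect_mem_insert: "{p \<in> insert x A. Q p} = (if Q x then {x} else {}) \<union> {p \<in> A. Q p}"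
  by auto

lemma labels_eq: "labels D = (if D \<subseteq> {5, 6, 0, 1} then {(0, 0)} else {}) \<union>
  (if D \<subseteq> {6, 0, 1, 2} then {(Suc 0, 0)} else {}) \<union> (if D \<subseteq> {0, 1, 2, 3} then {(2, 0)} else {}) \<union>
  (if D \<subseteq> {0, 1, 3, 4} then {(3, 0)} else {}) \<union> (if D \<subseteq> {4, 5, 0, 1} then {(4, 0)} else {}) \<union>
  (if D \<subseteq> {6, 0, 2, 3} then {(2, Suc 0)} else {}) \<union> (if D \<subseteq> {3, 4, 6, 0} then {(3, Suc 0)} else {}) \<union>
  (if D \<subseteq> {4, 5, 6, 0} then {(4, Suc 0)} else {})"
  unfolding labels_def L8_def Collect_mem_insert by (simp only: lz_def prod.inject) (simp add: Un_assoc)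

lemma interval_faces_eq: "interval_faces = {{0}, {Suc 0}, {0, Suc 0}}"
  by (simp add: interval_faces_def)

lemma pentagon_faces_eq: "pentagon_faces = {{0}, {Suc 0}, {2}, {3}, {4}, {0, Suc 0}, {Suc 0, 2}, {2, 3}, {3, 4}, {0, 4}, {0, Suc 0, 2, 3, 4}}"
proof -
  have lt: "i < 5 \<longleftrightarrow> i \<in> {0, Suc 0, 2, 3, 4}" for i :: nat by auto
  have c: "{g i |i. i \<in> S} = g ` S" for g :: "nat \<Rightarrow> nat set" and S by auto
  have "{0..<5::nat} = {0, Suc 0, 2, 3, 4}" by auto
  then show ?thesis unfolding pentagon_faces_def lt c by (simp add: insert_commute flip: numeral_2_eq_2)
qed

lemma crush_simps: "crush (0, s) = (0, 0)" "crush (Suc 0, s) = (Suc 0, 0)"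
  "crush (2, s) = (2, s)" "crush (3, s) = (3, s)" "crush (4, s) = (4, s)"
  by (simp_all add: crush_def)

lemma dumpling_faces_eq: "dumpling_faces = {crush ` (A \<times> B) |A B. A \<in> pentagon_faces \<and> B \<in> interval_faces}"
  unfolding dumpling_faces_def prism_faces_def by auto

text \<open>All products of the eleven pentagon faces with the three interval faces. The three
  products over each of \<open>{0}\<close>, \<open>{1}\<close> and \<open>{0, 1}\<close> coincide,
  which reduces 33 to 27.\<close>

lemma crush_image:
  "crush ` ({0} \<times> {0}) = {(0, 0)}"
  "crush ` ({0} \<times> {Suc 0}) = {(0, 0)}"
  "crush ` ({0} \<times> {0, Suc 0}) = {(0, 0)}"
  "crush ` ({Suc 0} \<times> {0}) = {(Suc 0, 0)}"
  "crush ` ({Suc 0} \<times> {Suc 0}) = {(Suc 0, 0)}"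
  "crush ` ({Suc 0} \<times> {0, Suc 0}) = {(Suc 0, 0)}"
  "crush ` ({2} \<times> {0}) = {(2, 0)}"
  "crush ` ({2} \<times> {Suc 0}) = {(2, Suc 0)}"
  "crush ` ({2} \<times> {0, Suc 0}) = {(2, 0), (2, Suc 0)}"
  "crush ` ({3} \<times> {0}) = {(3, 0)}"
  "crush ` ({3} \<times> {Suc 0}) = {(3, Suc 0)}"
  "crush ` ({3} \<times> {0, Suc 0}) = {(3, 0), (3, Suc 0)}"
  "crush ` ({4} \<times> {0}) = {(4, 0)}"
  "crush ` ({4} \<times> {Suc 0}) = {(4, Suc 0)}"
  "crush ` ({4} \<times> {0, Suc 0}) = {(4, 0), (4, Suc 0)}"
  "crush ` ({0, Suc 0} \<times> {0}) = {(0, 0), (Suc 0, 0)}"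
  "crush ` ({0, Suc 0} \<times> {Suc 0}) = {(0, 0), (Suc 0, 0)}"
  "crush ` ({0, Suc 0} \<times> {0, Suc 0}) = {(0, 0), (Suc 0, 0)}"
  "crush ` ({Suc 0, 2} \<times> {0}) = {(Suc 0, 0), (2, 0)}"
  "crush ` ({Suc 0, 2} \<times> {Suc 0}) = {(Suc 0, 0), (2, Suc 0)}"
  "crush ` ({Suc 0, 2} \<times> {0, Suc 0}) = {(Suc 0, 0), (2, 0), (2, Suc 0)}"
  "crush ` ({2, 3} \<times> {0}) = {(2, 0), (3, 0)}"
  "crush ` ({2, 3} \<times> {Suc 0}) = {(2, Suc 0), (3, Suc 0)}"
  "crush ` ({2, 3} \<times> {0, Suc 0}) = {(2, 0), (3, 0), (2, Suc 0), (3, Suc 0)}"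
  "crush ` ({3, 4} \<times> {0}) = {(3, 0), (4, 0)}"
  "crush ` ({3, 4} \<times> {Suc 0}) = {(3, Suc 0), (4, Suc 0)}"
  "crush ` ({3, 4} \<times> {0, Suc 0}) = {(3, 0), (4, 0), (3, Suc 0), (4, Suc 0)}"
  "crush ` ({0, 4} \<times> {0}) = {(0, 0), (4, 0)}"
  "crush ` ({0, 4} \<times> {Suc 0}) = {(0, 0), (4, Suc 0)}"
  "crush ` ({0, 4} \<times> {0, Suc 0}) = {(0, 0), (4, 0), (4, Suc 0)}"
  "crush ` ({0, Suc 0, 2, 3, 4} \<times> {0}) = {(0, 0), (Suc 0, 0), (2, 0), (3, 0), (4, 0)}"
  "crush ` ({0, Suc 0, 2, 3, 4} \<times> {Suc 0}) = {(0, 0), (Suc 0, 0), (2, Suc 0), (3, Suc 0), (4, Suc 0)}"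
  "crush ` ({0, Suc 0, 2, 3, 4} \<times> {0, Suc 0}) = {(0, 0), (Suc 0, 0), (2, 0), (3, 0), (4, 0), (2, Suc 0), (3, Suc 0), (4, Suc 0)}"
  by (simp_all add: image_Un crush_simps insert_commute)

text \<open>One row for each of the 8 vertices, 12 edges, 6 two-dimensional faces and the dumpling
  itself.\<close>

lemma labels_table:
  "labels {0, 1, 5, 6} = {(0, 0)}"
  "labels {0, 1, 2, 6} = {(Suc 0, 0)}"
  "labels {0, 1, 2, 3} = {(2, 0)}"
  "labels {0, 2, 3, 6} = {(2, Suc 0)}"
  "labels {0, 2, 3} = {(2, 0), (2, Suc 0)}"
  "labels {0, 1, 3, 4} = {(3, 0)}"
  "labels {0, 3, 4, 6} = {(3, Suc 0)}"
  "labels {0, 3, 4} = {(3, 0), (3, Suc 0)}"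
  "labels {0, 1, 4, 5} = {(4, 0)}"
  "labels {0, 4, 5, 6} = {(4, Suc 0)}"
  "labels {0, 4, 5} = {(4, 0), (4, Suc 0)}"
  "labels {0, 1, 6} = {(0, 0), (Suc 0, 0)}"
  "labels {0, 1, 2} = {(Suc 0, 0), (2, 0)}"
  "labels {0, 2, 6} = {(Suc 0, 0), (2, Suc 0)}"
  "labels {0, 2} = {(Suc 0, 0), (2, 0), (2, Suc 0)}"
  "labels {0, 1, 3} = {(2, 0), (3, 0)}"
  "labels {0, 3, 6} = {(2, Suc 0), (3, Suc 0)}"
  "labels {0, 3} = {(2, 0), (3, 0), (2, Suc 0), (3, Suc 0)}"
  "labels {0, 1, 4} = {(3, 0), (4, 0)}"
  "labels {0, 4, 6} = {(3, Suc 0), (4, Suc 0)}"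
  "labels {0, 4} = {(3, 0), (4, 0), (3, Suc 0), (4, Suc 0)}"
  "labels {0, 1, 5} = {(0, 0), (4, 0)}"
  "labels {0, 5, 6} = {(0, 0), (4, Suc 0)}"
  "labels {0, 5} = {(0, 0), (4, 0), (4, Suc 0)}"
  "labels {0, 1} = {(0, 0), (Suc 0, 0), (2, 0), (3, 0), (4, 0)}"
  "labels {0, 6} = {(0, 0), (Suc 0, 0), (2, Suc 0), (3, Suc 0), (4, Suc 0)}"
  "labels {0} = {(0, 0), (Suc 0, 0), (2, 0), (3, 0), (4, 0), (2, Suc 0), (3, Suc 0), (4, Suc 0)}"
  by (simp_all add: labels_eq insert_commute)

lemma good_table:
  "good {0, 1, 5, 6}"
  "good {0, 1, 2, 6}"
  "good {0, 1, 2, 3}"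
  "good {0, 2, 3, 6}"
  "good {0, 2, 3}"
  "good {0, 1, 3, 4}"
  "good {0, 3, 4, 6}"
  "good {0, 3, 4}"
  "good {0, 1, 4, 5}"
  "good {0, 4, 5, 6}"
  "good {0, 4, 5}"
  "good {0, 1, 6}"
  "good {0, 1, 2}"
  "good {0, 2, 6}"
  "good {0, 2}"
  "good {0, 1, 3}"
  "good {0, 3, 6}"
  "good {0, 3}"
  "good {0, 1, 4}"
  "good {0, 4, 6}"
  "good {0, 4}"
  "good {0, 1, 5}"
  "good {0, 5, 6}"
  "good {0, 5}"
  "good {0, 1}"
  "good {0, 6}"
  "good {0}"
  by (simp_all add: good_def all7)

lemma dumpling_faces_labels:
  assumes "F \<in> dumpling_faces"
  shows "\<exists>D. good D \<and> 0 \<in> D \<and> F = labels D"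
proof -
  obtain A B where F: "F = crush ` (A \<times> B)" and A: "A \<in> pentagon_faces" and B: "B \<in> interval_faces"
    using assms unfolding dumpling_faces_eq by auto
  have ex: "good D \<Longrightarrow> 0 \<in> D \<Longrightarrow> labels D = X \<Longrightarrow> \<exists>D. good D \<and> 0 \<in> D \<and> X = labels D" for D X by auto
  note ex = ex[OF good_table(1) _ labels_table(1), simplified]
    ex[OF good_table(2) _ labels_table(2), simplified]
    ex[OF good_table(3) _ labels_table(3), simplified]
    ex[OF good_table(4) _ labels_table(4), simplified]
    ex[OF good_table(5) _ labels_table(5), simplified]
    ex[OF good_table(6) _ labels_table(6), simplified]
    ex[OF good_table(7) _ labels_table(7), simplified]
    ex[OF good_table(8) _ labels_table(8), simplified]
    ex[OF good_table(9) _ labels_table(9), simplified]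
    ex[OF good_table(10) _ labels_table(10), simplified]
    ex[OF good_table(11) _ labels_table(11), simplified]
    ex[OF good_table(12) _ labels_table(12), simplified]
    ex[OF good_table(13) _ labels_table(13), simplified]
    ex[OF good_table(14) _ labels_table(14), simplified]
    ex[OF good_table(15) _ labels_table(15), simplified]
    ex[OF good_table(16) _ labels_table(16), simplified]
    ex[OF good_table(17) _ labels_table(17), simplified]
    ex[OF good_table(18) _ labels_table(18), simplified]
    ex[OF good_table(19) _ labels_table(19), simplified]
    ex[OF good_table(20) _ labels_table(20), simplified]
    ex[OF good_table(21) _ labels_table(21), simplified]
    ex[OF good_table(22) _ labels_table(22), simplified]
    ex[OF good_table(23) _ labels_table(23), simplified]
    ex[OF good_table(24) _ labels_table(24), simplified]
    ex[OF good_table(25) _ labels_table(25), simplified]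
    ex[OF good_table(26) _ labels_table(26), simplified]
    ex[OF good_table(27) _ labels_table(27), simplified]
  show ?thesis
    using A B unfolding F pentagon_faces_eq interval_faces_eq
    by (simp only: insert_iff empty_iff simp_thms) (elim disjE; simp only: crush_image; rule ex)
qed

lemma dumpling_face_table:
  "{(0, 0)} \<in> dumpling_faces"
  "{(Suc 0, 0)} \<in> dumpling_faces"
  "{(2, 0)} \<in> dumpling_faces"
  "{(2, Suc 0)} \<in> dumpling_faces"
  "{(2, 0), (2, Suc 0)} \<in> dumpling_faces"
  "{(3, 0)} \<in> dumpling_faces"
  "{(3, Suc 0)} \<in> dumpling_faces"
  "{(3, 0), (3, Suc 0)} \<in> dumpling_faces"
  "{(4, 0)} \<in> dumpling_faces"
  "{(4, Suc 0)} \<in> dumpling_faces"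
  "{(4, 0), (4, Suc 0)} \<in> dumpling_faces"
  "{(0, 0), (Suc 0, 0)} \<in> dumpling_faces"
  "{(Suc 0, 0), (2, 0)} \<in> dumpling_faces"
  "{(Suc 0, 0), (2, Suc 0)} \<in> dumpling_faces"
  "{(Suc 0, 0), (2, 0), (2, Suc 0)} \<in> dumpling_faces"
  "{(2, 0), (3, 0)} \<in> dumpling_faces"
  "{(2, Suc 0), (3, Suc 0)} \<in> dumpling_faces"
  "{(2, 0), (3, 0), (2, Suc 0), (3, Suc 0)} \<in> dumpling_faces"
  "{(3, 0), (4, 0)} \<in> dumpling_faces"
  "{(3, Suc 0), (4, Suc 0)} \<in> dumpling_faces"
  "{(3, 0), (4, 0), (3, Suc 0), (4, Suc 0)} \<in> dumpling_faces"
  "{(0, 0), (4, 0)} \<in> dumpling_faces"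
  "{(0, 0), (4, Suc 0)} \<in> dumpling_faces"
  "{(0, 0), (4, 0), (4, Suc 0)} \<in> dumpling_faces"
  "{(0, 0), (Suc 0, 0), (2, 0), (3, 0), (4, 0)} \<in> dumpling_faces"
  "{(0, 0), (Suc 0, 0), (2, Suc 0), (3, Suc 0), (4, Suc 0)} \<in> dumpling_faces"
  "{(0, 0), (Suc 0, 0), (2, 0), (3, 0), (4, 0), (2, Suc 0), (3, Suc 0), (4, Suc 0)} \<in> dumpling_faces"
proof -
  have "crush ` (A \<times> B) \<in> dumpling_faces" if "A \<in> pentagon_faces" "B \<in> interval_faces" for A B
    unfolding dumpling_faces_eq using that by auto
  note c = this[unfolded pentagon_faces_eq interval_faces_eq]
  show "{(0, 0)} \<in> dumpling_faces"
    unfolding crush_image(1)[symmetric] by (rule c) simp_all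
  show "{(Suc 0, 0)} \<in> dumpling_faces"
    unfolding crush_image(4)[symmetric] by (rule c) simp_all
  show "{(2, 0)} \<in> dumpling_faces"
    unfolding crush_image(7)[symmetric] by (rule c) simp_all
  show "{(2, Suc 0)} \<in> dumpling_faces"
    unfolding crush_image(8)[symmetric] by (rule c) simp_all
  show "{(2, 0), (2, Suc 0)} \<in> dumpling_faces"
    unfolding crush_image(9)[symmetric] by (rule c) simp_all
  show "{(3, 0)} \<in> dumpling_faces"
    unfolding crush_image(10)[symmetric] by (rule c) simp_all
  show "{(3, Suc 0)} \<in> dumpling_faces"
    unfolding crush_image(11)[symmetric] by (rule c) simp_all
  show "{(3, 0), (3, Suc 0)} \<in> dumpling_faces"
    unfolding crush_image(12)[symmetric] by (rule c) simp_all
  show "{(4, 0)} \<in> dumpling_faces"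
    unfolding crush_image(13)[symmetric] by (rule c) simp_all
  show "{(4, Suc 0)} \<in> dumpling_faces"
    unfolding crush_image(14)[symmetric] by (rule c) simp_all
  show "{(4, 0), (4, Suc 0)} \<in> dumpling_faces"
    unfolding crush_image(15)[symmetric] by (rule c) simp_all
  show "{(0, 0), (Suc 0, 0)} \<in> dumpling_faces"
    unfolding crush_image(16)[symmetric] by (rule c) simp_all
  show "{(Suc 0, 0), (2, 0)} \<in> dumpling_faces"
    unfolding crush_image(19)[symmetric] by (rule c) simp_all
  show "{(Suc 0, 0), (2, Suc 0)} \<in> dumpling_faces"
    unfolding crush_image(20)[symmetric] by (rule c) simp_all
  show "{(Suc 0, 0), (2, 0), (2, Suc 0)} \<in> dumpling_faces"
    unfolding crush_image(21)[symmetric] by (rule c) simp_all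
  show "{(2, 0), (3, 0)} \<in> dumpling_faces"
    unfolding crush_image(22)[symmetric] by (rule c) simp_all
  show "{(2, Suc 0), (3, Suc 0)} \<in> dumpling_faces"
    unfolding crush_image(23)[symmetric] by (rule c) simp_all
  show "{(2, 0), (3, 0), (2, Suc 0), (3, Suc 0)} \<in> dumpling_faces"
    unfolding crush_image(24)[symmetric] by (rule c) simp_all
  show "{(3, 0), (4, 0)} \<in> dumpling_faces"
    unfolding crush_image(25)[symmetric] by (rule c) simp_all
  show "{(3, Suc 0), (4, Suc 0)} \<in> dumpling_faces"
    unfolding crush_image(26)[symmetric] by (rule c) simp_all
  show "{(3, 0), (4, 0), (3, Suc 0), (4, Suc 0)} \<in> dumpling_faces"
    unfolding crush_image(27)[symmetric] by (rule c) simp_all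
  show "{(0, 0), (4, 0)} \<in> dumpling_faces"
    unfolding crush_image(28)[symmetric] by (rule c) simp_all
  show "{(0, 0), (4, Suc 0)} \<in> dumpling_faces"
    unfolding crush_image(29)[symmetric] by (rule c) simp_all
  show "{(0, 0), (4, 0), (4, Suc 0)} \<in> dumpling_faces"
    unfolding crush_image(30)[symmetric] by (rule c) simp_all
  show "{(0, 0), (Suc 0, 0), (2, 0), (3, 0), (4, 0)} \<in> dumpling_faces"
    unfolding crush_image(31)[symmetric] by (rule c) simp_all
  show "{(0, 0), (Suc 0, 0), (2, Suc 0), (3, Suc 0), (4, Suc 0)} \<in> dumpling_faces"
    unfolding crush_image(32)[symmetric] by (rule c) simp_all
  show "{(0, 0), (Suc 0, 0), (2, 0), (3, 0), (4, 0), (2, Suc 0), (3, Suc 0), (4, Suc 0)} \<in> dumpling_faces"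
    unfolding crush_image(33)[symmetric] by (rule c) simp_all
qed

lemma subset_insert_cases:
  assumes "x \<in> D" "D \<subseteq> {x, a, b, c}"
  shows "D \<in> {{x}, {x, a}, {x, b}, {x, c}, {x, a, b}, {x, a, c}, {x, b, c}, {x, a, b, c}}"
proof -
  have "insert x ((if c \<in> D then {c} else {}) \<union> ((if b \<in> D then {b} else {}) \<union> (if a \<in> D then {a} else {}))) = D"
    using assms by auto
  then show ?thesis by (cases "a \<in> D"; cases "b \<in> D"; cases "c \<in> D") simp_all
qed

text \<open>A good set containing 0 lies in one of the eight maximal good sets through 0, and each
  of these has eight subsets through 0, all of them in the table.\<close>

lemma labels_dumpling_faces:
  assumes "good D" "0 \<in> D"
  shows "labels D \<in> dumpling_faces"
proof -
  have z: "0 \<in> zV k \<longleftrightarrow> k = 0 \<or> k = 6 \<or> k = 5 \<or> k = 4" "0 \<in> zU k \<longleftrightarrow> k = 0 \<or> k = 6 \<or> k = 4 \<or> k = 3" for k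
    by (cases k "0::7" rule: cases7; simp add: zV_def zU_def)+
  have "D \<subseteq> zV 0 \<or> D \<subseteq> zV 6 \<or> D \<subseteq> zV 5 \<or> D \<subseteq> zV 4 \<or> D \<subseteq> zU 0 \<or> D \<subseteq> zU 6 \<or> D \<subseteq> zU 4 \<or> D \<subseteq> zU 3"
  proof -
    obtain j where "D \<subseteq> zV j \<or> D \<subseteq> zU j" using assms(1) unfolding good_iff by (rule exE)
    then show ?thesis
    proof
      assume s: "D \<subseteq> zV j"
      then have "0 \<in> zV j" using assms(2) by auto
      then have "j = 0 \<or> j = 6 \<or> j = 5 \<or> j = 4" using z(1) by simp
      then show ?thesis using s by (elim disjE) simp_all
    next
      assume s: "D \<subseteq> zU j"
      then have "0 \<in> zU j" using assms(2) by auto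
      then have "j = 0 \<or> j = 6 \<or> j = 4 \<or> j = 3" using z(2) by simp
      then show ?thesis using s by (elim disjE) simp_all
    qed
  qed
  then have "D \<subseteq> {0,1,2,3} \<or> D \<subseteq> {0,1,2,6} \<or> D \<subseteq> {0,1,5,6} \<or> D \<subseteq> {0,4,5,6} \<or>
      D \<subseteq> {0,1,3,4} \<or> D \<subseteq> {0,2,3,6} \<or> D \<subseteq> {0,1,4,5} \<or> D \<subseteq> {0,3,4,6}"
    by (simp add: zV_def zU_def insert_commute)
  then show ?thesis
    apply (elim disjE)
    apply (drule subset_insert_cases[OF assms(2)], elim insertE emptyE; simp only: labels_table dumpling_face_table)+
    done
qed

text \<open>If \<open>i\<close> lies in \<open>D'\<close> but not in \<open>D\<close>, then by
  \<open>good_separate\<close> some vertex of the face of \<open>D\<close> is not on the hyperplane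
  \<open>i\<close>, so its label distinguishes the two sets.\<close>

lemma labels_subset_iff:
  assumes "good D" "0 \<in> D" "good D'"
  shows "labels D \<subseteq> labels D' \<longleftrightarrow> D' \<subseteq> D"
proof
  assume sub: "labels D \<subseteq> labels D'"
  show "D' \<subseteq> D"
  proof (rule ccontr)
    assume "\<not> D' \<subseteq> D"
    then obtain i where i: "i \<in> D'" "i \<notin> D" by auto
    obtain W where W: "W \<in> range zV \<union> range zU" "D \<subseteq> W" "i \<notin> W"
      using good_separate[OF assms(1) i(2)] by auto
    have "\<exists>p\<in>L8. lz p = W"
    proof -
      have "0 \<in> W" using W assms(2) by auto
      have "0 \<in> zV k \<Longrightarrow> \<exists>p\<in>L8. lz p = zV k" "0 \<in> zU k \<Longrightarrow> \<exists>p\<in>L8. lz p = zU k" for k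
        by (cases k "0::7" rule: cases7; simp add: zV_def zU_def L8_def lz_def insert_commute)+
      then show ?thesis using W(1) \<open>0 \<in> W\<close> by auto
    qed
    then obtain p where "p \<in> L8" "lz p = W" by auto
    then have "p \<in> labels D" "p \<notin> labels D'" using W i by (auto simp: labels_def)
    then show False using sub by auto
  qed
qed (auto simp: labels_def)

context alternating
begin

lemma dumpling_P: "dumpling (P {k})"
proof -
  \<comment> \<open>Rotation by \<open>-k\<close> moves the facet \<open>k\<close> to the facet 0,
    for which the labels are defined.\<close>
  define sh where "sh J = (\<lambda>i. i - k) ` J" for J
  have good_sh: "good (sh J) \<longleftrightarrow> good J" for J
  proof -
    have m: "i - k \<in> sh J \<longleftrightarrow> i \<in> J" for i unfolding sh_def by (rule inj_image_mem_iff) (auto intro: injI)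
    have t: "(\<forall>i. Q i) \<longleftrightarrow> (\<forall>i. Q (i - k))" for Q by (metis add_diff_cancel)
    have "good (sh J) \<longleftrightarrow> (\<forall>i. \<not> (i - k \<in> sh J \<and> i + 2 - k \<in> sh J \<and> i + 4 - k \<in> sh J))"
      unfolding good_def by (subst t) (simp add: algebra_simps)
    then show ?thesis unfolding m good_def .
  qed
  have sub: "sh J \<subseteq> sh J' \<longleftrightarrow> J \<subseteq> J'" for J J' unfolding sh_def by (rule inj_image_subset_iff) (auto intro: injI)
  have zero: "0 \<in> sh J \<longleftrightarrow> k \<in> J" for J unfolding sh_def by (auto simp: image_iff)
  have surj: "\<exists>J. sh J = D" for D
    by (rule exI[of _ "(\<lambda>i. i + k) ` D"]) (simp add: sh_def image_image)
  have faces: "{F. proj_face F (P {k}) \<and> F \<noteq> {}} = {P J |J. good J \<and> k \<in> J}"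
    unfolding proj_face_P using P_nonempty by auto
  define \<phi> where "\<phi> F = labels (sh (THE J. good J \<and> F = P J))" for F
  have phi: "\<phi> (P J) = labels (sh J)" if "good J" for J
  proof -
    have "(THE J'. good J' \<and> P J = P J') = J" by (rule the_equality) (use that P_eq_iff in auto)
    then show ?thesis by (simp add: \<phi>_def)
  qed
  have "comb_iso \<phi> {P J |J. good J \<and> k \<in> J} dumpling_faces"
    unfolding comb_iso_def bij_betw_def
  proof (intro conjI ballI)
    show inc: "\<phi> A \<subseteq> \<phi> A' \<longleftrightarrow> A \<subseteq> A'" if AA: "A \<in> {P J |J. good J \<and> k \<in> J}" "A' \<in> {P J |J. good J \<and> k \<in> J}" for A A'
    proof -
      obtain J J' where J: "good J" "k \<in> J" "A = P J" "good J'" "A' = P J'" using AA by auto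
      have "\<phi> A \<subseteq> \<phi> A' \<longleftrightarrow> sh J' \<subseteq> sh J" using J phi labels_subset_iff[of "sh J" "sh J'"] good_sh zero by simp
      also have "\<dots> \<longleftrightarrow> A \<subseteq> A'" using sub J P_subset_iff[OF J(1)] by simp
      finally show ?thesis .
    qed
    show "inj_on \<phi> {P J |J. good J \<and> k \<in> J}"
    proof (rule inj_onI)
      fix A A' assume "A \<in> {P J |J. good J \<and> k \<in> J}" "A' \<in> {P J |J. good J \<and> k \<in> J}" "\<phi> A = \<phi> A'"
      with inc[of A A'] inc[of A' A] show "A = A'" by auto
    qed
    show "\<phi> ` {P J |J. good J \<and> k \<in> J} = dumpling_faces"
    proof (intro set_eqI iffI)
      fix F assume "F \<in> \<phi> ` {P J |J. good J \<and> k \<in> J}"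
      then obtain J where "good J" "k \<in> J" "F = \<phi> (P J)" by auto
      then show "F \<in> dumpling_faces" using phi labels_dumpling_faces[of "sh J"] good_sh zero by simp
    next
      fix F assume "F \<in> dumpling_faces"
      then obtain D where D: "good D" "0 \<in> D" "F = labels D" using dumpling_faces_labels by auto
      obtain J where J: "sh J = D" using surj by auto
      have "good J" "k \<in> J" using D J good_sh[of J] zero[of J] by simp_all
      then show "F \<in> \<phi> ` {P J |J. good J \<and> k \<in> J}"
        using phi[of J] D(3) J by (intro image_eqI[of _ _ "P J"]) auto
    qed
  qed
  then show ?thesis
    unfolding dumpling_def faces[symmetric] using proj_polytope_P[OF good_card1, of 3 k] by auto
qed

section \<open>The chamber in projective space: interior, closure and frontier\<close>

definition K :: "(real^5) set" where "K = {x. x \<noteq> 0 \<and> (\<forall>i. 0 \<le> f i x)}"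
definition Kp :: "(real^5) set" where "Kp = {x. \<forall>i. 0 < f i x}"
definition hyper :: "7 \<Rightarrow> (real^5) pspace set" where "hyper i = abs_pspace ` {x. x \<noteq> 0 \<and> f i x = 0}"
definition BR :: "(real^5) set" where "BR = {x \<in> R. Z x \<noteq> {}}"

lemma K_some_pos: "x \<in> K \<Longrightarrow> \<exists>i. 0 < f i x"
  using a_inj[of x] unfolding K_def by (force simp: less_le)

lemma hv_pos: "x \<in> K \<Longrightarrow> 0 < hv \<bullet> x"
proof -
  assume x: "x \<in> K"
  then obtain i where "0 < f i x" using K_some_pos by blast
  then have "0 < (\<Sum>i\<in>UNIV. f i x)" using x by (intro sum_pos2[of _ i]) (auto simp: K_def)
  then show ?thesis by (simp add: hv)
qed

lemma abs_K: "abs_pspace ` K = P {}"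
proof
  show "abs_pspace ` K \<subseteq> P {}"
  proof
    fix p assume "p \<in> abs_pspace ` K"
    then obtain x where x: "x \<in> K" "p = abs_pspace x" by auto
    have h: "0 < hv \<bullet> x" using hv_pos[OF x(1)] .
    have "(1 / (hv \<bullet> x)) *\<^sub>R x \<in> R" using x(1) h by (simp add: R_def K_def)
    moreover have "abs_pspace ((1 / (hv \<bullet> x)) *\<^sub>R x) = p"
      unfolding x(2) by (rule abs_pspace_scaleR) (use x h in \<open>auto simp: K_def\<close>)
    ultimately show "p \<in> P {}" by (auto simp: P_def FC_empty)
  qed
  show "P {} \<subseteq> abs_pspace ` K"
    unfolding P_def FC_empty by (rule image_mono) (use R_nz in \<open>auto simp: K_def R_def\<close>)
qed

lemma abs_mem_K:
  assumes "x \<noteq> 0"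
  shows "abs_pspace x \<in> abs_pspace ` K \<longleftrightarrow> (\<forall>i. 0 \<le> f i x) \<or> (\<forall>i. f i x \<le> 0)"
proof
  assume "abs_pspace x \<in> abs_pspace ` K"
  then obtain y where y: "y \<in> K" "abs_pspace x = abs_pspace y" by auto
  then have "y \<noteq> 0" by (simp add: K_def)
  then obtain r where r: "r \<noteq> 0" "y = r *\<^sub>R x" using y(2) abs_pspace_eq_iff assms by blast
  have "0 \<le> r * f i x" for i using y(1) r(2) by (simp add: K_def)
  then show "(\<forall>i. 0 \<le> f i x) \<or> (\<forall>i. f i x \<le> 0)"
    using r(1) by (cases "0 < r") (auto simp: zero_le_mult_iff)
next
  assume "(\<forall>i. 0 \<le> f i x) \<or> (\<forall>i. f i x \<le> 0)"
  then show "abs_pspace x \<in> abs_pspace ` K"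
  proof
    assume "\<forall>i. 0 \<le> f i x"
    then show ?thesis using assms by (auto simp: K_def)
  next
    assume "\<forall>i. f i x \<le> 0"
    then have "(-1) *\<^sub>R x \<in> K" using assms by (simp add: K_def)
    moreover have "abs_pspace ((-1) *\<^sub>R x) = abs_pspace x" using assms by (intro abs_pspace_scaleR) auto
    ultimately show ?thesis by (metis imageI)
  qed
qed

lemma Kp_nz: "x \<in> Kp \<Longrightarrow> x \<noteq> 0"
  by (auto simp: Kp_def)

lemma abs_mem_Kp:
  assumes "x \<noteq> 0"
  shows "abs_pspace x \<in> abs_pspace ` Kp \<longleftrightarrow> (\<forall>i. 0 < f i x) \<or> (\<forall>i. f i x < 0)"
proof
  assume "abs_pspace x \<in> abs_pspace ` Kp"
  then obtain y where y: "y \<in> Kp" "abs_pspace x = abs_pspace y" by auto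
  then have "y \<noteq> 0" by (simp add: Kp_nz)
  then obtain r where r: "r \<noteq> 0" "y = r *\<^sub>R x" using y(2) abs_pspace_eq_iff assms by blast
  have "0 < r * f i x" for i using y(1) r(2) by (simp add: Kp_def)
  then show "(\<forall>i. 0 < f i x) \<or> (\<forall>i. f i x < 0)"
    using r(1) by (cases "0 < r") (auto simp: zero_less_mult_iff)
next
  assume "(\<forall>i. 0 < f i x) \<or> (\<forall>i. f i x < 0)"
  then show "abs_pspace x \<in> abs_pspace ` Kp"
  proof
    assume "\<forall>i. 0 < f i x"
    then show ?thesis by (auto simp: Kp_def)
  next
    assume "\<forall>i. f i x < 0"
    then have "(-1) *\<^sub>R x \<in> Kp" by (simp add: Kp_def)
    moreover have "abs_pspace ((-1) *\<^sub>R x) = abs_pspace x" using assms by (intro abs_pspace_scaleR) auto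
    ultimately show ?thesis by (metis imageI)
  qed
qed

lemma open_all_less: "open {x. \<forall>i::7. g i x < h i x}"
  if "\<And>i. continuous_on UNIV (g i)" "\<And>i. continuous_on UNIV (h i)"
  for g h :: "7 \<Rightarrow> real^5 \<Rightarrow> real"
proof -
  have "{x. \<forall>i. g i x < h i x} = (\<Inter>i. {x. g i x < h i x})" by auto
  then show ?thesis using that by (auto intro!: open_INT open_Collect_less)
qed

lemma open_Kp: "open (abs_pspace ` Kp)"
proof -
  have "{x. x \<noteq> 0 \<and> abs_pspace x \<in> abs_pspace ` Kp} = {x. \<forall>i. 0 < f i x} \<union> {x. \<forall>i. f i x < 0}"
  proof (intro set_eqI iffI)
    fix x assume "x \<in> {x. \<forall>i. 0 < f i x} \<union> {x. \<forall>i. f i x < 0}"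
    moreover from this have "x \<noteq> 0" by auto
    ultimately show "x \<in> {x. x \<noteq> 0 \<and> abs_pspace x \<in> abs_pspace ` Kp}" using abs_mem_Kp by simp
  qed (use abs_mem_Kp in auto)
  moreover have "open ({x. \<forall>i. 0 < f i x} \<union> {x. \<forall>i. f i x < 0})"
    by (intro open_Un open_all_less continuous_intros)
  ultimately show ?thesis by (simp add: open_pspace_def)
qed

lemma closed_K: "closed (abs_pspace ` K)"
proof -
  have "{x. x \<noteq> 0 \<and> abs_pspace x \<in> - abs_pspace ` K} = (\<Union>i. {x. f i x < 0}) \<inter> (\<Union>i. {x. 0 < f i x})"
  proof (intro set_eqI iffI)
    fix x assume "x \<in> (\<Union>i. {x. f i x < 0}) \<inter> (\<Union>i. {x. 0 < f i x})"
    then obtain i j where "f i x < 0" "0 < f j x" by auto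
    moreover from this have "x \<noteq> 0" by auto
    ultimately show "x \<in> {x. x \<noteq> 0 \<and> abs_pspace x \<in> - abs_pspace ` K}"
      using abs_mem_K[of x] by (auto simp: not_le)
  qed (auto simp: abs_mem_K not_le)
  moreover have "open ((\<Union>i. {x. f i x < 0}) \<inter> (\<Union>i. {x. 0 < f i x}))"
    by (intro open_Int open_UN ballI open_Collect_less continuous_intros)
  ultimately show ?thesis by (simp add: closed_def open_pspace_def)
qed

lemma c_nz: "c \<noteq> 0" using a_c[of 0] by auto

text \<open>Along \<open>c\<close> all functionals change at the same rate, so one small shift
  enters the open cone and the opposite one leaves it at a boundary point.\<close>

lemma small_shift:
  assumes "open T" "x \<in> T" "0 < e"
  shows "\<exists>s>0. s < e \<and> x + s *\<^sub>R c \<in> T \<and> x - s *\<^sub>R c \<in> T"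
proof -
  obtain d where d: "d > 0" "ball x d \<subseteq> T" using assms open_contains_ball by blast
  define s where "s = min (e/2) (d / (2 * norm c))"
  have s: "0 < s" "s < e" using assms d c_nz by (auto simp: s_def)
  have "s * norm c \<le> d / (2 * norm c) * norm c" by (intro mult_right_mono) (auto simp: s_def)
  also have "\<dots> < d" using d c_nz by simp
  finally have "x + s *\<^sub>R c \<in> ball x d" "x - s *\<^sub>R c \<in> ball x d" using s by (auto simp: dist_norm)
  then show ?thesis using s d(2) by blast
qed

lemma closure_Kp: "closure (abs_pspace ` Kp) = abs_pspace ` K"
proof
  have "Kp \<subseteq> K" by (auto simp: K_def Kp_def Kp_nz less_imp_le)
  then show "closure (abs_pspace ` Kp) \<subseteq> abs_pspace ` K"
    by (intro closure_minimal image_mono closed_K)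
  show "abs_pspace ` K \<subseteq> closure (abs_pspace ` Kp)"
  proof
    fix p assume "p \<in> abs_pspace ` K"
    then obtain x where x: "x \<in> K" "p = abs_pspace x" by auto
    have "abs_pspace ` Kp \<inter> T \<noteq> {}" if T: "open T" "p \<in> T" for T
    proof -
      let ?O = "{x. x \<noteq> 0 \<and> abs_pspace x \<in> T}"
      have "open ?O" using T(1) by (simp add: open_pspace_def)
      moreover have "x \<in> ?O" using x T by (auto simp: K_def)
      ultimately obtain s where s: "0 < s" "x + s *\<^sub>R c \<in> ?O" using small_shift[of ?O x 1] by auto
      have "x + s *\<^sub>R c \<in> Kp" using x(1) s(1) by (auto simp: Kp_def K_def inner_add_right a_c intro: add_nonneg_pos)
      then show ?thesis using s(2) by auto
    qed
    then show "p \<in> closure (abs_pspace ` Kp)"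
      unfolding closure_iff_nhds_not_empty
    proof (intro allI impI)
      fix A S assume "S \<subseteq> A" "open S" "p \<in> S"
      from \<open>\<And>T. open T \<Longrightarrow> p \<in> T \<Longrightarrow> abs_pspace ` Kp \<inter> T \<noteq> {}\<close>[OF this(2,3)] this(1)
      show "abs_pspace ` Kp \<inter> A \<noteq> {}" by auto
    qed
  qed
qed

text \<open>At a point with \<open>f j\<close> zero, subtracting a small multiple of
  \<open>c\<close> makes \<open>f j\<close> negative while some \<open>f i\<close> stays positive;
  such a point is outside under both choices of sign of the representative.\<close>

lemma interior_K: "interior (abs_pspace ` K) = abs_pspace ` Kp"
proof
  have "Kp \<subseteq> K" by (auto simp: K_def Kp_def Kp_nz less_imp_le)
  then show "abs_pspace ` Kp \<subseteq> interior (abs_pspace ` K)"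
    by (intro interior_maximal image_mono open_Kp)
  show "interior (abs_pspace ` K) \<subseteq> abs_pspace ` Kp"
  proof
    fix p assume "p \<in> interior (abs_pspace ` K)"
    then obtain T where T: "open T" "p \<in> T" "T \<subseteq> abs_pspace ` K" by (auto simp: interior_def)
    then obtain x where x: "x \<in> K" "p = abs_pspace x" by auto
    have "0 < f j x" for j
    proof (rule ccontr)
      assume "\<not> 0 < f j x"
      then have j: "f j x = 0" using x(1) by (auto simp: K_def not_less intro: antisym)
      obtain i where i: "0 < f i x" using K_some_pos[OF x(1)] by blast
      let ?O = "{x. x \<noteq> 0 \<and> abs_pspace x \<in> T}"
      have "open ?O" using T(1) by (simp add: open_pspace_def)
      moreover have "x \<in> ?O" using x T by (auto simp: K_def)
      ultimately obtain s where s: "0 < s" "s < f i x" "x - s *\<^sub>R c \<in> ?O"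
        using small_shift[of ?O x "f i x"] i by auto
      then have "abs_pspace (x - s *\<^sub>R c) \<in> abs_pspace ` K" "x - s *\<^sub>R c \<noteq> 0" using T(3) by auto
      then have "(\<forall>i. 0 \<le> f i (x - s *\<^sub>R c)) \<or> (\<forall>i. f i (x - s *\<^sub>R c) \<le> 0)" using abs_mem_K by blast
      moreover have "f j (x - s *\<^sub>R c) < 0" "0 < f i (x - s *\<^sub>R c)"
        using s j by (simp_all add: inner_diff_right a_c)
      ultimately show False by (meson not_le)
    qed
    then show "p \<in> abs_pspace ` Kp" using x by (auto simp: Kp_def)
  qed
qed

lemma frontier_K: "frontier (abs_pspace ` K) = abs_pspace ` BR"
proof -
  have 1: "abs_pspace ` K - abs_pspace ` Kp = abs_pspace ` R - abs_pspace ` Kp"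
    using abs_K by (simp add: P_def FC_empty)
  have "abs_pspace ` R - abs_pspace ` Kp = abs_pspace ` BR"
  proof (intro set_eqI iffI)
    fix p assume "p \<in> abs_pspace ` R - abs_pspace ` Kp"
    then obtain x where x: "x \<in> R" "p = abs_pspace x" "x \<notin> Kp" by auto
    then obtain i where "\<not> 0 < f i x" by (auto simp: Kp_def)
    then have "i \<in> Z x" using R_nonneg[OF x(1), of i] by (simp add: Z_def)
    then show "p \<in> abs_pspace ` BR" using x by (auto simp: BR_def)
  next
    fix p assume "p \<in> abs_pspace ` BR"
    then obtain x i where x: "x \<in> R" "p = abs_pspace x" "f i x = 0" by (auto simp: BR_def Z_def)
    then have "abs_pspace x \<notin> abs_pspace ` Kp" using abs_mem_Kp[OF R_nz[OF x(1)]] by (metis less_irrefl)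
    then show "p \<in> abs_pspace ` R - abs_pspace ` Kp" using x by auto
  qed
  then show ?thesis using 1 closure_closed[OF closed_K] interior_K by (simp add: frontier_def)
qed

lemma BR_P: "abs_pspace ` BR = (\<Union>j. P {j})"
proof -
  have "(\<Union>j. P {j}) = \<Union>(P ` range (\<lambda>j. {j}))" by auto
  also have "\<dots> = abs_pspace ` BR" unfolding Union_P BR_def by (rule arg_cong[where f = "image abs_pspace"]) auto
  finally show ?thesis by simp
qed

lemma K_hyper: "abs_pspace ` K \<inter> hyper j = P {j}"
proof
  show "abs_pspace ` K \<inter> hyper j \<subseteq> P {j}"
  proof
    fix p assume p: "p \<in> abs_pspace ` K \<inter> hyper j"
    then have "p \<in> abs_pspace ` R" using abs_K by (simp add: P_def FC_empty)
    then obtain x where x: "x \<in> R" "p = abs_pspace x" by auto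
    obtain y where y: "y \<noteq> 0" "f j y = 0" "abs_pspace y = abs_pspace x" using p x by (auto simp: hyper_def)
    then obtain r where "x = r *\<^sub>R y" using abs_pspace_eq_iff R_nz[OF x(1)] by blast
    then have "f j x = 0" using y by simp
    then show "p \<in> P {j}" using x abs_in_P by (simp add: Z_def)
  qed
  show "P {j} \<subseteq> abs_pspace ` K \<inter> hyper j"
  proof
    fix p assume "p \<in> P {j}"
    then obtain x where x: "x \<in> R" "f j x = 0" "p = abs_pspace x" by (auto simp: P_def FC_def)
    then show "p \<in> abs_pspace ` K \<inter> hyper j" using R_nz[OF x(1)] by (auto simp: K_def hyper_def R_def)
  qed
qed

text \<open>Points of \<open>K\<close> outside \<open>Kp\<close> lie on a hyperplane, so the
  complement of the hyperplanes is covered by two disjoint open sets, the image of \<open>Kp\<close>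
  and the complement of the image of \<open>K\<close>. The former is connected because
  \<open>Kp\<close> is convex, hence a component.\<close>

lemma chamber_K: "chamber (range hyper) (abs_pspace ` K)"
proof -
  let ?U = "abs_pspace ` Kp" and ?S = "- \<Union>(range hyper)"
  have memS: "p \<notin> ?S" if "p \<in> abs_pspace ` K" "p \<notin> ?U" for p
  proof -
    obtain x where x: "x \<in> K" "p = abs_pspace x" using \<open>p \<in> abs_pspace ` K\<close> by auto
    then obtain i where "\<not> 0 < f i x" using \<open>p \<notin> ?U\<close> by (auto simp: Kp_def)
    then have "f i x = 0" using x(1) by (auto simp: K_def not_less intro: antisym)
    then show ?thesis using x by (auto simp: hyper_def K_def)
  qed
  have US: "?U \<subseteq> ?S"
  proof
    fix p assume "p \<in> ?U"
    then obtain x where x: "x \<in> Kp" "p = abs_pspace x" by auto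
    have "p \<notin> hyper i" for i
    proof
      assume "p \<in> hyper i"
      then obtain y where y: "y \<noteq> 0" "f i y = 0" "abs_pspace y = abs_pspace x" using x by (auto simp: hyper_def)
      then obtain r where "x = r *\<^sub>R y" using abs_pspace_eq_iff Kp_nz[OF x(1)] by blast
      then have "f i x = 0" using y by simp
      with x(1) show False by (auto simp: Kp_def) (metis less_irrefl)
    qed
    then show "p \<in> ?S" by auto
  qed
  have "convex Kp" unfolding Kp_def convex_def
    by (auto simp: inner_add_right) (metis add.commute add_0 add_nonneg_pos add_pos_nonneg less_eq_real_def mult_nonneg_nonneg mult_pos_pos zero_neq_one less_le)
  moreover have "continuous_on Kp abs_pspace"
    by (rule continuous_on_subset[OF continuous_on_abs_pspace]) (use Kp_nz in auto)
  ultimately have conn: "connected ?U" by (intro connected_continuous_image convex_connected)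
  have ne: "?U \<noteq> {}" using a_c by (auto simp: Kp_def intro!: exI[of _ c])
  have "D = ?U" if D: "D \<noteq> {}" "?U \<subseteq> D" "D \<subseteq> ?S" "connected D" for D
  proof -
    have "D \<subseteq> ?U \<union> - abs_pspace ` K" using memS D(3) by auto
    moreover have "?U \<inter> - abs_pspace ` K \<inter> D = {}"
      using interior_K interior_subset[of "abs_pspace ` K"] by auto
    ultimately have "?U \<inter> D = {} \<or> - abs_pspace ` K \<inter> D = {}"
      using connectedD[OF D(4) open_Kp] closed_K by (metis open_Compl)
    then have "- abs_pspace ` K \<inter> D = {}" using ne D(2) by auto
    have "p \<in> ?U" if "p \<in> D" for p
    proof (rule ccontr)
      assume "p \<notin> ?U"
      moreover have "p \<in> abs_pspace ` K" using \<open>- abs_pspace ` K \<inter> D = {}\<close> that by auto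
      ultimately have "p \<notin> ?S" using memS by simp
      moreover have "p \<in> ?S" using D(3) that by (rule subsetD)
      ultimately show False by contradiction
    qed
    then show ?thesis by (intro subset_antisym D(2) subsetI)
  qed
  then have "?U \<in> components ?S" unfolding in_components_maximal using ne US conn by (intro conjI allI impI) simp_all
  then show ?thesis unfolding chamber_def by (rule bexI[rotated]) (simp only: closure_Kp)
qed

end

section \<open>The planar fan over the heptagon of special edges\<close>

lemma vec2_eq_iff: "x = y \<longleftrightarrow> x $ 0 = y $ 0 \<and> x $ 1 = y $ 1" for x y :: "'b ^ 2"
proof -
  have e: "(2::2) = 0" by simp
  show ?thesis unfolding vec_eq_iff forall_2 e by auto
qed

lemma vec4_eq_iff: "x = y \<longleftrightarrow> x $ 0 = y $ 0 \<and> x $ 1 = y $ 1 \<and> x $ 2 = y $ 2 \<and> x $ 3 = y $ 3" for x y :: "'b ^ 4"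
proof -
  have e: "(4::4) = 0" by simp
  show ?thesis unfolding vec_eq_iff forall_4 e by auto
qed

context alternating
begin

text \<open>\<open>W w\<close> is the vertex of the heptagon at which exactly \<open>f w\<close>, \<open>f (w+1)\<close>, \<open>f (w+2)\<close> are positive.\<close>

definition W :: "7 \<Rightarrow> real^5" where "W w = V (w + 3)"

lemma fW_zero: "j \<noteq> w \<Longrightarrow> j \<noteq> w + 1 \<Longrightarrow> j \<noteq> w + 2 \<Longrightarrow> f j (W w) = 0"
  unfolding W_def by (rule f_V(1), cases j w rule: cases7) (simp_all add: zV_def)

lemma fW_pos: "0 < f w (W w)" "0 < f (w+1) (W w)" "0 < f (w+2) (W w)"
  unfolding W_def by (rule f_V(2), simp add: zV_def)+

lemma W_in_R: "W w \<in> R" unfolding W_def by (rule V_in_R)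

text \<open>The projection \<open>(p1, p2)\<close> kills the centre \<open>c\<close> and sends \<open>W 0, \<dots>, W 6\<close> to vectors that turn once
  around the origin counterclockwise.\<close>

definition p1 :: "real^5 \<Rightarrow> real" where "p1 x = f 0 x - f 3 x"
definition p2 :: "real^5 \<Rightarrow> real" where "p2 x = f 1 x - f 5 x"
definition lc :: "real^7 \<Rightarrow> real^5" where "lc u = (\<Sum>i\<in>UNIV. u $ i *\<^sub>R W i)"

text \<open>Nonnegative weights on the two ends \<open>W w\<close>, \<open>W (w+1)\<close> of one
  special edge: a sector of the fan.\<close>

definition sec :: "7 \<Rightarrow> real^7 \<Rightarrow> bool" where
  "sec w u \<longleftrightarrow> (\<forall>i. 0 \<le> u $ i) \<and> (\<forall>i. i \<noteq> w \<longrightarrow> i \<noteq> w + 1 \<longrightarrow> u $ i = 0)"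

lemma lc_sec: "sec w u \<Longrightarrow> lc u = u $ w *\<^sub>R W w + u $ (w+1) *\<^sub>R W (w+1)"
  unfolding lc_def sum7_shift[of _ w] by (simp add: sec_def)

lemma sec_zero_iff: "sec w u \<Longrightarrow> u = 0 \<longleftrightarrow> u $ w = 0 \<and> u $ (w+1) = 0"
  unfolding sec_def vec_eq_iff by (metis zero_index)

lemma p_lc:
  assumes "sec w u"
  shows "p1 (lc u) = u $ w * p1 (W w) + u $ (w+1) * p1 (W (w+1))"
    "p2 (lc u) = u $ w * p2 (W w) + u $ (w+1) * p2 (W (w+1))"
  unfolding lc_sec[OF assms] p1_def p2_def by (simp_all add: inner_add_right algebra_simps)

lemma pW:
  "p1 (W 0) = f 0 (W 0)" "p2 (W 0) = f 1 (W 0)"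
  "p1 (W 1) = - f 3 (W 1)" "p2 (W 1) = f 1 (W 1)"
  "p1 (W 2) = - f 3 (W 2)" "p2 (W 2) = 0"
  "p1 (W 3) = - f 3 (W 3)" "p2 (W 3) = - f 5 (W 3)"
  "p1 (W 4) = 0" "p2 (W 4) = - f 5 (W 4)"
  "p1 (W 5) = f 0 (W 5)" "p2 (W 5) = - f 5 (W 5)"
  "p1 (W 6) = f 0 (W 6)" "p2 (W 6) = f 1 (W 6)"
  by (simp_all add: p1_def p2_def fW_zero)

lemma fW_pos_table:
  "0 < f 0 (W 0)" "0 < f 1 (W 0)" "0 < f 3 (W 1)" "0 < f 1 (W 1)" "0 < f 3 (W 2)" "0 < f 3 (W 3)"
  "0 < f 5 (W 3)" "0 < f 5 (W 4)" "0 < f 0 (W 5)" "0 < f 5 (W 5)" "0 < f 0 (W 6)" "0 < f 1 (W 6)"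
  using fW_pos[of 0] fW_pos[of 1] fW_pos[of 2] fW_pos[of 3] fW_pos[of 4] fW_pos[of 5] fW_pos[of 6] by simp_all

text \<open>The one turn of the heptagon that is not visible from the signs alone needs the alternating relation.\<close>

lemma turn60: "f 1 (W 6) * f 0 (W 0) < f 0 (W 6) * f 1 (W 0)"
proof -
  have 1: "l 2 5 * f 0 (W 6) = l 2 4 * f 6 (W 6) + l 2 6 * f 1 (W 6)"
    using alt[of 2 "W 6"] by (simp add: fW_zero)
  have 2: "l 2 5 * f 0 (W 0) = l 2 6 * f 1 (W 0)"
    using alt[of 2 "W 0"] by (simp add: fW_zero)
  have "0 < l 2 4 * f 6 (W 6) * f 1 (W 0)" using l_pos fW_pos[of 6] fW_pos[of 0] by simp
  also have "\<dots> = (l 2 5 * f 0 (W 6) - l 2 6 * f 1 (W 6)) * f 1 (W 0)" using 1 by simp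
  also have "\<dots> = l 2 5 * (f 0 (W 6) * f 1 (W 0)) - f 1 (W 6) * (l 2 6 * f 1 (W 0))" by (simp add: algebra_simps)
  also have "\<dots> = l 2 5 * (f 0 (W 6) * f 1 (W 0) - f 1 (W 6) * f 0 (W 0))" unfolding 2[symmetric] by (simp add: algebra_simps)
  finally show ?thesis using l_pos[of 2 5] by (simp add: zero_less_mult_iff)
qed

text \<open>The cross product of two consecutive projected vertices; positive means
  counterclockwise.\<close>

definition turn :: "7 \<Rightarrow> real" where "turn w = p1 (W w) * p2 (W (w+1)) - p2 (W w) * p1 (W (w+1))"

lemma turn_pos: "0 < turn w"
proof -
  note t = fW_pos_table
  have "\<forall>w. 0 < turn w"
    unfolding all7 turn_def
    using mult_pos_pos[OF t(1) t(4)] mult_pos_pos[OF t(2) t(3)] mult_pos_pos[OF t(4) t(5)]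
      mult_pos_pos[OF t(5) t(7)] mult_pos_pos[OF t(6) t(8)] mult_pos_pos[OF t(8) t(9)]
      mult_pos_pos[OF t(9) t(12)] mult_pos_pos[OF t(10) t(11)] turn60
    by (simp add: pW)
  then show ?thesis by blast
qed

text \<open>The cross product of the projection of \<open>W 6\<close> with \<open>(x, y)\<close>.
  Its sign separates the sectors 5 and 0, which the signs of the coordinates alone do not.\<close>

definition cr6 :: "real \<Rightarrow> real \<Rightarrow> real" where "cr6 x y = f 0 (W 6) * y - f 1 (W 6) * x"

lemma pos_comb:
  fixes s t p q :: real
  assumes "0 < p" "0 < q" "0 \<le> s" "0 \<le> t" "s \<noteq> 0 \<or> t \<noteq> 0"
  shows "0 < s * p + t * q"
proof (cases "s = 0")
  case False
  then have "0 < s * p" "0 \<le> t * q" using assms by simp_all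
  then show ?thesis by linarith
qed (use assms in simp)

text \<open>Crude half-plane bounds for each sector, just strong enough that sectors which are not
  cyclic neighbours have only the origin in common.\<close>

lemma region:
  assumes s: "sec w u" and u: "u \<noteq> 0"
  defines "za \<equiv> p1 (lc u)" and "zb \<equiv> p2 (lc u)"
  shows "w = 0 \<Longrightarrow> 0 < zb \<and> 0 < cr6 za zb" "w = 1 \<Longrightarrow> 0 \<le> zb \<and> za < 0" "w = 2 \<Longrightarrow> zb \<le> 0 \<and> za < 0"
    "w = 3 \<Longrightarrow> za \<le> 0 \<and> zb < 0" "w = 4 \<Longrightarrow> 0 \<le> za \<and> zb < 0" "w = 5 \<Longrightarrow> 0 < za \<and> cr6 za zb \<le> 0"
    "w = 6 \<Longrightarrow> 0 < za \<and> 0 < zb"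
proof -
  define \<alpha> \<beta> where "\<alpha> = u $ w" and "\<beta> = u $ (w+1)"
  have n: "0 \<le> \<alpha>" "0 \<le> \<beta>" "\<alpha> \<noteq> 0 \<or> \<beta> \<noteq> 0"
    using s u sec_zero_iff[OF s] by (auto simp: \<alpha>_def \<beta>_def sec_def)
  have za: "za = \<alpha> * p1 (W w) + \<beta> * p1 (W (w+1))" and zb: "zb = \<alpha> * p2 (W w) + \<beta> * p2 (W (w+1))"
    unfolding za_def zb_def p_lc[OF s] \<alpha>_def \<beta>_def by simp_all
  note t = fW_pos_table
  have pc: "0 < \<alpha> * p + \<beta> * q" if "0 < p" "0 < q" for p q by (rule pos_comb[OF that n])
  have nn: "0 \<le> \<alpha> * p" "0 \<le> \<beta> * p" if "0 < p" for p using that n by simp_all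
  show "0 < zb \<and> 0 < cr6 za zb" if w: "w = 0"
  proof
    show "0 < zb" using pc[OF t(2) t(4)] unfolding zb w by (simp add: pW)
    have "cr6 za zb = \<alpha> * (f 0 (W 6) * f 1 (W 0) - f 1 (W 6) * f 0 (W 0)) + \<beta> * (f 0 (W 6) * f 1 (W 1) + f 1 (W 6) * f 3 (W 1))"
      unfolding cr6_def za zb w by (simp add: pW algebra_simps)
    moreover have "0 < f 0 (W 6) * f 1 (W 1) + f 1 (W 6) * f 3 (W 1)" using t by (simp add: add_pos_pos)
    ultimately show "0 < cr6 za zb" using pc turn60 by simp
  qed
  show "0 \<le> zb \<and> za < 0" if w: "w = 1"
    using pc[OF t(3) t(5)] nn(1)[OF t(4)] unfolding za zb w by (simp add: pW)
  show "zb \<le> 0 \<and> za < 0" if w: "w = 2"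
    using pc[OF t(5) t(6)] nn(2)[OF t(7)] unfolding za zb w by (simp add: pW)
  show "za \<le> 0 \<and> zb < 0" if w: "w = 3"
    using pc[OF t(7) t(8)] nn(1)[OF t(6)] unfolding za zb w by (simp add: pW)
  show "0 \<le> za \<and> zb < 0" if w: "w = 4"
    using pc[OF t(8) t(10)] nn(2)[OF t(9)] unfolding za zb w by (simp add: pW)
  show "0 < za \<and> cr6 za zb \<le> 0" if w: "w = 5"
  proof
    show "0 < za" using pc[OF t(9) t(11)] unfolding za w by (simp add: pW)
    have "cr6 za zb = - \<alpha> * (f 0 (W 6) * f 5 (W 5) + f 1 (W 6) * f 0 (W 5))"
      unfolding cr6_def za zb w by (simp add: pW algebra_simps)
    moreover have "0 < f 0 (W 6) * f 5 (W 5) + f 1 (W 6) * f 0 (W 5)" using t by (simp add: add_pos_pos)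
    ultimately show "cr6 za zb \<le> 0" using nn(1) by simp
  qed
  show "0 < za \<and> 0 < zb" if w: "w = 6"
    using pc[OF t(11) t(1)] pc[OF t(12) t(2)] unfolding za zb w by (simp add: pW)
qed

lemma p_lc_zero:
  assumes "sec w u" "p1 (lc u) = 0" "p2 (lc u) = 0"
  shows "u = 0"
proof (rule ccontr)
  assume "u \<noteq> 0"
  with region[OF assms(1) this] assms(2,3) show False
    by (cases w "0::7" rule: cases7) (simp_all add: cr6_def)
qed

lemma sec_inj_same:
  assumes s: "sec w u" "sec w v" and e: "p1 (lc u) = p1 (lc v)" "p2 (lc u) = p2 (lc v)"
  shows "u = v"
proof -
  have "(u $ w - v $ w) * turn w = 0" "(u $ (w+1) - v $ (w+1)) * turn w = 0"
    using e unfolding p_lc[OF s(1)] p_lc[OF s(2)] turn_def by algebra+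
  then have "u $ w = v $ w" "u $ (w+1) = v $ (w+1)" using turn_pos[of w] by auto
  moreover have "u $ i = v $ i" if "i \<noteq> w" "i \<noteq> w + 1" for i using s that by (simp add: sec_def)
  ultimately show ?thesis unfolding vec_eq_iff by metis
qed

text \<open>The cross product with the projection of the common vertex \<open>W (w+1)\<close>
  removes both of its multiples and leaves a nonnegative combination of two positive turns that
  equals 0.\<close>

lemma sec_inj_next:
  assumes s: "sec w u" "sec (w+1) v" and e: "p1 (lc u) = p1 (lc v)" "p2 (lc u) = p2 (lc v)"
  shows "u = v"
proof -
  define \<alpha> \<beta> \<gamma> \<delta> where "\<alpha> = u $ w" "\<beta> = u $ (w+1)" "\<gamma> = v $ (w+1)" "\<delta> = v $ (w+2)"
  have n: "0 \<le> \<alpha>" "0 \<le> \<delta>" using s by (simp_all add: sec_def \<alpha>_\<beta>_\<gamma>_\<delta>_def)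
  have e': "\<alpha> * p1 (W w) + \<beta> * p1 (W (w+1)) = \<gamma> * p1 (W (w+1)) + \<delta> * p1 (W (w+2))"
    "\<alpha> * p2 (W w) + \<beta> * p2 (W (w+1)) = \<gamma> * p2 (W (w+1)) + \<delta> * p2 (W (w+2))"
    using e unfolding p_lc[OF s(1)] p_lc[OF s(2)] \<alpha>_\<beta>_\<gamma>_\<delta>_def by simp_all
  have "\<alpha> * turn w + \<delta> * turn (w+1) = 0"
    using e' unfolding turn_def by simp algebra
  moreover have "0 \<le> \<alpha> * turn w" "0 \<le> \<delta> * turn (w+1)" using n turn_pos[of w] turn_pos[of "w+1"] by simp_all
  ultimately have "\<alpha> * turn w = 0" "\<delta> * turn (w+1) = 0" by linarith+
  then have "\<alpha> = 0" "\<delta> = 0" using turn_pos[of w] turn_pos[of "w+1"] by auto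
  have "v $ i = 0" if "i \<noteq> w" "i \<noteq> w + 1" for i
    using s(2) that \<open>\<delta> = 0\<close> unfolding sec_def \<alpha>_\<beta>_\<gamma>_\<delta>_def by (cases "i = w + 2") simp_all
  then have "sec w v" using s(2) by (simp add: sec_def)
  then show ?thesis by (rule sec_inj_same[OF s(1) _ e])
qed

definition Fcone :: "(real^7) set" where "Fcone = {u. \<exists>w. sec w u}"

lemma fan_inj:
  assumes u: "u \<in> Fcone" "v \<in> Fcone" and e: "p1 (lc u) = p1 (lc v)" "p2 (lc u) = p2 (lc v)"
  shows "u = v"
proof -
  obtain w where w: "sec w u" using u by (auto simp: Fcone_def)
  obtain w' where w': "sec w' v" using u by (auto simp: Fcone_def)
  show ?thesis
  proof (cases "u = 0 \<or> v = 0")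
    case True
    then have "p1 (lc u) = 0 \<and> p2 (lc u) = 0" using e by (auto simp: lc_def p1_def p2_def)
    then have "u = 0" "v = 0" using p_lc_zero[OF w] p_lc_zero[OF w'] e by simp_all
    then show ?thesis by simp
  next
    case False
    then have nz: "u \<noteq> 0" "v \<noteq> 0" by simp_all
    define za zb where "za = p1 (lc u)" and "zb = p2 (lc u)"
    note r = region[OF w nz(1), folded za_def zb_def] region[OF w' nz(2), folded e, folded za_def zb_def]
    have "w' = w \<or> w' = w + 1 \<or> w = w' + 1"
      by (cases w "0::7" rule: cases7; cases w' "0::7" rule: cases7; insert r; simp)
    then show ?thesis
    proof (elim disjE)
      assume "w' = w"
      with w' have "sec w v" by simp
      then show ?thesis by (rule sec_inj_same[OF w _ e])
    next
      assume "w' = w + 1"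
      with w' have "sec (w + 1) v" by simp
      then show ?thesis by (rule sec_inj_next[OF w _ e])
    next
      assume "w = w' + 1"
      with w have "sec (w' + 1) u" by simp
      then show ?thesis by (rule sec_inj_next[OF w' _ e[symmetric], symmetric])
    qed
  qed
qed

lemma fan_surj: "\<exists>u\<in>Fcone. p1 (lc u) = za \<and> p2 (lc u) = zb"
proof -
  \<comment> \<open>The cross product of the projected \<open>W w\<close> with the target. Where it
    passes from nonnegative to nonpositive, the target lies in the sector \<open>w\<close>.\<close>
  define s where "s w = p1 (W w) * zb - p2 (W w) * za" for w
  have "\<exists>w. 0 \<le> s w \<and> s (w+1) \<le> 0"
  proof (rule ccontr)
    assume "\<not> ?thesis"
    then have step: "0 < s (w+1)" if "0 \<le> s w" for w using that by (meson not_le)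
    note t = fW_pos_table
    have s: "s 0 = f 0 (W 0) * zb - f 1 (W 0) * za" "s 2 = - f 3 (W 2) * zb" "s 4 = f 5 (W 4) * za"
      by (simp_all add: s_def pW)
    \<comment> \<open>Otherwise the sign would propagate around the cycle. But the projections of
      \<open>W 0\<close>, \<open>W 2\<close> and \<open>W 4\<close> surround the origin, so
      \<open>s 0\<close>, \<open>s 2\<close> and \<open>s 4\<close> cannot agree in sign.\<close>
    show False
    proof (cases "0 \<le> s 0")
      case True
      then have "0 < s 1" "0 < s 2" "0 < s 3" "0 < s 4"
        using step[of 0] step[of 1] step[of 2] step[of 3] by simp_all
      then have "zb < 0" "0 < za" using s t by (simp_all add: mult_less_0_iff zero_less_mult_iff)
      then have "f 0 (W 0) * zb < 0" "0 < f 1 (W 0) * za" using t by (simp_all add: mult_less_0_iff)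
      then show False using True s by simp
    next
      case False
      have "s 6 < 0" "s 5 < 0" "s 4 < 0" "s 3 < 0" "s 2 < 0"
      proof -
        show 6: "s 6 < 0" using step[of 6] False by force
        show 5: "s 5 < 0" using step[of 5] 6 by force
        show 4: "s 4 < 0" using step[of 4] 5 by force
        show 3: "s 3 < 0" using step[of 3] 4 by force
        show "s 2 < 0" using step[of 2] 3 by force
      qed
      then have "0 < zb" "za < 0" using s t by (simp_all add: mult_less_0_iff zero_less_mult_iff)
      then have "0 < f 0 (W 0) * zb" "f 1 (W 0) * za < 0" using t by (simp_all add: mult_less_0_iff)
      then show False using False s by simp
    qed
  qed
  then obtain w where w: "0 \<le> s w" "s (w+1) \<le> 0" by blast
  \<comment> \<open>Coordinates by the rule of Cramer; \<open>turn w\<close> is the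
    determinant.\<close>
  define u :: "real^7" where "u = (\<chi> i. if i = w then - s (w+1) / turn w else if i = w + 1 then s w / turn w else 0)"
  have t: "0 < turn w" by (rule turn_pos)
  have "sec w u" unfolding sec_def u_def using w t by (auto simp: divide_nonneg_pos divide_nonpos_pos)
  moreover have "p1 (lc u) * turn w = za * turn w" "p2 (lc u) * turn w = zb * turn w"
  proof -
    have u: "u $ w * turn w = - s (w+1)" "u $ (w+1) * turn w = s w" using t by (simp_all add: u_def)
    show "p1 (lc u) * turn w = za * turn w" "p2 (lc u) * turn w = zb * turn w"
      unfolding p_lc[OF \<open>sec w u\<close>] using u unfolding s_def turn_def by algebra+
  qed
  ultimately show ?thesis using t by (auto simp: Fcone_def)
qed

text \<open>The piecewise linear inverse of the planar projection of the cone over the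
  heptagon.\<close>

definition fan :: "real^2 \<Rightarrow> real^7" where
  "fan z = (THE u. u \<in> Fcone \<and> p1 (lc u) = z $ 0 \<and> p2 (lc u) = z $ 1)"

lemma fan_ex1: "\<exists>!u. u \<in> Fcone \<and> p1 (lc u) = z $ 0 \<and> p2 (lc u) = z $ 1"
proof -
  obtain u where "u \<in> Fcone" "p1 (lc u) = z $ 0" "p2 (lc u) = z $ 1" using fan_surj by blast
  then show ?thesis by (intro ex1I[of _ u] conjI) (auto intro: fan_inj)
qed

definition pl :: "real^7 \<Rightarrow> real^2" where "pl u = (\<chi> i. if i = 0 then p1 (lc u) else p2 (lc u))"

lemma fan: "fan z \<in> Fcone" "pl (fan z) = z"
  using theI'[OF fan_ex1[of z]] unfolding fan_def[symmetric] by (simp_all add: pl_def vec2_eq_iff)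

lemma fan_pl: "u \<in> Fcone \<Longrightarrow> fan (pl u) = u"
  unfolding fan_def by (rule the1_equality[OF fan_ex1]) (simp add: pl_def)

lemma linear_lc: "linear lc"
  unfolding lc_def by (rule linearI) (simp_all add: sum.distrib scaleR_sum_right algebra_simps)

lemma linear_pl: "linear pl"
  by (rule linearI) (simp_all add: pl_def vec2_eq_iff p1_def p2_def linear_add[OF linear_lc] linear_cmul[OF linear_lc] inner_add_right algebra_simps)

lemma Fcone_scale: "u \<in> Fcone \<Longrightarrow> 0 \<le> r \<Longrightarrow> r *\<^sub>R u \<in> Fcone"
  by (auto simp: Fcone_def sec_def)

lemma Fcone_nonneg: "u \<in> Fcone \<Longrightarrow> 0 \<le> u $ i"
  by (auto simp: Fcone_def sec_def)

lemma zero_Fcone: "0 \<in> Fcone"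
  by (simp add: Fcone_def sec_def)

lemma fan_scale: "0 \<le> r \<Longrightarrow> fan (r *\<^sub>R z) = r *\<^sub>R fan z"
  using fan_pl[OF Fcone_scale[OF fan(1)[of z]], of r] by (simp add: linear_cmul[OF linear_pl] fan(2))

lemma pl_eq_0: "u \<in> Fcone \<Longrightarrow> pl u = 0 \<longleftrightarrow> u = 0"
  using fan_pl[of u] fan_pl[OF zero_Fcone] linear_0[OF linear_pl] by metis

lemma closed_Fcone: "closed Fcone"
proof -
  have "Fcone = (\<Union>w. (\<Inter>i. {u. 0 \<le> u $ i}) \<inter> (\<Inter>i\<in>{i. i \<noteq> w \<and> i \<noteq> w + 1}. {u. u $ i = 0}))"
    by (auto simp: Fcone_def sec_def)
  moreover have "closed (\<Union>w::7. (\<Inter>i. {u::real^7. 0 \<le> u $ i}) \<inter> (\<Inter>i\<in>{i. i \<noteq> w \<and> i \<noteq> w + 1}. {u. u $ i = 0}))"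
    by (intro closed_UN finite closed_Int closed_INT ballI closed_Collect_le closed_Collect_eq continuous_intros)
  ultimately show ?thesis by simp
qed

definition tot :: "real^7 \<Rightarrow> real" where "tot u = (\<Sum>i\<in>UNIV. u $ i)"

lemma linear_tot: "linear tot"
  unfolding tot_def by (rule linearI) (simp_all add: sum.distrib sum_distrib_left)

lemma tot_nonneg: "u \<in> Fcone \<Longrightarrow> 0 \<le> tot u"
  unfolding tot_def using Fcone_nonneg by (simp add: sum_nonneg)

lemma norm_le_tot: "u \<in> Fcone \<Longrightarrow> norm u \<le> tot u"
  using norm_le_l1_cart[of u] Fcone_nonneg by (simp add: tot_def)

lemma tot_eq_0: "u \<in> Fcone \<Longrightarrow> tot u = 0 \<longleftrightarrow> u = 0"
  using norm_le_tot[of u] linear_0[OF linear_tot] by auto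

lemma cont_pl: "continuous_on S pl" and cont_tot: "continuous_on S tot" and cont_lc: "continuous_on S lc"
  by (simp_all add: linear_continuous_on linear_conv_bounded_linear[symmetric] linear_pl linear_tot linear_lc)

lemma compact_Fcone_le: "compact {u \<in> Fcone. tot u \<le> r}"
proof -
  have "bounded {u \<in> Fcone. tot u \<le> r}" unfolding bounded_iff using norm_le_tot by (auto intro: order_trans)
  moreover have "{u \<in> Fcone. tot u \<le> r} = Fcone \<inter> {u. tot u \<le> r}" by auto
  moreover have "closed {u. tot u \<le> r}" by (intro closed_Collect_le cont_tot continuous_intros)
  ultimately show ?thesis using closed_Fcone by (simp add: compact_eq_bounded_closed closed_Int)
qed

definition F1 :: "(real^7) set" where "F1 = {u \<in> Fcone. tot u = 1}"

lemma compact_F1: "compact F1"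
proof -
  have e: "F1 = {u \<in> Fcone. tot u \<le> 1} \<inter> {u. tot u = 1}" by (auto simp: F1_def)
  have "closed {u. tot u = 1}" by (intro closed_Collect_eq cont_tot continuous_intros)
  then show ?thesis unfolding e by (rule compact_Int_closed[OF compact_Fcone_le])
qed

text \<open>By homogeneity the minimum of the norm on the compact slice \<open>F1\<close> serves; it
  is positive because only 0 projects to 0.\<close>

lemma pl_bound: "\<exists>m>0. \<forall>u\<in>Fcone. m * tot u \<le> norm (pl u)"
proof -
  have "axis 0 1 \<in> F1"
    by (auto simp: F1_def Fcone_def sec_def axis_def tot_def sum7 intro!: exI[of _ 0])
  then have "F1 \<noteq> {}" by auto
  then obtain u0 where u0: "u0 \<in> F1" "\<And>u. u \<in> F1 \<Longrightarrow> norm (pl u0) \<le> norm (pl u)"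
    using continuous_attains_inf[OF compact_F1 _ continuous_on_norm[OF cont_pl]] by blast
  have "u0 \<noteq> 0" using u0(1) linear_0[OF linear_tot] by (auto simp: F1_def)
  then have "0 < norm (pl u0)" using pl_eq_0 u0(1) by (simp add: F1_def)
  moreover have "norm (pl u0) * tot u \<le> norm (pl u)" if u: "u \<in> Fcone" for u
  proof (cases "u = 0")
    case True
    then show ?thesis by (simp add: linear_0[OF linear_tot])
  next
    case False
    then have t: "0 < tot u" using tot_nonneg[OF u] tot_eq_0[OF u] by simp
    then have "(1 / tot u) *\<^sub>R u \<in> F1"
      using Fcone_scale[OF u, of "1 / tot u"] by (simp add: F1_def linear_cmul[OF linear_tot])
    then have "norm (pl u0) \<le> norm (pl ((1 / tot u) *\<^sub>R u))" by (rule u0(2))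
    also have "\<dots> = norm (pl u) / tot u" using t by (simp add: linear_cmul[OF linear_pl])
    finally show ?thesis using t by (simp add: field_simps)
  qed
  ultimately show ?thesis by blast
qed

text \<open>By \<open>pl_bound\<close> the weights of all points of a ball stay in one compact set,
  and a continuous injection of a compact set has a continuous inverse.\<close>

lemma cont_fan: "continuous_on UNIV fan"
proof -
  obtain m where m: "m > 0" "\<And>u. u \<in> Fcone \<Longrightarrow> m * tot u \<le> norm (pl u)" using pl_bound by blast
  have ball: "continuous_on (ball 0 N) fan" for N
  proof -
    let ?B = "{u \<in> Fcone. tot u \<le> N / m}"
    have inj: "inj_on pl ?B" using fan_pl by (intro inj_onI) (metis (mono_tags, lifting) mem_Collect_eq)
    obtain g where g: "homeomorphism ?B (pl ` ?B) pl g"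
      using homeomorphism_compact[OF compact_Fcone_le cont_pl refl inj] by blast
    have "continuous_on (pl ` ?B) fan"
    proof (rule continuous_on_eq[OF homeomorphism_cont2[OF g]])
      fix z assume "z \<in> pl ` ?B"
      then obtain u where "u \<in> ?B" "z = pl u" by blast
      then show "g z = fan z" using fan_pl homeomorphism_apply1[OF g] by auto
    qed
    moreover have "ball 0 N \<subseteq> pl ` ?B"
    proof
      fix z :: "real^2" assume "z \<in> ball 0 N"
      then have "m * tot (fan z) \<le> N" using m(2)[OF fan(1)[of z]] by (simp add: fan(2))
      then have "fan z \<in> ?B" using m(1) fan(1)[of z] by (simp add: field_simps)
      then show "z \<in> pl ` ?B" using fan(2) by (metis imageI)
    qed
    ultimately show ?thesis by (rule continuous_on_subset)
  qed
  have "isCont fan z" for z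
    using ball[of "norm z + 1"] by (rule continuous_on_interior) simp
  then show ?thesis by (simp add: continuous_at_imp_continuous_on)
qed

end

section \<open>Flattening the heptagon to a round circle in the 3-sphere\<close>

lemma vec2_cont:
  fixes g h :: "'b::topological_space \<Rightarrow> real"
  assumes "continuous_on S g" "continuous_on S h"
  shows "continuous_on S (\<lambda>x. (\<chi> i. if i = 0 then g x else h x) :: real^2)"
proof (rule continuous_on_vec_lambda)
  show "continuous_on S (\<lambda>x. if i = 0 then g x else h x)" for i :: 2
    using assms by (cases "i = 0") simp_all
qed

lemma vec4_cont:
  fixes g h k l :: "'b::topological_space \<Rightarrow> real"
  assumes "continuous_on S g" "continuous_on S h" "continuous_on S k" "continuous_on S l"
  shows "continuous_on S (\<lambda>x. (\<chi> i. if i = 0 then g x else if i = 1 then h x else if i = 2 then k x else l x) :: real^4)"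
proof (rule continuous_on_vec_lambda)
  show "continuous_on S (\<lambda>x. if i = 0 then g x else if i = 1 then h x else if i = 2 then k x else l x)" for i :: 4
    using assms by (cases "i = 0"; cases "i = 1"; cases "i = 2") simp_all
qed

context alternating
begin

text \<open>With \<open>g2\<close> this completes \<open>p1\<close>, \<open>p2\<close> to
  coordinates of the quotient by \<open>c\<close>; all four vanish on \<open>c\<close>.\<close>

definition g1 :: "real^5 \<Rightarrow> real" where "g1 x = f 2 x - f 0 x"
definition g2 :: "real^5 \<Rightarrow> real" where "g2 x = f 4 x - f 0 x"
definition px :: "real^5 \<Rightarrow> real^2" where "px x = (\<chi> i. if i = 0 then p1 x else p2 x)"

lemma pl_px: "pl u = px (lc u)" by (simp add: pl_def px_def)

lemma L_add: "p1 (x + y) = p1 x + p1 y" "p2 (x + y) = p2 x + p2 y" "g1 (x + y) = g1 x + g1 y" "g2 (x + y) = g2 x + g2 y"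
  and L_diff: "p1 (x - y) = p1 x - p1 y" "p2 (x - y) = p2 x - p2 y" "g1 (x - y) = g1 x - g1 y" "g2 (x - y) = g2 x - g2 y"
  and L_scale: "p1 (r *\<^sub>R x) = r * p1 x" "p2 (r *\<^sub>R x) = r * p2 x" "g1 (r *\<^sub>R x) = r * g1 x" "g2 (r *\<^sub>R x) = r * g2 x"
  and L_c: "p1 c = 0" "p2 c = 0" "g1 c = 0" "g2 c = 0"
  by (simp_all add: p1_def p2_def g1_def g2_def inner_add_right inner_diff_right a_c algebra_simps)

lemma px_scale: "px (r *\<^sub>R x) = r *\<^sub>R px x" and px_shift: "px (x + s *\<^sub>R c) = px x"
  by (simp_all add: px_def vec2_eq_iff L_add L_scale L_c)

text \<open>After subtracting a multiple of \<open>c\<close>, the values 0, 2, 3, 4 vanish and the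
  values 1 and 5 agree. In the relation omitting 6 the latter stand on the same side, so they vanish
  too.\<close>

lemma L_kernel:
  assumes "p1 x = 0" "p2 x = 0" "g1 x = 0" "g2 x = 0"
  shows "x = f 0 x *\<^sub>R c"
proof -
  define y where "y = x - f 0 x *\<^sub>R c"
  have fy: "f i y = f i x - f 0 x" for i by (simp add: y_def inner_diff_right a_c)
  have z: "f 0 y = 0" "f 3 y = 0" "f 2 y = 0" "f 4 y = 0" "f 5 y = f 1 y"
    using assms by (simp_all add: fy p1_def p2_def g1_def g2_def)
  have "l 6 2 * f 1 y + l 6 6 * f 1 y = 0" using alt[of 6 y] z by simp
  then have "(l 6 2 + l 6 6) * f 1 y = 0" by (simp add: distrib_right)
  then have "f 1 y = 0" using l_pos[of 6 2] l_pos[of 6 6] by simp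
  have "y = 0"
  proof (rule f_zero5[of 6 6])
    fix i :: 7 assume "i \<noteq> 6"
    then show "f i y = 0" using z \<open>f 1 y = 0\<close> by (cases i "0::7" rule: cases7) simp_all
  qed
  then show ?thesis by (simp add: y_def)
qed

text \<open>The shear: the last two coordinates are measured from the point of the cone over the heptagon that
  has the same first two coordinates.\<close>

definition Sf :: "real^5 \<Rightarrow> real^4" where
  "Sf x = (\<chi> i. if i = 0 then p1 x else if i = 1 then p2 x
    else if i = 2 then g1 x - g1 (lc (fan (px x))) else g2 x - g2 (lc (fan (px x))))"

lemma Sf_nth: "Sf x $ 0 = p1 x" "Sf x $ 1 = p2 x" "Sf x $ 2 = g1 x - g1 (lc (fan (px x)))"
  "Sf x $ 3 = g2 x - g2 (lc (fan (px x)))"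
  by (simp_all add: Sf_def)

lemma cont_L: "continuous_on S p1" "continuous_on S p2" "continuous_on S g1" "continuous_on S g2"
  unfolding p1_def p2_def g1_def g2_def by (intro continuous_intros)+

lemma cont_px: "continuous_on S px"
  unfolding px_def by (intro vec2_cont cont_L)

lemma cont_lc_fan: "continuous_on S (\<lambda>x. lc (fan (px x)))"
  by (intro continuous_on_compose2[OF cont_lc[of UNIV]] continuous_on_compose2[OF cont_fan] cont_px) auto

lemma cont_Sf: "continuous_on S Sf"
proof -
  have "continuous_on S (\<lambda>x. g1 (lc (fan (px x))))" "continuous_on S (\<lambda>x. g2 (lc (fan (px x))))"
    by (rule continuous_on_compose2[OF cont_L(3)[of UNIV] cont_lc_fan], simp,
        rule continuous_on_compose2[OF cont_L(4)[of UNIV] cont_lc_fan], simp)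
  then show ?thesis
    unfolding Sf_def by (intro vec4_cont cont_L continuous_on_diff)
qed

lemma Sf_scale: "0 \<le> r \<Longrightarrow> Sf (r *\<^sub>R x) = r *\<^sub>R Sf x"
  by (simp add: vec4_eq_iff Sf_nth L_scale px_scale fan_scale linear_cmul[OF linear_lc] algebra_simps)

lemma Sf_shift: "Sf (x + s *\<^sub>R c) = Sf x"
  by (simp add: vec4_eq_iff Sf_nth L_scale L_add L_c px_shift)

lemma Sf_eq:
  assumes "Sf x = Sf y"
  shows "\<exists>s. x = y + s *\<^sub>R c"
proof -
  have p: "p1 x = p1 y" "p2 x = p2 y" using assms Sf_nth(1,2) by metis+
  then have "px x = px y" unfolding vec2_eq_iff px_def by simp
  then have "g1 x = g1 y" "g2 x = g2 y" using assms Sf_nth(3,4)[of x] Sf_nth(3,4)[of y] by simp_all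
  with p have "x - y = f 0 (x - y) *\<^sub>R c" by (intro L_kernel) (simp_all add: L_diff)
  then show ?thesis by (intro exI[of _ "f 0 (x - y)"]) (simp add: algebra_simps)
qed

lemma L_surj: "\<exists>x. p1 x = v0 \<and> p2 x = v1 \<and> g1 x = v2 \<and> g2 x = v3"
proof -
  \<comment> \<open>The fifth coordinate \<open>hv\<close> is 1 on \<open>c\<close>, which spans the
    common kernel of the other four, so the square system is injective and hence surjective.\<close>
  define T :: "real^5 \<Rightarrow> real^5" where
    "T x = (\<chi> i. if i = 0 then p1 x else if i = 1 then p2 x else if i = 2 then g1 x else if i = 3 then g2 x else hv \<bullet> x)" for x
  have T: "T x $ 0 = p1 x" "T x $ 1 = p2 x" "T x $ 2 = g1 x" "T x $ 3 = g2 x" "T x $ 4 = hv \<bullet> x" for x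
    by (simp_all add: T_def)
  have lin: "linear T" by (rule linearI) (simp_all add: T_def vec_eq_iff L_add L_scale inner_add_right)
  have "inj T"
    unfolding linear_injective_0[OF lin]
  proof (intro allI impI)
    fix x assume "T x = 0"
    then have "p1 x = 0" "p2 x = 0" "g1 x = 0" "g2 x = 0" "hv \<bullet> x = 0" using T[of x] by simp_all
    then have "x = f 0 x *\<^sub>R c" "hv \<bullet> x = 0" using L_kernel by blast+
    then have "f 0 x = 0" using hv_c by (metis inner_scaleR_right mult.right_neutral)
    with \<open>x = f 0 x *\<^sub>R c\<close> show "x = 0" by simp
  qed
  then have "surj T" using linear_injective_imp_surjective[OF lin] by simp
  then obtain x where x: "(\<chi> i. if i = 0 then v0 else if i = 1 then v1 else if i = 2 then v2 else if i = 3 then v3 else 0) = T x"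
    by (rule surjE)
  show ?thesis unfolding T(1-4)[symmetric] x[symmetric] by (intro exI[of _ x]) (simp add: x[symmetric])
qed

lemma Sf_surj: "\<exists>x. Sf x = v"
proof -
  define q where "q = lc (fan (\<chi> i. if i = 0 then v $ 0 else v $ 1))"
  obtain x where x: "p1 x = v $ 0" "p2 x = v $ 1" "g1 x = v $ 2 + g1 q" "g2 x = v $ 3 + g2 q"
    using L_surj by blast
  then have "px x = (\<chi> i. if i = 0 then v $ 0 else v $ 1)" unfolding vec2_eq_iff px_def by simp
  then have "Sf x = v" using x by (simp add: vec4_eq_iff Sf_nth q_def)
  then show ?thesis by blast
qed

lemma BR_FC: "BR = (\<Union>i. FC {i})"
  by (auto simp: BR_def FC_iff)

lemma compact_BR: "compact BR"
  unfolding BR_FC by (intro compact_UN finite compact_FC)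

text \<open>A functional vanishing at \<open>y\<close> gives \<open>0 \<le> s\<close>, one vanishing
  at \<open>x\<close> gives \<open>s \<le> 0\<close>, and the height \<open>hv\<close> then gives
  \<open>r = 1\<close>. So a ray modulo \<open>c\<close> meets the boundary at most once.\<close>

lemma BR_ray:
  assumes x: "x \<in> BR" and y: "y \<in> BR" and e: "x = r *\<^sub>R y + s *\<^sub>R c" and r: "0 \<le> r"
  shows "x = y"
proof -
  have xR: "x \<in> R" and yR: "y \<in> R" using x y by (simp_all add: BR_def)
  obtain i j where i: "f i x = 0" and j: "f j y = 0" using x y by (auto simp: BR_def Z_def)
  have fx: "f k x = r * f k y + s" for k unfolding e by (simp add: inner_add_right a_c)
  have "0 \<le> s" using fx[of j] j R_nonneg[OF xR, of j] by simp
  moreover have "s \<le> 0" using fx[of i] i r R_nonneg[OF yR, of i] by (simp add: add_nonneg_eq_0_iff not_le)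
     (metis add_nonneg_eq_0_iff mult_nonneg_nonneg calculation order_refl)
  ultimately have "s = 0" by simp
  moreover have "1 = r + s" using R_hv[OF xR] R_hv[OF yR] hv_c unfolding e by (simp add: inner_add_right)
  ultimately show ?thesis using e by simp
qed

lemma ray_exit:
  assumes "hv \<bullet> d = 0" "d \<noteq> 0"
  shows "\<exists>t>0. c + t *\<^sub>R d \<in> BR"
proof -
  have s: "(\<Sum>i\<in>UNIV. f i d) = 0" using assms(1) by (simp add: hv)
  have "\<exists>i. f i d < 0"
  proof (rule ccontr)
    assume "\<not> ?thesis"
    then have ge: "0 \<le> f i d" for i by (simp add: not_less)
    then have "f i d = 0" for i using s by (subst (asm) sum_nonneg_eq_0_iff) auto
    then show False using a_inj assms(2) by blast
  qed
  \<comment> \<open>On \<open>c + t *\<^sub>R d\<close> a functional negative at \<open>d\<close>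
    reaches 0 at \<open>t = - 1 / f i d\<close>, so the first exit is at
    \<open>t = 1 / \<mu>\<close>.\<close>
  define \<mu> where "\<mu> = Max (range (\<lambda>i. - f i d))"
  have mu: "- f i d \<le> \<mu>" for i unfolding \<mu>_def by (rule Max_ge) auto
  have mu0: "0 < \<mu>" using \<open>\<exists>i. f i d < 0\<close> mu by (metis less_le_trans neg_0_less_iff_less)
  have "\<mu> \<in> range (\<lambda>i. - f i d)" unfolding \<mu>_def by (rule Max_in) auto
  then obtain j where j: "\<mu> = - f j d" by auto
  let ?x = "c + (1/\<mu>) *\<^sub>R d"
  have fx: "f i ?x = (\<mu> + f i d) / \<mu>" for i using mu0 by (simp add: inner_add_right a_c add_divide_distrib)
  have "?x \<in> R" unfolding R_def using fx mu mu0 assms(1) hv_c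
    by (auto simp: inner_add_right intro!: divide_nonneg_pos) (smt (verit))
  moreover have "j \<in> Z ?x" using fx[of j] j by (simp add: Z_def)
  ultimately have "?x \<in> BR" by (auto simp: BR_def)
  then show ?thesis using mu0 by (intro exI[of _ "1/\<mu>"]) simp
qed

text \<open>Rays of the quotient by \<open>c\<close> are identified with points of the unit sphere,
  after the shear.\<close>

definition Hm :: "real^5 \<Rightarrow> real^4" where "Hm x = (1 / norm (Sf x)) *\<^sub>R Sf x"

lemma Sf_nz:
  assumes "x \<in> BR"
  shows "Sf x \<noteq> 0"
proof
  assume "Sf x = 0"
  then have "Sf x = Sf 0" using Sf_scale[of 0 x] by simp
  then obtain s where s: "x = s *\<^sub>R c" using Sf_eq[of x 0] by auto
  have "x \<in> R" using assms by (simp add: BR_def)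
  then have "s = 1" using s hv_c R_hv by force
  then have "f i x = 1" for i using s by (simp add: a_c)
  then show False using assms by (auto simp: BR_def Z_def)
qed

lemma Hm_inj: "inj_on Hm BR"
proof (rule inj_onI)
  fix x y assume xy: "x \<in> BR" "y \<in> BR" "Hm x = Hm y"
  define r where "r = norm (Sf x) / norm (Sf y)"
  have "norm (Sf x) *\<^sub>R Hm x = norm (Sf x) *\<^sub>R Hm y" using xy(3) by simp
  then have "Sf x = r *\<^sub>R Sf y" using Sf_nz[OF xy(1)] by (simp add: Hm_def r_def)
  moreover have "0 \<le> r" by (simp add: r_def)
  ultimately have "Sf x = Sf (r *\<^sub>R y)" by (simp add: Sf_scale)
  then obtain s where "x = r *\<^sub>R y + s *\<^sub>R c" using Sf_eq by blast
  then show "x = y" using BR_ray[OF xy(1,2)] \<open>0 \<le> r\<close> by blast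
qed

lemma Hm_image: "Hm ` BR = sphere 0 1"
proof
  show "Hm ` BR \<subseteq> sphere 0 1" using Sf_nz by (auto simp: Hm_def)
  show "sphere 0 1 \<subseteq> Hm ` BR"
  proof
    fix v :: "real^4" assume v: "v \<in> sphere 0 1"
    obtain y where y: "Sf y = v" using Sf_surj by blast
    \<comment> \<open>The representative modulo \<open>c\<close> of height 0, so that the line from
      \<open>c\<close> in this direction stays in the chart.\<close>
    define d where "d = y + (- (hv \<bullet> y)) *\<^sub>R c"
    have d: "Sf d = v" "hv \<bullet> d = 0"
      unfolding d_def Sf_shift using y by (simp_all add: inner_diff_right hv_c)
    have "Sf 0 = 0" using Sf_scale[of 0 0] by simp
    then have "d \<noteq> 0" using d(1) v by auto
    then obtain t where t: "t > 0" "c + t *\<^sub>R d \<in> BR" using ray_exit[OF d(2)] by blast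
    have "Sf (c + t *\<^sub>R d) = Sf (t *\<^sub>R d + 1 *\<^sub>R c)" by (simp add: add.commute)
    also have "\<dots> = t *\<^sub>R v" unfolding Sf_shift using t(1) d(1) Sf_scale by simp
    finally have "Hm (c + t *\<^sub>R d) = v" using t(1) v by (simp add: Hm_def)
    then show "v \<in> Hm ` BR" using t(2) by blast
  qed
qed

lemma Hm_homeo: "\<exists>h'. homeomorphism BR (sphere 0 1) Hm h'"
proof -
  have "continuous_on BR Hm" unfolding Hm_def by (intro continuous_intros cont_Sf) (use Sf_nz in auto)
  from homeomorphism_compact[OF compact_BR this Hm_image Hm_inj] show ?thesis by blast
qed

lemma lc_in_Cset:
  assumes "u \<in> F1"
  shows "lc u \<in> Cset"
proof -
  obtain w where s: "sec w u" using assms by (auto simp: F1_def Fcone_def)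
  have t: "u $ w + u $ (w+1) = 1"
    using assms s unfolding F1_def tot_def sum7_shift[of _ w] by (simp add: sec_def)
  have "lc u \<in> R" unfolding lc_sec[OF s] using convex_R W_in_R s t by (auto simp: convex_def sec_def)
  moreover have "{w+4, w+4+1, w+4+2} \<subseteq> Z (lc u)"
    unfolding lc_sec[OF s] Z_def by (simp add: inner_add_right fW_zero)
  ultimately show ?thesis unfolding Cset_def by blast
qed

lemma Cset_lc: "Cset = lc ` F1"
proof
  show "lc ` F1 \<subseteq> Cset" using lc_in_Cset by blast
  show "Cset \<subseteq> lc ` F1"
  proof
    fix x assume "x \<in> Cset"
    then obtain k where k: "x \<in> R" "{k, k+1, k+2} \<subseteq> Z x" by (auto simp: Cset_def)
    then have "x \<in> FC {k, k+1, k+2}" by (simp add: FC_iff)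
    moreover have e1: "{V j |j. {k, k+1, k+2} \<subseteq> zV j} = {W (k+3), W (k+3+1)}"
    proof -
      have "j \<in> {j. {k, k+1, k+2} \<subseteq> zV j} \<longleftrightarrow> j \<in> {k+6, k}" for j
        by (cases j k rule: cases7; simp add: zV_def)
      then have e: "{j. {k, k+1, k+2} \<subseteq> zV j} = {k+6, k}" by blast
      have "{V j |j. {k, k+1, k+2} \<subseteq> zV j} = V ` {j. {k, k+1, k+2} \<subseteq> zV j}" by auto
      then show ?thesis unfolding e by (simp add: W_def)
    qed
    moreover have e2: "{U j |j. {k, k+1, k+2} \<subseteq> zU j} = {}"
    proof -
      have "\<not> {k, k+1, k+2} \<subseteq> zU j" for j
        by (cases j k rule: cases7; simp add: zU_def)
      then show ?thesis by simp
    qed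
    ultimately have "x \<in> convex hull {W (k+3), W (k+3+1)}" unfolding FC_hull e1 e2 by simp
    then obtain p q where pq: "0 \<le> p" "0 \<le> q" "p + q = 1" "x = p *\<^sub>R W (k+3) + q *\<^sub>R W (k+3+1)"
      unfolding convex_hull_2 by blast
    define u :: "real^7" where "u = (\<chi> i. if i = k+3 then p else if i = k+3+1 then q else 0)"
    have s: "sec (k+3) u" using pq by (auto simp: sec_def u_def)
    have "tot u = 1" unfolding tot_def sum7_shift[of _ "k+3"] using pq by (simp add: u_def)
    then have "u \<in> F1" using s by (auto simp: F1_def Fcone_def)
    moreover have "lc u = x" unfolding lc_sec[OF s] pq(4) by (simp add: u_def)
    ultimately show "x \<in> lc ` F1" by blast
  qed
qed

lemma Cset_BR: "Cset \<subseteq> BR" by (auto simp: Cset_def BR_def)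

lemma Sf_lc: "u \<in> Fcone \<Longrightarrow> Sf (lc u) $ 2 = 0 \<and> Sf (lc u) $ 3 = 0"
  by (simp add: Sf_nth pl_px[symmetric] fan_pl)

text \<open>The last two coordinates of \<open>Sf x\<close> vanish exactly when \<open>x\<close>
  agrees modulo \<open>c\<close> with the point of the cone over the heptagon that has the same
  projection. Scaling that point to total weight 1 puts it on the curve without changing its
  ray.\<close>

lemma Hm_Cset: "Hm ` Cset = {x \<in> sphere 0 1. x $ 2 = 0 \<and> x $ 3 = 0}"
proof
  show "Hm ` Cset \<subseteq> {x \<in> sphere 0 1. x $ 2 = 0 \<and> x $ 3 = 0}"
  proof
    fix v assume "v \<in> Hm ` Cset"
    then obtain u where u: "u \<in> F1" "v = Hm (lc u)" unfolding Cset_lc by blast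
    then have "v $ 2 = 0 \<and> v $ 3 = 0" using Sf_lc[of u] by (simp add: Hm_def F1_def)
    moreover have "v \<in> sphere 0 1" using u Hm_image lc_in_Cset Cset_BR by blast
    ultimately show "v \<in> {x \<in> sphere 0 1. x $ 2 = 0 \<and> x $ 3 = 0}" by simp
  qed
  show "{x \<in> sphere 0 1. x $ 2 = 0 \<and> x $ 3 = 0} \<subseteq> Hm ` Cset"
  proof
    fix v :: "real^4" assume v: "v \<in> {x \<in> sphere 0 1. x $ 2 = 0 \<and> x $ 3 = 0}"
    then obtain x where x: "x \<in> BR" "v = Hm x" using Hm_image by (metis (mono_tags, lifting) imageE mem_Collect_eq)
    have n: "norm (Sf x) \<noteq> 0" using Sf_nz[OF x(1)] by simp
    have z: "Sf x $ 2 = 0" "Sf x $ 3 = 0" using v x n by (simp_all add: Hm_def)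
    define u where "u = fan (px x)"
    have u: "u \<in> Fcone" "px (lc u) = px x" using fan[of "px x"] by (simp_all add: u_def pl_px)
    have "p1 (lc u) = p1 x" "p2 (lc u) = p2 x" using u(2) by (simp_all add: px_def vec2_eq_iff)
    then have e: "Sf (lc u) = Sf x" using Sf_lc[OF u(1)] z by (simp add: vec4_eq_iff Sf_nth)
    have "u \<noteq> 0" using e Sf_nz[OF x(1)] Sf_scale[of 0 0] linear_0[OF linear_lc] by auto
    then have t: "0 < tot u" using tot_nonneg[OF u(1)] tot_eq_0[OF u(1)] by simp
    have "(1 / tot u) *\<^sub>R u \<in> F1"
      using Fcone_scale[OF u(1), of "1 / tot u"] t by (simp add: F1_def linear_cmul[OF linear_tot])
    then have C: "lc ((1 / tot u) *\<^sub>R u) \<in> Cset" by (rule lc_in_Cset)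
    have "Sf (lc ((1 / tot u) *\<^sub>R u)) = (1 / tot u) *\<^sub>R Sf x"
      using t by (simp add: linear_cmul[OF linear_lc] Sf_scale e)
    then have "Hm (lc ((1 / tot u) *\<^sub>R u)) = v" using t by (simp add: Hm_def x(2))
    then show "v \<in> Hm ` Cset" using C by blast
  qed
qed

lemma chart_homeo: "X \<subseteq> R \<Longrightarrow> homeomorphism (abs_pspace ` X) X (chart hv) abs_pspace"
  by (rule homeomorphism_symD, rule homeomorphism_chart) (auto simp: R_def)

lemma unknotted_C: "unknotted_circle_in (abs_pspace ` Cset) (abs_pspace ` BR)"
proof -
  obtain h' where h': "homeomorphism BR (sphere 0 1) Hm h'" using Hm_homeo by blast
  have BRR: "BR \<subseteq> R" by (auto simp: BR_def)
  have h: "homeomorphism (abs_pspace ` BR) (sphere 0 1) (Hm \<circ> chart hv) (abs_pspace \<circ> h')"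
    by (rule homeomorphism_compose[OF chart_homeo[OF BRR] h'])
  have "chart hv (abs_pspace x) = x" if "x \<in> Cset" for x
    using homeomorphism_apply2[OF chart_homeo[OF BRR]] that Cset_BR by blast
  then have "(Hm \<circ> chart hv) ` abs_pspace ` Cset = Hm ` Cset" by (force simp: image_image)
  then show ?thesis unfolding unknotted_circle_in_def
    by (intro exI[of _ "Hm \<circ> chart hv"] exI[of _ "abs_pspace \<circ> h'"] conjI h image_mono Cset_BR)
       (simp only: Hm_Cset)
qed

end

lemma unknotted_imp_three_sphere: "unknotted_circle_in C S \<Longrightarrow> three_sphere S"
  unfolding unknotted_circle_in_def three_sphere_def homeomorphic_def by blast

lemma unknotted_imp_circle:
  assumes "unknotted_circle_in C S"
  shows "circle C"
proof -
  obtain h h' where h: "homeomorphism S (sphere 0 1 :: (real^4) set) h h'"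
    and C: "h ` C = {x \<in> sphere 0 1. x $ 2 = 0 \<and> x $ 3 = 0}" "C \<subseteq> S"
    using assms unfolding unknotted_circle_in_def by blast
  have "homeomorphism C (h ` C) h h'"
    by (rule homeomorphism_of_subsets[OF h]) (use C in \<open>auto simp: homeomorphism_image1[OF h]\<close>)
  then have 1: "C homeomorphic (h ` C)" unfolding homeomorphic_def by blast
  define i :: "real^4 \<Rightarrow> real^2" where "i x = (\<chi> k. if k = 0 then x $ 0 else x $ 1)" for x
  \<comment> \<open>The redundant last branch has the shape that \<open>vec4_cont\<close>
    expects.\<close>
  define j :: "real^2 \<Rightarrow> real^4" where
    "j x = (\<chi> k. if k = 0 then x $ 0 else if k = 1 then x $ 1 else if k = 2 then 0 else 0)" for x
  have n4: "norm x = sqrt ((x $ 0)\<^sup>2 + (x $ 1)\<^sup>2 + (x $ 2)\<^sup>2 + (x $ 3)\<^sup>2)" for x :: "real^4"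
  proof -
    have e: "(4::4) = 0" by simp
    show ?thesis unfolding norm_vec_def L2_set_def sum_4 e by (simp add: ac_simps)
  qed
  have n2: "norm x = sqrt ((x $ 0)\<^sup>2 + (x $ 1)\<^sup>2)" for x :: "real^2"
  proof -
    have e: "(2::2) = 0" by simp
    show ?thesis unfolding norm_vec_def L2_set_def sum_2 e by (simp add: ac_simps)
  qed
  have "homeomorphism (h ` C) (sphere 0 1) i j"
  proof (rule homeomorphismI)
    show "continuous_on (h ` C) i" unfolding i_def by (intro vec2_cont continuous_intros)
    show "continuous_on (sphere 0 1) j" unfolding j_def by (intro vec4_cont continuous_intros)
  qed (auto simp: C i_def j_def n4 n2 vec4_eq_iff vec2_eq_iff)
  then have "(h ` C) homeomorphic (sphere 0 1 :: (real^2) set)" unfolding homeomorphic_def by blast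
  with 1 show ?thesis unfolding circle_def by (rule homeomorphic_trans)
qed

text \<open>The face of \<open>J\<close> is a simplex: each of its vertices is separated from the others by one functional.\<close>

definition simplicial :: "7 set \<Rightarrow> bool" where
  "simplicial J \<longleftrightarrow> (\<forall>X\<in>vs J. \<exists>i. i \<notin> X \<and> (\<forall>Y\<in>vs J. Y \<noteq> X \<longrightarrow> i \<in> Y))"

lemma simplicial2: "simplicial {j, j+2}"
proof -
  have "j+6 \<notin> zV j" "j+6 \<in> zV (j+6)" "j+6 \<in> zU (j+6)" "j+3 \<notin> zV (j+6)" "j+3 \<in> zV j" "j+3 \<in> zU (j+6)"
    "j+1 \<notin> zU (j+6)" "j+1 \<in> zV j" "j+1 \<in> zV (j+6)"
    by (simp_all add: zV_def zU_def)
  then show ?thesis unfolding simplicial_def vs_pair2 by auto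
qed

text \<open>The edge shared by the quadrilaterals of \<open>{j+1, j+4}\<close> and
  \<open>{j+4, j}\<close>; it occurs where neighbouring quadrilaterals of the strip meet.\<close>

lemma simplicial3: "simplicial {j, j+1, j+4}"
proof -
  have "vs {j, j+1, j+4} = {X \<in> vs {j, j+1}. j+4 \<in> X}" by (auto simp: vs_def)
  also have "\<dots> = {zU j, zU (j+4)}" unfolding vs_pair1 by (auto simp: zV_def zU_def)
  finally have e: "vs {j, j+1, j+4} = {zU j, zU (j+4)}" .
  have "j+5 \<notin> zU j" "j+5 \<in> zU (j+4)" "j+3 \<notin> zU (j+4)" "j+3 \<in> zU j"
    by (simp_all add: zU_def)
  then show ?thesis unfolding simplicial_def e by auto
qed

lemma Collect7: "{k::7. Q k} = (if Q 0 then {0} else {}) \<union> (if Q 1 then {1} else {}) \<union> (if Q 2 then {2} else {}) \<union>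
  (if Q 3 then {3} else {}) \<union> (if Q 4 then {4} else {}) \<union> (if Q 5 then {5} else {}) \<union> (if Q 6 then {6} else {})"
proof -
  have "{k. Q k} = {k \<in> UNIV. Q k}" by simp
  then show ?thesis unfolding UNIV_7 Collect_mem_insert by (simp add: Un_assoc)
qed

lemma zV_table: "zV 0 = {0, 1, 2, 3}" "zV 1 = {1, 2, 3, 4}" "zV 2 = {2, 3, 4, 5}" "zV 3 = {3, 4, 5, 6}" "zV 4 = {4, 5, 6, 0}" "zV 5 = {5, 6, 0, 1}" "zV 6 = {6, 0, 1, 2}"
  and zU_table: "zU 0 = {0, 1, 3, 4}" "zU 1 = {1, 2, 4, 5}" "zU 2 = {2, 3, 5, 6}" "zU 3 = {3, 4, 6, 0}" "zU 4 = {4, 5, 0, 1}" "zU 5 = {5, 6, 1, 2}" "zU 6 = {6, 0, 2, 3}"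
  by (simp_all add: zV_def zU_def)

context alternating
begin

definition comb :: "real^7 \<Rightarrow> real^7 \<Rightarrow> real^5" where
  "comb A B = (\<Sum>i\<in>UNIV. A $ i *\<^sub>R V i) + (\<Sum>i\<in>UNIV. B $ i *\<^sub>R U i)"

lemma f_comb: "f j (comb A B) = (\<Sum>i\<in>UNIV. A $ i * f j (V i)) + (\<Sum>i\<in>UNIV. B $ i * f j (U i))"
  by (simp add: comb_def inner_add_right inner_sum_right)

lemma fV_nonneg: "0 \<le> f j (V i)" and fU_nonneg: "0 \<le> f j (U i)"
  using R_nonneg V_in_R U_in_R by blast+

lemma fV0: "f j (V i) = 0 \<longleftrightarrow> j \<in> zV i" and fU0: "f j (U i) = 0 \<longleftrightarrow> j \<in> zU i"
  using Z_V[of i] Z_U[of i] by (auto simp: Z_def)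

definition nonneg :: "real^7 \<Rightarrow> bool" where "nonneg A \<longleftrightarrow> (\<forall>i. 0 \<le> A $ i)"

lemma f_comb_nonneg: "nonneg A \<Longrightarrow> nonneg B \<Longrightarrow> 0 \<le> f j (comb A B)"
  unfolding f_comb nonneg_def by (intro add_nonneg_nonneg sum_nonneg mult_nonneg_nonneg fV_nonneg fU_nonneg) auto

text \<open>Nothing cancels between nonnegative terms, so the zero set of a combination is read off
  the vertices of its support.\<close>

lemma f_comb_zero:
  assumes "nonneg A" "nonneg B"
  shows "f j (comb A B) = 0 \<longleftrightarrow> (\<forall>i. A $ i = 0 \<or> j \<in> zV i) \<and> (\<forall>i. B $ i = 0 \<or> j \<in> zU i)"
proof -
  have n: "0 \<le> A $ i * f j (V i)" "0 \<le> B $ i * f j (U i)" for i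
    using assms fV_nonneg fU_nonneg by (simp_all add: nonneg_def)
  then have "f j (comb A B) = 0 \<longleftrightarrow> (\<Sum>i\<in>UNIV. A $ i * f j (V i)) = 0 \<and> (\<Sum>i\<in>UNIV. B $ i * f j (U i)) = 0"
    unfolding f_comb by (intro add_nonneg_eq_0_iff sum_nonneg) auto
  also have "\<dots> \<longleftrightarrow> (\<forall>i. A $ i * f j (V i) = 0) \<and> (\<forall>i. B $ i * f j (U i) = 0)"
    using n by (simp add: sum_nonneg_eq_0_iff)
  finally show ?thesis by (simp add: fV0 fU0)
qed

lemma sum_single: "(\<And>j. j \<noteq> k \<Longrightarrow> g j = 0) \<Longrightarrow> (\<Sum>j\<in>UNIV. g j) = g k" for g :: "7 \<Rightarrow> real"
  using sum.mono_neutral_right[of UNIV "{k}" g] by auto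

text \<open>Both combinations are supported on the vertices of the face of \<open>J\<close>, and the
  functional that singles out one vertex reads its weight off the point.\<close>

lemma comb_unique:
  assumes n: "nonneg A" "nonneg B" "nonneg A'" "nonneg B'" and e: "comb A B = comb A' B'"
    and J: "J \<subseteq> Z (comb A B)" "simplicial J"
  shows "A = A' \<and> B = B'"
proof -
  have sup: "A $ i = 0 \<or> J \<subseteq> zV i" "B $ i = 0 \<or> J \<subseteq> zU i" 
    if "nonneg A" "nonneg B" "J \<subseteq> Z (comb A B)" for A B i
    using that f_comb_zero[OF that(1,2)] unfolding Z_def by blast+
  have pick: "f i (comb A B) = A $ k * f i (V k)"
    if AB: "nonneg A" "nonneg B" "J \<subseteq> Z (comb A B)" and i: "\<And>Y. Y \<in> vs J \<Longrightarrow> Y \<noteq> zV k \<Longrightarrow> i \<in> Y" for A B i k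
  proof -
    have "A $ j * f i (V j) = 0" if "j \<noteq> k" for j
      using sup(1)[OF AB, of j] i[of "zV j"] that by (auto simp: vs_def fV0)
    moreover have "B $ j * f i (U j) = 0" for j
      using sup(2)[OF AB, of j] i[of "zU j"] by (auto simp: vs_def fU0)
    then have "(\<Sum>j\<in>UNIV. B $ j * f i (U j)) = 0" by (rule sum.neutral[OF ballI])
    ultimately show ?thesis unfolding f_comb using sum_single[of k "\<lambda>j. A $ j * f i (V j)"] by simp
  qed
  have pick': "f i (comb A B) = B $ k * f i (U k)"
    if AB: "nonneg A" "nonneg B" "J \<subseteq> Z (comb A B)" and i: "\<And>Y. Y \<in> vs J \<Longrightarrow> Y \<noteq> zU k \<Longrightarrow> i \<in> Y" for A B i k
  proof -
    have "B $ j * f i (U j) = 0" if "j \<noteq> k" for j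
      using sup(2)[OF AB, of j] i[of "zU j"] that by (auto simp: vs_def fU0)
    moreover have "A $ j * f i (V j) = 0" for j
      using sup(1)[OF AB, of j] i[of "zV j"] by (auto simp: vs_def fV0)
    then have "(\<Sum>j\<in>UNIV. A $ j * f i (V j)) = 0" by (rule sum.neutral[OF ballI])
    ultimately show ?thesis unfolding f_comb using sum_single[of k "\<lambda>j. B $ j * f i (U j)"] by simp
  qed
  have J': "J \<subseteq> Z (comb A' B')" using J(1) e by simp
  have "A $ k = A' $ k" for k
  proof (cases "J \<subseteq> zV k")
    case True
    then have "zV k \<in> vs J" by (auto simp: vs_def)
    then obtain i where i: "i \<notin> zV k" "\<And>Y. Y \<in> vs J \<Longrightarrow> Y \<noteq> zV k \<Longrightarrow> i \<in> Y"
      using J(2) unfolding simplicial_def by auto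
    have "A $ k * f i (V k) = A' $ k * f i (V k)"
      using pick[OF n(1,2) J(1) i(2)] pick[OF n(3,4) J' i(2)] e by simp
    then show ?thesis using i(1) fV0 by simp
  next
    case False
    then show ?thesis using sup(1)[OF n(1,2) J(1), of k] sup(1)[OF n(3,4) J', of k] by simp
  qed
  moreover have "B $ k = B' $ k" for k
  proof (cases "J \<subseteq> zU k")
    case True
    then have "zU k \<in> vs J" by (auto simp: vs_def)
    then obtain i where i: "i \<notin> zU k" "\<And>Y. Y \<in> vs J \<Longrightarrow> Y \<noteq> zU k \<Longrightarrow> i \<in> Y"
      using J(2) unfolding simplicial_def by auto
    have "B $ k * f i (U k) = B' $ k * f i (U k)"
      using pick'[OF n(1,2) J(1) i(2)] pick'[OF n(3,4) J' i(2)] e by simp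
    then show ?thesis using i(1) fU0 by simp
  next
    case False
    then show ?thesis using sup(2)[OF n(1,2) J(1), of k] sup(2)[OF n(3,4) J', of k] by simp
  qed
  ultimately show ?thesis by (simp add: vec_eq_iff)
qed

text \<open>Two points on rays from \<open>p\<close> that are opposite to \<open>p\<close> (some functional positive at \<open>p\<close> vanishes)
  lie on the same ray only if they coincide.\<close>

lemma fan_unique:
  assumes "\<And>i. 0 \<le> f i y" "\<And>i. 0 \<le> f i y'" "f m y = 0" "f m' y' = 0" "0 < f m p" "0 < f m' p"
    and e: "s *\<^sub>R p + y = s' *\<^sub>R p + y'"
  shows "s = s' \<and> y = y'"
proof -
  have fe: "s * f i p + f i y = s' * f i p + f i y'" for i
    using arg_cong[OF e, of "f i"] by (simp add: inner_add_right)
  have "s' * f m p \<le> s * f m p" using fe[of m] assms(2)[of m] assms(3) by simp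
  moreover have "s * f m' p \<le> s' * f m' p" using fe[of m'] assms(1)[of m'] assms(4) by simp
  ultimately have "s = s'" using assms(5,6) by simp
  then show ?thesis using e by simp
qed

text \<open>The ray from \<open>p\<close> through \<open>x\<close> is followed until it leaves
  \<open>R\<close>; there some functional vanishes that is positive at \<open>p\<close>, while zeros
  common to \<open>p\<close> and \<open>x\<close> persist.\<close>

lemma exit_point:
  assumes p: "p \<in> R" and x: "x \<in> R" and ne: "x \<noteq> p"
  shows "\<exists>t y m. 0 < t \<and> t \<le> 1 \<and> y \<in> R \<and> x = (1 - t) *\<^sub>R p + t *\<^sub>R y \<and> Z x \<inter> Z p \<subseteq> Z y \<and> m \<in> Z y \<and> m \<notin> Z p"
proof -
  \<comment> \<open>At \<open>p + r *\<^sub>R (x - p)\<close> the value is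
    \<open>f i p * (1 - r * q i)\<close>, so the first functional to vanish is one with the largest
    \<open>q i\<close>, at \<open>r = 1 / t\<close>.\<close>
  define q where "q i = 1 - f i x / f i p" for i
  have pos: "0 < f i p" if "i \<notin> Z p" for i using R_nonneg[OF p, of i] that by (simp add: Z_def less_le)
  have "- Z p \<noteq> {}" using a_inj[of p] R_nz[OF p] by (auto simp: Z_def)
  define t where "t = Max (q ` (- Z p))"
  have qt: "q i \<le> t" if "i \<notin> Z p" for i unfolding t_def by (rule Max_ge) (use that in auto)
  have "t \<in> q ` (- Z p)" unfolding t_def by (rule Max_in) (use \<open>- Z p \<noteq> {}\<close> in auto)
  then obtain m where m: "m \<notin> Z p" "t = q m" by auto
  have t1: "t \<le> 1" using m pos[OF m(1)] R_nonneg[OF x, of m] by (simp add: q_def)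
  have t0: "0 < t"
  proof (rule ccontr)
    assume "\<not> 0 < t"
    then have "f i p \<le> f i x" for i
    proof (cases "i \<in> Z p")
      case True
      then show ?thesis using R_nonneg[OF x, of i] by (simp add: Z_def)
    next
      case False
      then have "q i \<le> 0" using qt[OF False] \<open>\<not> 0 < t\<close> by simp
      then show ?thesis using pos[OF False] by (simp add: q_def field_simps)
    qed
    moreover have "(\<Sum>i\<in>UNIV. f i x) = (\<Sum>i\<in>UNIV. f i p)" using R_hv[OF x] R_hv[OF p] by (simp add: hv)
    then have "(\<Sum>i\<in>UNIV. f i (x - p)) = 0" by (simp add: inner_diff_right sum_subtractf)
    ultimately have "f i (x - p) = 0" for i
      by (subst (asm) sum_nonneg_eq_0_iff) (auto simp: inner_diff_right)
    then have "x - p = 0" using a_inj by blast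
    with ne show False by simp
  qed
  define y where "y = (1/t) *\<^sub>R (x - (1 - t) *\<^sub>R p)"
  have fy: "f i y = (f i x - (1 - t) * f i p) / t" for i by (simp add: y_def inner_diff_right)
  have "0 \<le> f i x - (1 - t) * f i p" for i
  proof (cases "i \<in> Z p")
    case True
    then show ?thesis using R_nonneg[OF x, of i] by (simp add: Z_def)
  next
    case False
    then show ?thesis using qt[OF False] pos[OF False] by (simp add: q_def field_simps)
  qed
  then have "0 \<le> f i y" for i unfolding fy using t0 by simp
  moreover have "hv \<bullet> y = 1" using R_hv[OF x] R_hv[OF p] t0 by (simp add: y_def inner_diff_right)
  ultimately have "y \<in> R" by (simp add: R_def)
  moreover have "x = (1 - t) *\<^sub>R p + t *\<^sub>R y" using t0 by (simp add: y_def)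
  moreover have "Z x \<inter> Z p \<subseteq> Z y" by (auto simp: Z_def fy)
  moreover have "m \<in> Z y" using m pos[OF m(1)] by (simp add: Z_def fy q_def)
  ultimately show ?thesis using t0 t1 m(1) by (intro exI[of _ t] exI[of _ y] exI[of _ m]) simp
qed

section \<open>The disc\<close>

text \<open>The six faces form a disc with interior vertices \<open>U 0\<close>, \<open>U 3\<close>, \<open>U 4\<close>. It is parametrised by the cone
  over the heptagon with apex \<open>U 0\<close>, in which the triangles \<open>U 0, W 0, W 1\<close> and \<open>U 0, W 1, W 2\<close>
  are subdivided at the additional vertices \<open>U 3\<close> and \<open>U 4\<close>.\<close>

definition m0 :: "real^7 \<Rightarrow> real" where "m0 u = min (1 - tot u) (min (u $ 0) (u $ 1))"
definition m1 :: "real^7 \<Rightarrow> real" where "m1 u = min (1 - tot u) (min (u $ 1) (u $ 2))"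

text \<open>The shift by 4 is the renaming \<open>V i = W (i + 4)\<close>. The new vertices sit at
  barycentres: the minimum of the three coordinates of a subdivided triangle is taken from each of
  them, and three times this minimum goes to the new vertex.\<close>

definition dA :: "real^7 \<Rightarrow> real^7" where
  "dA u = (\<chi> i. if i = 3 then u $ 0 - m0 u else if i = 4 then u $ 1 - m0 u - m1 u
    else if i = 5 then u $ 2 - m1 u else u $ (i + 4))"

definition dB :: "real^7 \<Rightarrow> real^7" where
  "dB u = (\<chi> i. if i = 0 then 1 - tot u - m0 u - m1 u else if i = 3 then 3 * m0 u
    else if i = 4 then 3 * m1 u else 0)"

text \<open>The weights \<open>dB\<close> without that of the apex \<open>U 0\<close>.\<close>

definition dY :: "real^7 \<Rightarrow> real^7" where
  "dY u = (\<chi> i. if i = 3 then 3 * m0 u else if i = 4 then 3 * m1 u else 0)"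

definition \<Theta> :: "real^7 \<Rightarrow> real^5" where "\<Theta> u = comb (dA u) (dB u)"

definition D1 :: "(real^7) set" where "D1 = {u \<in> Fcone. tot u \<le> 1}"

lemma disc_split: "\<Theta> u = (1 - tot u - m0 u - m1 u) *\<^sub>R U 0 + comb (dA u) (dY u)"
  by (simp add: \<Theta>_def comb_def dB_def dY_def sum7)

text \<open>The first four pairs run cyclically through the zero set of \<open>U 0\<close>, so these
  faces surround \<open>U 0\<close>. The triangles of \<open>{4, 6}\<close> and
  \<open>{5, 0}\<close> fill the notches at \<open>U 3\<close> and \<open>U 4\<close>, so that the
  boundary becomes the heptagon.\<close>

definition disc_faces :: "7 set set" where
  "disc_faces = {{0, 1}, {1, 3}, {3, 4}, {4, 0}, {4, 6}, {5, 0}}"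

lemma disc_nonneg:
  assumes "u \<in> D1"
  shows "nonneg (dA u)" "nonneg (dB u)" "nonneg (dY u)" "m0 u = 0 \<or> m1 u = 0" "0 \<le> m0 u" "0 \<le> m1 u"
proof -
  obtain w where w: "sec w u" using assms by (auto simp: D1_def Fcone_def)
  have t: "0 \<le> 1 - tot u" using assms by (simp add: D1_def)
  have u0: "0 \<le> u $ i" for i using w by (simp add: sec_def)
  show m: "0 \<le> m0 u" "0 \<le> m1 u" using t u0 by (simp_all add: m0_def m1_def)
  have "u $ 0 = 0 \<or> u $ 1 = 0 \<or> u $ 2 = 0"
    using w unfolding sec_def by (cases w "0::7" rule: cases7) simp_all
  then show z: "m0 u = 0 \<or> m1 u = 0" using t u0[of 0] u0[of 1] u0[of 2] by (auto simp: m0_def m1_def min_def)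
  have le: "m0 u \<le> 1 - tot u" "m0 u \<le> u $ 0" "m0 u \<le> u $ 1" "m1 u \<le> 1 - tot u" "m1 u \<le> u $ 1" "m1 u \<le> u $ 2"
    by (simp_all add: m0_def m1_def)
  show "nonneg (dA u)" "nonneg (dB u)" "nonneg (dY u)"
    unfolding nonneg_def dA_def dB_def dY_def using z le m u0 t by auto
qed

text \<open>For every parameter either the apex has weight 0 and the point lies on one of the two outer triangles,
  or the part of the point away from the apex lies on an edge opposite to the apex.\<close>

lemma disc_shape:
  assumes u: "u \<in> D1"
  shows "(\<exists>J\<in>disc_faces. J \<subseteq> Z (\<Theta> u)) \<and>
    ((\<exists>i. {i, i+2} \<subseteq> Z (\<Theta> u)) \<or>
     (\<exists>i m. {i, i+2} \<subseteq> Z (comb (dA u) (dY u)) \<and> m \<in> Z (comb (dA u) (dY u)) \<and> m \<notin> zU 0))"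
proof -
  obtain w where w: "sec w u" using assms by (auto simp: D1_def Fcone_def)
  have t: "0 \<le> 1 - tot u" using assms by (simp add: D1_def)
  have u0: "0 \<le> u $ i" for i using w by (simp add: sec_def)
  note n = disc_nonneg[OF u]
  have ZT: "i \<in> Z (\<Theta> u) \<longleftrightarrow> (\<forall>j. dA u $ j = 0 \<or> i \<in> zV j) \<and> (\<forall>j. dB u $ j = 0 \<or> i \<in> zU j)" for i
    unfolding \<Theta>_def Z_def using f_comb_zero[OF n(1,2)] by simp
  have ZY: "i \<in> Z (comb (dA u) (dY u)) \<longleftrightarrow> (\<forall>j. dA u $ j = 0 \<or> i \<in> zV j) \<and> (\<forall>j. dY u $ j = 0 \<or> i \<in> zU j)" for i
    unfolding Z_def using f_comb_zero[OF n(1,3)] by simp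
  have uz: "u $ i = 0" if "i \<noteq> w" "i \<noteq> w + 1" for i using w that by (simp add: sec_def)
  have A: "dA u $ 0 = u $ 4" "dA u $ 1 = u $ 5" "dA u $ 2 = u $ 6" "dA u $ 3 = u $ 0 - m0 u"
    "dA u $ 4 = u $ 1 - m0 u - m1 u" "dA u $ 5 = u $ 2 - m1 u" "dA u $ 6 = u $ 3"
    and B: "dB u $ 0 = 1 - tot u - m0 u - m1 u" "dB u $ 1 = 0" "dB u $ 2 = 0" "dB u $ 3 = 3 * m0 u" "dB u $ 4 = 3 * m1 u"
      "dB u $ 5 = 0" "dB u $ 6 = 0"
    and Y: "dY u $ 0 = 0" "dY u $ 1 = 0" "dY u $ 2 = 0" "dY u $ 3 = 3 * m0 u" "dY u $ 4 = 3 * m1 u"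
      "dY u $ 5 = 0" "dY u $ 6 = 0"
    by (simp_all add: dA_def dB_def dY_def)
  note zz = ZT ZY all7 A B Y zV_def zU_def disc_faces_def ex7
  consider (far) "w \<noteq> 0" "w \<noteq> 1" | (s0) "w = 0" | (s1) "w = 1" by blast
  then show ?thesis
  proof cases
    case far
    have "u $ 1 = 0" using uz[of 1] far by (cases w "0::7" rule: cases7) simp_all
    then have m: "m0 u = 0" "m1 u = 0" using t u0[of 0] u0[of 2] by (simp_all add: m0_def m1_def)
    show ?thesis
      using far uz[of 0] uz[of 1] uz[of 2] uz[of 3] uz[of 4] uz[of 5] uz[of 6]
      by (cases w "0::7" rule: cases7) (simp_all add: zz m)
  next
    case s0
    then have z: "u $ 2 = 0" "u $ 3 = 0" "u $ 4 = 0" "u $ 5 = 0" "u $ 6 = 0" using uz by simp_all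
    then have m: "m1 u = 0" using t u0[of 1] by (simp add: m1_def)
    have "m0 u = 1 - tot u \<or> m0 u = u $ 0 \<or> m0 u = u $ 1" by (simp add: m0_def min_def)
    then show ?thesis by (elim disjE) (simp_all add: zz m z)
  next
    case s1
    then have z: "u $ 0 = 0" "u $ 3 = 0" "u $ 4 = 0" "u $ 5 = 0" "u $ 6 = 0" using uz by simp_all
    then have m: "m0 u = 0" using t u0[of 1] by (simp add: m0_def)
    have "m1 u = 1 - tot u \<or> m1 u = u $ 1 \<or> m1 u = u $ 2" by (simp add: m1_def min_def)
    then show ?thesis by (elim disjE) (simp_all add: zz m z)
  qed
qed

lemma disc_weights_inj:
  assumes "dA u = dA v" "dY u = dY v"
  shows "u = v"
proof -
  have Y: "m0 u = m0 v" "m1 u = m1 v"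
    using arg_cong[OF assms(2), of "\<lambda>y. y $ 3"] arg_cong[OF assms(2), of "\<lambda>y. y $ 4"] by (simp_all add: dY_def)
  have A: "dA u $ i = dA v $ i" for i using assms(1) by simp
  have "\<forall>i. u $ i = v $ i"
    unfolding all7 using Y A[of 0] A[of 1] A[of 2] A[of 3] A[of 4] A[of 5] A[of 6] by (simp add: dA_def)
  then show ?thesis by (simp add: vec_eq_iff)
qed

text \<open>On a triangle the weights are unique. Elsewhere \<open>fan_unique\<close> separates the
  weight of the apex \<open>U 0\<close>, and the remainder again lies on a triangle, where its
  weights are unique.\<close>

lemma disc_inj: "inj_on \<Theta> D1"
proof (rule inj_onI)
  fix u v assume uv: "u \<in> D1" "v \<in> D1" "\<Theta> u = \<Theta> v"
  note n = disc_nonneg[OF uv(1)] and n' = disc_nonneg[OF uv(2)]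
  have ear: "u = v" if "{i, i+2} \<subseteq> Z (\<Theta> u)" for i
  proof -
    have "dA u = dA v \<and> dB u = dB v"
      by (rule comb_unique[OF n(1,2) n'(1,2) _ _ simplicial2[of i]]) (use uv(3) that in \<open>simp_all add: \<Theta>_def\<close>)
    moreover then have "dY u = dY v"
      by (auto simp: vec_eq_iff dY_def dB_def dest: spec[of _ 3] spec[of _ 4])
    ultimately show ?thesis using disc_weights_inj by blast
  qed
  show "u = v"
  proof (cases "(\<exists>i. {i, i+2} \<subseteq> Z (\<Theta> u)) \<or> (\<exists>i. {i, i+2} \<subseteq> Z (\<Theta> v))")
    case True
    then show ?thesis using ear uv(3) by metis
  next
    case False
    then obtain i m i' m' where m: "{i, i+2} \<subseteq> Z (comb (dA u) (dY u))" "m \<in> Z (comb (dA u) (dY u))" "m \<notin> zU 0"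
      and m': "m' \<in> Z (comb (dA v) (dY v))" "m' \<notin> zU 0"
      using disc_shape[OF uv(1)] disc_shape[OF uv(2)] by metis
    have "1 - tot u - m0 u - m1 u = 1 - tot v - m0 v - m1 v \<and> comb (dA u) (dY u) = comb (dA v) (dY v)"
    proof (rule fan_unique)
      show "f m (comb (dA u) (dY u)) = 0" "f m' (comb (dA v) (dY v)) = 0" using m m' by (simp_all add: Z_def)
      show "0 < f m (U 0)" "0 < f m' (U 0)" using f_U(2) m m' by simp_all
      show "(1 - tot u - m0 u - m1 u) *\<^sub>R U 0 + comb (dA u) (dY u) = (1 - tot v - m0 v - m1 v) *\<^sub>R U 0 + comb (dA v) (dY v)"
        using uv(3) unfolding disc_split .
    qed (rule f_comb_nonneg[OF n(1,3)], rule f_comb_nonneg[OF n'(1,3)])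
    then have "dA u = dA v \<and> dY u = dY v"
      by (intro comb_unique[OF n(1,3) n'(1,3) _ m(1) simplicial2]) simp
    then show ?thesis using disc_weights_inj by blast
  qed
qed

lemma comb_in_R:
  assumes "nonneg A" "nonneg B" "(\<Sum>i\<in>UNIV. A $ i) + (\<Sum>i\<in>UNIV. B $ i) = 1"
  shows "comb A B \<in> R"
proof -
  have "hv \<bullet> comb A B = 1"
    using assms(3) by (simp add: comb_def inner_add_right inner_sum_right hv_V hv_U)
  then show ?thesis using f_comb_nonneg[OF assms(1,2)] by (simp add: R_def)
qed

lemma disc_in_R: "u \<in> D1 \<Longrightarrow> \<Theta> u \<in> R"
  unfolding \<Theta>_def by (rule comb_in_R) (simp_all add: disc_nonneg, simp add: sum7 dA_def dB_def tot_def)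

lemma disc_far:
  assumes "0 \<le> p" "0 \<le> q" "0 \<le> s" "s + p + q = 1" "w \<noteq> 0" "w \<noteq> 1"
  shows "s *\<^sub>R U 0 + p *\<^sub>R W w + q *\<^sub>R W (w+1) \<in> \<Theta> ` D1"
proof -
  define u :: "real^7" where "u = (\<chi> i. if i = w then p else if i = w + 1 then q else 0)"
  have s: "sec w u" using assms by (auto simp: sec_def u_def)
  have t: "tot u = p + q" unfolding tot_def sum7_shift[of _ w] by (simp add: u_def)
  have "u \<in> D1" using s t assms by (auto simp: D1_def Fcone_def)
  have "u $ 1 = 0" using assms(5,6) by (cases w "0::7" rule: cases7) (simp_all add: u_def)
  then have m: "m0 u = 0" "m1 u = 0" using s t assms by (simp_all add: m0_def m1_def sec_def)
  have "comb (dA u) (dY u) = lc u"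
    by (simp add: comb_def dA_def dY_def m lc_def W_def sum7 algebra_simps)
  moreover have "lc u = p *\<^sub>R W w + q *\<^sub>R W (w+1)" unfolding lc_sec[OF s] by (simp add: u_def)
  moreover have "1 - tot u - m0 u - m1 u = s" using assms(4) t m by simp
  ultimately have "\<Theta> u = s *\<^sub>R U 0 + p *\<^sub>R W w + q *\<^sub>R W (w+1)"
    unfolding disc_split by (simp add: add.assoc)
  then show ?thesis using \<open>u \<in> D1\<close> by force
qed

text \<open>The last hypothesis places the point in one of the three triangles around
  \<open>U 3\<close>. The parameter undoes the subdivision by returning \<open>r/3\<close> to each
  of the three corners.\<close>

lemma disc_near0:
  assumes "0 \<le> p" "0 \<le> q" "0 \<le> s" "0 \<le> r" "s + p + q + r = 1" "s = 0 \<or> p = 0 \<or> q = 0"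
  shows "s *\<^sub>R U 0 + p *\<^sub>R V 3 + q *\<^sub>R V 4 + r *\<^sub>R U 3 \<in> \<Theta> ` D1"
proof -
  define u :: "real^7" where "u = (\<chi> i. if i = 0 then p + r/3 else if i = 1 then q + r/3 else 0)"
  have s: "sec 0 u" using assms by (auto simp: sec_def u_def)
  have t: "tot u = p + q + 2*r/3" by (simp add: tot_def sum7 u_def)
  have "u \<in> D1" using s t assms by (auto simp: D1_def Fcone_def)
  have m: "m0 u = r/3" "m1 u = 0" using assms by (auto simp: m0_def m1_def t) (auto simp: u_def min_def)
  have un: "u $ 0 = p + r/3" "u $ 1 = q + r/3" "u $ 2 = 0" "u $ 3 = 0" "u $ 4 = 0" "u $ 5 = 0" "u $ 6 = 0"
    by (simp_all add: u_def)
  have "comb (dA u) (dY u) = p *\<^sub>R V 3 + q *\<^sub>R V 4 + r *\<^sub>R U 3"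
    by (simp add: comb_def dA_def dY_def m sum7 un)
  moreover have "1 - tot u - m0 u - m1 u = s" using assms(5) t m by simp
  ultimately have "\<Theta> u = s *\<^sub>R U 0 + p *\<^sub>R V 3 + q *\<^sub>R V 4 + r *\<^sub>R U 3"
    unfolding disc_split by (simp add: add.assoc)
  then show ?thesis using \<open>u \<in> D1\<close> by force
qed

lemma disc_near1:
  assumes "0 \<le> p" "0 \<le> q" "0 \<le> s" "0 \<le> r" "s + p + q + r = 1" "s = 0 \<or> p = 0 \<or> q = 0"
  shows "s *\<^sub>R U 0 + p *\<^sub>R V 4 + q *\<^sub>R V 5 + r *\<^sub>R U 4 \<in> \<Theta> ` D1"
proof -
  define u :: "real^7" where "u = (\<chi> i. if i = 1 then p + r/3 else if i = 2 then q + r/3 else 0)"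
  have s: "sec 1 u" using assms by (auto simp: sec_def u_def)
  have t: "tot u = p + q + 2*r/3" by (simp add: tot_def sum7 u_def)
  have "u \<in> D1" using s t assms by (auto simp: D1_def Fcone_def)
  have m: "m1 u = r/3" "m0 u = 0" using assms by (auto simp: m0_def m1_def t) (auto simp: u_def min_def)
  have un: "u $ 0 = 0" "u $ 1 = p + r/3" "u $ 2 = q + r/3" "u $ 3 = 0" "u $ 4 = 0" "u $ 5 = 0" "u $ 6 = 0"
    by (simp_all add: u_def)
  have "comb (dA u) (dY u) = p *\<^sub>R V 4 + q *\<^sub>R V 5 + r *\<^sub>R U 4"
    by (simp add: comb_def dA_def dY_def m sum7 un)
  moreover have "1 - tot u - m0 u - m1 u = s" using assms(5) t m by simp
  ultimately have "\<Theta> u = s *\<^sub>R U 0 + p *\<^sub>R V 4 + q *\<^sub>R V 5 + r *\<^sub>R U 4"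
    unfolding disc_split by (simp add: add.assoc)
  then show ?thesis using \<open>u \<in> D1\<close> by force
qed

lemma FC_edge:
  assumes "{k. J \<subseteq> zV k} = SV" "{k. J \<subseteq> zU k} = SU" "V ` SV \<union> U ` SU = {X, Y}" "x \<in> FC J"
  shows "\<exists>p q. 0 \<le> p \<and> 0 \<le> q \<and> p + q = 1 \<and> x = p *\<^sub>R X + q *\<^sub>R Y"
proof -
  have "{V k |k. J \<subseteq> zV k} \<union> {U k |k. J \<subseteq> zU k} = {X, Y}" unfolding assms(3)[symmetric] assms(1,2)[symmetric] by auto
  then have "x \<in> convex hull {X, Y}" using assms(4) FC_hull by simp
  then show ?thesis unfolding convex_hull_2 by auto
qed

lemma FC_triangle:
  assumes "{k. J \<subseteq> zV k} = SV" "{k. J \<subseteq> zU k} = SU" "V ` SV \<union> U ` SU = {X, Y, T}" "x \<in> FC J"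
  shows "\<exists>p q r. 0 \<le> p \<and> 0 \<le> q \<and> 0 \<le> r \<and> p + q + r = 1 \<and> x = p *\<^sub>R X + q *\<^sub>R Y + r *\<^sub>R T"
proof -
  have "{V k |k. J \<subseteq> zV k} \<union> {U k |k. J \<subseteq> zU k} = {X, Y, T}" unfolding assms(3)[symmetric] assms(1,2)[symmetric] by auto
  then have "x \<in> convex hull {X, Y, T}" using assms(4) FC_hull by simp
  then show ?thesis unfolding convex_hull_3 by auto
qed

text \<open>The nine edges that avoid \<open>U 0\<close> in the four faces around it: three for each
  pentagon, one for the triangle, two for the quadrilateral.\<close>

lemma FC_edges:
  "x \<in> FC {0,1,2} \<Longrightarrow> \<exists>p q. 0 \<le> p \<and> 0 \<le> q \<and> p + q = 1 \<and> x = p *\<^sub>R V 6 + q *\<^sub>R V 0"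
  "x \<in> FC {0,1,5} \<Longrightarrow> \<exists>p q. 0 \<le> p \<and> 0 \<le> q \<and> p + q = 1 \<and> x = p *\<^sub>R V 5 + q *\<^sub>R U 4"
  "x \<in> FC {0,1,6} \<Longrightarrow> \<exists>p q. 0 \<le> p \<and> 0 \<le> q \<and> p + q = 1 \<and> x = p *\<^sub>R V 5 + q *\<^sub>R V 6"
  "x \<in> FC {1,3,2} \<Longrightarrow> \<exists>p q. 0 \<le> p \<and> 0 \<le> q \<and> p + q = 1 \<and> x = p *\<^sub>R V 0 + q *\<^sub>R V 1"
  "x \<in> FC {3,4,2} \<Longrightarrow> \<exists>p q. 0 \<le> p \<and> 0 \<le> q \<and> p + q = 1 \<and> x = p *\<^sub>R V 1 + q *\<^sub>R V 2"
  "x \<in> FC {3,4,5} \<Longrightarrow> \<exists>p q. 0 \<le> p \<and> 0 \<le> q \<and> p + q = 1 \<and> x = p *\<^sub>R V 2 + q *\<^sub>R V 3"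
  "x \<in> FC {3,4,6} \<Longrightarrow> \<exists>p q. 0 \<le> p \<and> 0 \<le> q \<and> p + q = 1 \<and> x = p *\<^sub>R V 3 + q *\<^sub>R U 3"
  "x \<in> FC {4,0,5} \<Longrightarrow> \<exists>p q. 0 \<le> p \<and> 0 \<le> q \<and> p + q = 1 \<and> x = p *\<^sub>R V 4 + q *\<^sub>R U 4"
  "x \<in> FC {4,0,6} \<Longrightarrow> \<exists>p q. 0 \<le> p \<and> 0 \<le> q \<and> p + q = 1 \<and> x = p *\<^sub>R V 4 + q *\<^sub>R U 3"
proof -
  note e = FC_edge[OF Collect7 Collect7]
  note c = zV_table zU_table
  show "x \<in> FC {0,1,2} \<Longrightarrow> \<exists>p q. 0 \<le> p \<and> 0 \<le> q \<and> p + q = 1 \<and> x = p *\<^sub>R V 6 + q *\<^sub>R V 0"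
    by (rule e) (auto simp: c)
  show "x \<in> FC {0,1,5} \<Longrightarrow> \<exists>p q. 0 \<le> p \<and> 0 \<le> q \<and> p + q = 1 \<and> x = p *\<^sub>R V 5 + q *\<^sub>R U 4"
    by (rule e) (auto simp: c)
  show "x \<in> FC {0,1,6} \<Longrightarrow> \<exists>p q. 0 \<le> p \<and> 0 \<le> q \<and> p + q = 1 \<and> x = p *\<^sub>R V 5 + q *\<^sub>R V 6"
    by (rule e) (auto simp: c)
  show "x \<in> FC {1,3,2} \<Longrightarrow> \<exists>p q. 0 \<le> p \<and> 0 \<le> q \<and> p + q = 1 \<and> x = p *\<^sub>R V 0 + q *\<^sub>R V 1"
    by (rule e) (auto simp: c)
  show "x \<in> FC {3,4,2} \<Longrightarrow> \<exists>p q. 0 \<le> p \<and> 0 \<le> q \<and> p + q = 1 \<and> x = p *\<^sub>R V 1 + q *\<^sub>R V 2"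
    by (rule e) (auto simp: c)
  show "x \<in> FC {3,4,5} \<Longrightarrow> \<exists>p q. 0 \<le> p \<and> 0 \<le> q \<and> p + q = 1 \<and> x = p *\<^sub>R V 2 + q *\<^sub>R V 3"
    by (rule e) (auto simp: c)
  show "x \<in> FC {3,4,6} \<Longrightarrow> \<exists>p q. 0 \<le> p \<and> 0 \<le> q \<and> p + q = 1 \<and> x = p *\<^sub>R V 3 + q *\<^sub>R U 3"
    by (rule e) (auto simp: c)
  show "x \<in> FC {4,0,5} \<Longrightarrow> \<exists>p q. 0 \<le> p \<and> 0 \<le> q \<and> p + q = 1 \<and> x = p *\<^sub>R V 4 + q *\<^sub>R U 4"
    by (rule e) (auto simp: c)
  show "x \<in> FC {4,0,6} \<Longrightarrow> \<exists>p q. 0 \<le> p \<and> 0 \<le> q \<and> p + q = 1 \<and> x = p *\<^sub>R V 4 + q *\<^sub>R U 3"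
    by (rule e) (auto simp: c)
qed

lemma FC_ears:
  "x \<in> FC {4,6} \<Longrightarrow> \<exists>p q r. 0 \<le> p \<and> 0 \<le> q \<and> 0 \<le> r \<and> p + q + r = 1 \<and> x = p *\<^sub>R V 3 + q *\<^sub>R V 4 + r *\<^sub>R U 3"
  "x \<in> FC {5,0} \<Longrightarrow> \<exists>p q r. 0 \<le> p \<and> 0 \<le> q \<and> 0 \<le> r \<and> p + q + r = 1 \<and> x = p *\<^sub>R V 4 + q *\<^sub>R V 5 + r *\<^sub>R U 4"
proof -
  note e = FC_triangle[OF Collect7 Collect7]
  note c = zV_table zU_table
  show "x \<in> FC {4,6} \<Longrightarrow> \<exists>p q r. 0 \<le> p \<and> 0 \<le> q \<and> 0 \<le> r \<and> p + q + r = 1 \<and> x = p *\<^sub>R V 3 + q *\<^sub>R V 4 + r *\<^sub>R U 3"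
    by (rule e) (auto simp: c)
  show "x \<in> FC {5,0} \<Longrightarrow> \<exists>p q r. 0 \<le> p \<and> 0 \<le> q \<and> 0 \<le> r \<and> p + q + r = 1 \<and> x = p *\<^sub>R V 4 + q *\<^sub>R V 5 + r *\<^sub>R U 4"
    by (rule e) (auto simp: c)
qed

lemma disc_cone:
  assumes "x = (1 - t) *\<^sub>R U 0 + t *\<^sub>R y" "0 < t" "t \<le> 1" "0 \<le> p" "0 \<le> q" "p + q = 1"
  shows "y = p *\<^sub>R V (w+3) + q *\<^sub>R V (w+4) \<Longrightarrow> w \<noteq> 0 \<Longrightarrow> w \<noteq> 1 \<Longrightarrow> x \<in> \<Theta> ` D1"
    "y = p *\<^sub>R V 3 + q *\<^sub>R U 3 \<Longrightarrow> x \<in> \<Theta> ` D1" "y = p *\<^sub>R V 4 + q *\<^sub>R U 3 \<Longrightarrow> x \<in> \<Theta> ` D1"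
    "y = p *\<^sub>R V 4 + q *\<^sub>R U 4 \<Longrightarrow> x \<in> \<Theta> ` D1" "y = p *\<^sub>R V 5 + q *\<^sub>R U 4 \<Longrightarrow> x \<in> \<Theta> ` D1"
proof -
  have s: "0 \<le> 1 - t" "0 \<le> t * p" "0 \<le> t * q" using assms by simp_all
  have 1: "(1 - t) + t * p + t * q = 1" using assms(6) by (metis add.assoc diff_add_cancel distrib_left mult.right_neutral)
  show "x \<in> \<Theta> ` D1" if "y = p *\<^sub>R V (w+3) + q *\<^sub>R V (w+4)" "w \<noteq> 0" "w \<noteq> 1"
    using disc_far[OF s(2,3,1) 1 that(2,3)] unfolding assms(1) that(1) by (simp add: W_def algebra_simps)
  show "x \<in> \<Theta> ` D1" if "y = p *\<^sub>R V 3 + q *\<^sub>R U 3"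
    using disc_near0[of "t*p" 0 "1-t" "t*q"] s 1 unfolding assms(1) that by (simp add: algebra_simps)
  show "x \<in> \<Theta> ` D1" if "y = p *\<^sub>R V 4 + q *\<^sub>R U 3"
    using disc_near0[of 0 "t*p" "1-t" "t*q"] s 1 unfolding assms(1) that by (simp add: algebra_simps)
  show "x \<in> \<Theta> ` D1" if "y = p *\<^sub>R V 4 + q *\<^sub>R U 4"
    using disc_near1[of "t*p" 0 "1-t" "t*q"] s 1 unfolding assms(1) that by (simp add: algebra_simps)
  show "x \<in> \<Theta> ` D1" if "y = p *\<^sub>R V 5 + q *\<^sub>R U 4"
    using disc_near1[of 0 "t*p" "1-t" "t*q"] s 1 unfolding assms(1) that by (simp add: algebra_simps)
qed

lemma U0_disc: "U 0 \<in> \<Theta> ` D1"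
  using disc_near0[of 0 0 1 0] by simp

text \<open>In a face at \<open>U 0\<close> the ray from \<open>U 0\<close> is followed to an edge
  that avoids it; the new zero is 2, 5 or 6, and combinations that are not good are excluded. The
  two outer triangles are covered directly.\<close>

lemma disc_image: "\<Theta> ` D1 = {x \<in> R. \<exists>J\<in>disc_faces. J \<subseteq> Z x}"
proof
  show "\<Theta> ` D1 \<subseteq> {x \<in> R. \<exists>J\<in>disc_faces. J \<subseteq> Z x}" using disc_shape disc_in_R by auto
  show "{x \<in> R. \<exists>J\<in>disc_faces. J \<subseteq> Z x} \<subseteq> \<Theta> ` D1"
  proof
    fix x assume "x \<in> {x \<in> R. \<exists>J\<in>disc_faces. J \<subseteq> Z x}"
    then obtain J where J: "x \<in> R" "J \<in> disc_faces" "J \<subseteq> Z x" by auto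
    consider (ear1) "J = {4, 6}" | (ear2) "J = {5, 0}" | (star) "J \<in> {{0,1},{1,3},{3,4},{4,0}}"
      using J(2) by (auto simp: disc_faces_def)
    then show "x \<in> \<Theta> ` D1"
    proof cases
      case ear1
      then have "x \<in> FC {4,6}" using J by (simp add: FC_iff)
      then obtain p q r where "0 \<le> p" "0 \<le> q" "0 \<le> r" "p + q + r = 1" "x = p *\<^sub>R V 3 + q *\<^sub>R V 4 + r *\<^sub>R U 3"
        using FC_ears(1) by blast
      then show ?thesis using disc_near0[of p q 0 r] by simp
    next
      case ear2
      then have "x \<in> FC {5,0}" using J by (simp add: FC_iff)
      then obtain p q r where "0 \<le> p" "0 \<le> q" "0 \<le> r" "p + q + r = 1" "x = p *\<^sub>R V 4 + q *\<^sub>R V 5 + r *\<^sub>R U 4"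
        using FC_ears(2) by blast
      then show ?thesis using disc_near1[of p q 0 r] by simp
    next
      case star
      show ?thesis
      proof (cases "x = U 0")
        case True
        then show ?thesis using U0_disc by simp
      next
        case False
        then obtain t y m where y: "0 < t" "t \<le> 1" "y \<in> R" "x = (1 - t) *\<^sub>R U 0 + t *\<^sub>R y"
          "Z x \<inter> Z (U 0) \<subseteq> Z y" "m \<in> Z y" "m \<notin> Z (U 0)"
          using exit_point[OF U_in_R J(1)] by blast
        have "J \<subseteq> zU 0" using star by (auto simp: zU_def)
        then have "J \<subseteq> Z y" using J(3) y(5) Z_U by blast
        have "m = 2 \<or> m = 5 \<or> m = 6" using y(7) unfolding Z_U by (cases m "0::7" rule: cases7) (simp_all add: zU_def)
        note dc = disc_cone[OF y(4,1,2)]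
        note w = dc(1)[of _ _ 2, simplified] dc(1)[of _ _ 3, simplified] dc(1)[of _ _ 4, simplified]
          dc(1)[of _ _ 5, simplified] dc(1)[of _ _ 6, simplified]
        have mem: "{i, j} \<subseteq> Z y \<Longrightarrow> y \<in> FC {i, j, m}" for i j using y(3,6) by (simp add: FC_iff)
        have bad: "\<not> {i, i+2, i+4} \<subseteq> Z y" for i using good_Z[OF y(3)] unfolding good_def by simp
        note fe = FC_edges[of y]
        have "J = {0,1} \<or> J = {1,3} \<or> J = {3,4} \<or> J = {4,0}" using star by simp
        then show ?thesis
        proof (elim disjE)
          assume "J = {0,1}"
          then have "y \<in> FC {0,1,m}" using \<open>J \<subseteq> Z y\<close> mem by blast
          then show ?thesis using \<open>m = 2 \<or> m = 5 \<or> m = 6\<close> fe(1-3) w dc(5) by (elim disjE) (metis, metis, metis)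
        next
          assume "J = {1,3}"
          then have "y \<in> FC {1,3,m}" using \<open>J \<subseteq> Z y\<close> mem by blast
          moreover have "m \<noteq> 5" "m \<noteq> 6" using bad[of 1] bad[of 6] \<open>J = {1,3}\<close> \<open>J \<subseteq> Z y\<close> y(6) by auto
          ultimately show ?thesis using \<open>m = 2 \<or> m = 5 \<or> m = 6\<close> fe(4) w by metis
        next
          assume "J = {3,4}"
          then have "y \<in> FC {3,4,m}" using \<open>J \<subseteq> Z y\<close> mem by blast
          then show ?thesis using \<open>m = 2 \<or> m = 5 \<or> m = 6\<close> fe(5-7) w dc(2) by (elim disjE) (metis, metis, metis)
        next
          assume "J = {4,0}"
          then have "y \<in> FC {4,0,m}" using \<open>J \<subseteq> Z y\<close> mem by blast
          moreover have "m \<noteq> 2" using bad[of 0] \<open>J = {4,0}\<close> \<open>J \<subseteq> Z y\<close> y(6) by auto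
          ultimately show ?thesis using \<open>m = 2 \<or> m = 5 \<or> m = 6\<close> fe(8,9) dc(3,4) by metis
        qed
      qed
    qed
  qed
qed

lemma disc_boundary: "\<Theta> ` F1 = Cset"
proof -
  have "\<Theta> u = lc u" if u: "u \<in> F1" for u
  proof -
    have t: "tot u = 1" "\<And>i. 0 \<le> u $ i" using u Fcone_nonneg by (auto simp: F1_def)
    then have m: "m0 u = 0" "m1 u = 0" by (simp_all add: m0_def m1_def min_def)
    have "comb (dA u) (dY u) = lc u"
      by (simp add: comb_def dA_def dY_def m lc_def W_def sum7 algebra_simps)
    then show ?thesis unfolding disc_split m t by simp
  qed
  then show ?thesis unfolding Cset_lc by auto
qed

lemma cont_\<Theta>: "continuous_on S \<Theta>"
proof -
  have m: "continuous_on S m0" "continuous_on S m1"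
    unfolding m0_def m1_def by (intro continuous_intros cont_tot)+
  have "continuous_on S (\<lambda>u. dA u $ i)" "continuous_on S (\<lambda>u. dB u $ i)" for i
    unfolding dA_def dB_def using m cont_tot[of S]
    by (cases "i = 0"; cases "i = 3"; cases "i = 4"; cases "i = 5"; auto intro!: continuous_intros)+
  then show ?thesis unfolding \<Theta>_def comb_def
    by (intro continuous_on_add continuous_on_sum continuous_on_scaleR continuous_on_const)
qed

text \<open>Rescales the planar image to length \<open>tot u\<close>, which turns the polygon into
  the round disc; the default value of division gives 0 at the apex.\<close>

definition km :: "real^7 \<Rightarrow> real^2" where "km u = (tot u / norm (pl u)) *\<^sub>R pl u"

lemma compact_D1: "compact D1" unfolding D1_def by (rule compact_Fcone_le)

lemma km_0: "km 0 = 0" by (simp add: km_def linear_0[OF linear_pl])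

lemma norm_km: "u \<in> Fcone \<Longrightarrow> norm (km u) = tot u"
  using pl_eq_0[of u] tot_nonneg[of u] linear_0[OF linear_tot] by (cases "u = 0") (simp_all add: km_def linear_0[OF linear_pl])

text \<open>At the apex the formula degenerates, and continuity follows from \<open>norm_km\<close>
  instead.\<close>

lemma cont_km: "continuous_on D1 km"
  unfolding continuous_on_eq_continuous_within
proof
  fix u assume u: "u \<in> D1"
  show "continuous (at u within D1) km"
  proof (cases "u = 0")
    case True
    have "(tot \<longlongrightarrow> tot 0) (at 0 within D1)" using cont_tot[of D1] u True by (simp add: continuous_on_def)
    then have "(tot \<longlongrightarrow> 0) (at 0 within D1)" by (simp add: linear_0[OF linear_tot])
    then have "(km \<longlongrightarrow> 0) (at 0 within D1)"
      by (rule Lim_null_comparison[rotated]) (auto simp: eventually_at_filter norm_km D1_def)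
    then show ?thesis unfolding True continuous_within km_0 .
  next
    case False
    have "pl u \<noteq> 0" using False u pl_eq_0 by (simp add: D1_def)
    then show ?thesis unfolding km_def using cont_pl[of D1] cont_tot[of D1] u
      by (intro continuous_intros) (auto simp: continuous_on_eq_continuous_within)
  qed
qed

lemma inj_km: "inj_on km D1"
proof (rule inj_onI)
  fix u v assume uv: "u \<in> D1" "v \<in> D1" "km u = km v"
  then have F: "u \<in> Fcone" "v \<in> Fcone" by (simp_all add: D1_def)
  then have t: "tot u = tot v" using norm_km uv(3) by metis
  show "u = v"
  proof (cases "u = 0 \<or> v = 0")
    case True
    then show ?thesis using t tot_eq_0 F linear_0[OF linear_tot] by metis
  next
    case False
    then have n: "0 < norm (pl u)" "0 < norm (pl v)" "0 < tot u" using F pl_eq_0 tot_eq_0 tot_nonneg[OF F(1)] by (auto simp: less_le)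
    define r where "r = norm (pl u) / norm (pl v)"
    have "(norm (pl u) / tot u) *\<^sub>R km u = (norm (pl u) / tot u) *\<^sub>R km v" using uv(3) by simp
    then have "pl u = r *\<^sub>R pl v" using n t by (simp add: km_def r_def)
    then have "pl u = pl (r *\<^sub>R v)" by (simp add: linear_cmul[OF linear_pl])
    then have e: "u = r *\<^sub>R v" using fan_pl[OF F(1)] fan_pl[OF Fcone_scale[OF F(2), of r]] by (simp add: r_def)
    then have "tot u = r * tot v" by (simp add: linear_cmul[OF linear_tot])
    then have "r = 1" using t n(3) by simp
    then show ?thesis using e by simp
  qed
qed

lemma km_surj: "\<exists>u\<in>Fcone. km u = z \<and> tot u = norm z"
proof (cases "z = 0")
  case True
  then show ?thesis using zero_Fcone km_0 linear_0[OF linear_tot] by (intro bexI[of _ 0]) simp_all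
next
  case False
  define v where "v = fan z"
  have v: "v \<in> Fcone" "pl v = z" using fan by (simp_all add: v_def)
  then have "v \<noteq> 0" using False linear_0[OF linear_pl] by auto
  then have t: "0 < tot v" using tot_nonneg[OF v(1)] tot_eq_0[OF v(1)] by simp
  let ?u = "(norm z / tot v) *\<^sub>R v"
  have "tot ?u = norm z" using t by (simp add: linear_cmul[OF linear_tot])
  moreover have "km ?u = z" using t False by (simp add: km_def linear_cmul[OF linear_tot] linear_cmul[OF linear_pl] v(2))
  moreover have "?u \<in> Fcone" using Fcone_scale[OF v(1)] t by simp
  ultimately show ?thesis by blast
qed

lemma km_image: "km ` D1 = cball 0 1" "km ` F1 = sphere 0 1"
proof -
  show "km ` D1 = cball 0 1"
  proof
    show "km ` D1 \<subseteq> cball 0 1" using norm_km by (auto simp: D1_def)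
    show "cball 0 1 \<subseteq> km ` D1"
    proof
      fix z :: "real^2" assume "z \<in> cball 0 1"
      moreover obtain u where "u \<in> Fcone" "km u = z" "tot u = norm z" using km_surj by blast
      ultimately show "z \<in> km ` D1" by (intro image_eqI[of _ _ u]) (simp_all add: D1_def)
    qed
  qed
  show "km ` F1 = sphere 0 1"
  proof
    show "km ` F1 \<subseteq> sphere 0 1" using norm_km by (auto simp: F1_def)
    show "sphere 0 1 \<subseteq> km ` F1"
    proof
      fix z :: "real^2" assume "z \<in> sphere 0 1"
      moreover obtain u where "u \<in> Fcone" "km u = z" "tot u = norm z" using km_surj by blast
      ultimately show "z \<in> km ` F1" by (intro image_eqI[of _ _ u]) (simp_all add: F1_def)
    qed
  qed
qed

lemma disc_exists: "\<exists>\<S>\<subseteq>cells_of_dim 2 tess. disc_with_boundary (\<Union>\<S>) (abs_pspace ` Cset)"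
proof (intro exI conjI)
  show "P ` disc_faces \<subseteq> cells_of_dim 2 tess" unfolding cells2 by (rule image_mono) (auto simp: disc_faces_def)
  obtain k' where k': "homeomorphism D1 (cball 0 1) km k'"
    using homeomorphism_compact[OF compact_D1 cont_km km_image(1) inj_km] by blast
  obtain t' where t': "homeomorphism D1 (\<Theta> ` D1) \<Theta> t'"
    using homeomorphism_compact[OF compact_D1 cont_\<Theta> refl disc_inj] by blast
  have DR: "\<Theta> ` D1 \<subseteq> R" using disc_in_R by auto
  have h: "homeomorphism (cball 0 1) (abs_pspace ` \<Theta> ` D1) (abs_pspace \<circ> (\<Theta> \<circ> k')) ((km \<circ> t') \<circ> chart hv)"
    by (rule homeomorphism_compose[OF homeomorphism_compose[OF homeomorphism_symD[OF k'] t'] homeomorphism_symD[OF chart_homeo[OF DR]]])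
  have "F1 \<subseteq> D1" by (auto simp: F1_def D1_def)
  then have "k' ` sphere 0 1 = F1"
    unfolding km_image(2)[symmetric] image_image using homeomorphism_apply1[OF k'] by (auto simp: image_iff subset_iff) 
  then have "(abs_pspace \<circ> (\<Theta> \<circ> k')) ` sphere 0 1 = abs_pspace ` Cset"
    unfolding image_comp[symmetric] by (simp add: disc_boundary)
  moreover have "\<Union>(P ` disc_faces) = abs_pspace ` \<Theta> ` D1" unfolding Union_P disc_image ..
  ultimately show "disc_with_boundary (\<Union>(P ` disc_faces)) (abs_pspace ` Cset)"
    unfolding disc_with_boundary_def using h by metis
qed

end

section \<open>The Moebius strip\<close>

text \<open>The universal cover \<open>\<real> \<times> [-1,1]\<close> of the strip is triangulated with vertices \<open>A p = (p, tau p)\<close> and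
  \<open>B p = (p, 0)\<close> and triangles \<open>A (p-1), A (p+1), B p\<close> and \<open>A p, B (p-1), B p\<close> and \<open>A p, B p, B (p+1)\<close>.
  \<open>hA p\<close> and \<open>hB p\<close> are the barycentric coordinates at \<open>A p\<close> and \<open>B p\<close>. The vertex \<open>A p\<close> is sent to
  \<open>V (4 p + 4)\<close> and \<open>B p\<close> to \<open>U (4 p)\<close>; translation by 7 reverses the second coordinate. The sums over
  \<open>{-30..30}\<close> include every vertex that matters for \<open>0 \<le> x \<le> 7\<close>.\<close>

definition hatA :: "real \<Rightarrow> real \<Rightarrow> real" where
  "hatA d s = max 0 ((max 0 (1 + s - d) - max 0 (1 - s - d)) / 2)"
definition hatB :: "real \<Rightarrow> real \<Rightarrow> real" where
  "hatB d s = max 0 (min (1 - d - max 0 s) (1 + min 0 s))"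
definition tau :: "int \<Rightarrow> real" where "tau p = (if even p then - 1 else 1)"
definition hA :: "int \<Rightarrow> real \<Rightarrow> real \<Rightarrow> real" where "hA p x y = hatA \<bar>x - of_int p\<bar> (tau p * y)"
definition hB :: "int \<Rightarrow> real \<Rightarrow> real \<Rightarrow> real" where "hB p x y = hatB \<bar>x - of_int p\<bar> (tau p * y)"
definition vA :: "int \<Rightarrow> 7" where "vA p = 4 * of_int p + 4"
definition vB :: "int \<Rightarrow> 7" where "vB p = 4 * of_int p"

definition wA :: "real \<Rightarrow> real \<Rightarrow> real^7" where
  "wA x y = (\<chi> i. \<Sum>p\<in>{-30..30}. if vA p = i then hA p x y else 0)"
definition wB :: "real \<Rightarrow> real \<Rightarrow> real^7" where
  "wB x y = (\<chi> i. \<Sum>p\<in>{-30..30}. if vB p = i then hB p x y else 0)"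

lemma tau_abs: "\<bar>tau p\<bar> = 1" "tau p * tau p = 1" by (simp_all add: tau_def)

lemma hA_zero: "2 \<le> \<bar>x - of_int p\<bar> \<Longrightarrow> \<bar>y\<bar> \<le> 1 \<Longrightarrow> hA p x y = 0"
  by (auto simp: hA_def hatA_def tau_def max_def abs_le_iff)

lemma hB_zero: "1 \<le> \<bar>x - of_int p\<bar> \<Longrightarrow> hB p x y = 0"
  unfolding hB_def hatB_def by (simp add: max_def min_def)

text \<open>The part of the strip above \<open>[k, k+1]\<close>. The sign in \<sigma> is such that
  \<open>A k\<close> has height 1 and \<open>A (k+1)\<close> height -1. The bounds on
  \<open>k\<close> keep all nearby vertices inside the range of summation and leave room for
  translations by 7.\<close>

locale cell =
  fixes k :: int and \<xi> y :: real
  assumes xi: "0 \<le> \<xi>" "\<xi> \<le> 1" and y: "\<bar>y\<bar> \<le> 1" and k: "-10 \<le> k" "k \<le> 20"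
begin

abbreviation "x \<equiv> of_int k + \<xi>"
abbreviation "j \<equiv> vB k"
definition "\<sigma> = tau k * y"
definition "al0 = hA (k - 1) x y"
definition "al1 = hA k x y"
definition "al2 = hA (k + 1) x y"
definition "al3 = hA (k + 2) x y"
definition "be1 = hB k x y"
definition "be2 = hB (k + 1) x y"

lemma sigma: "\<bar>\<sigma>\<bar> \<le> 1" using y by (simp add: \<sigma>_def abs_mult tau_abs)

lemma al: "al0 = hatA (1 + \<xi>) (- \<sigma>)" "al1 = hatA \<xi> \<sigma>" "al2 = hatA (1 - \<xi>) (- \<sigma>)" "al3 = hatA (2 - \<xi>) \<sigma>"
  "be1 = hatB \<xi> \<sigma>" "be2 = hatB (1 - \<xi>) (- \<sigma>)"
proof -
  have t: "tau (k - 1) = - tau k" "tau (k + 1) = - tau k" "tau (k + 2) = tau k" by (simp_all add: tau_def)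
  have d: "\<bar>x - of_int (k - 1)\<bar> = 1 + \<xi>" "\<bar>x - of_int k\<bar> = \<xi>" "\<bar>x - of_int (k + 1)\<bar> = 1 - \<xi>" "\<bar>x - of_int (k + 2)\<bar> = 2 - \<xi>"
    using xi by simp_all
  show "al0 = hatA (1 + \<xi>) (- \<sigma>)" "al1 = hatA \<xi> \<sigma>" "al2 = hatA (1 - \<xi>) (- \<sigma>)" "al3 = hatA (2 - \<xi>) \<sigma>"
    "be1 = hatB \<xi> \<sigma>" "be2 = hatB (1 - \<xi>) (- \<sigma>)"
    by (simp_all only: al0_def al1_def al2_def al3_def be1_def be2_def hA_def hB_def t d \<sigma>_def mult_minus_left)
qed

text \<open>In the half of the cell that contains \<open>A k\<close>, the maximum is positive
  exactly beyond the segment from \<open>A k\<close> to \<open>B (k+1)\<close>, that is, in the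
  triangle with the third vertex \<open>A (k+2)\<close>.\<close>

lemma upper:
  assumes "0 \<le> \<sigma>"
  shows "al0 = 0" "al2 = 0" "al1 = \<sigma> - max 0 (\<xi> + \<sigma> - 1) / 2" "al3 = max 0 (\<xi> + \<sigma> - 1) / 2"
    "be1 = 1 - \<sigma> - \<xi> + max 0 (\<xi> + \<sigma> - 1)" "be2 = \<xi> - max 0 (\<xi> + \<sigma> - 1)"
  unfolding al hatA_def hatB_def using assms sigma xi by (auto simp: max_def min_def field_simps)

lemma lower:
  assumes "\<sigma> \<le> 0"
  shows "al1 = 0" "al3 = 0" "al2 = - \<sigma> - max 0 (- \<sigma> - \<xi>) / 2" "al0 = max 0 (- \<sigma> - \<xi>) / 2"
    "be1 = 1 - \<xi> - max 0 (- \<sigma> - \<xi>)" "be2 = \<xi> + \<sigma> + max 0 (- \<sigma> - \<xi>)"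
  unfolding al hatA_def hatB_def using assms sigma xi by (auto simp: max_def min_def field_simps)

text \<open>Barycentric coordinates reproduce the constant 1 and both coordinates of the point;
  injectivity on a cell is a consequence.\<close>

lemma position:
  "0 \<le> al0" "0 \<le> al1" "0 \<le> al2" "0 \<le> al3" "0 \<le> be1" "0 \<le> be2"
  "al0 + al1 + al2 + al3 + be1 + be2 = 1" "- al0 + al2 + 2 * al3 + be2 = \<xi>" "al1 + al3 - al0 - al2 = \<sigma>"
proof -
  show "0 \<le> al0" "0 \<le> al1" "0 \<le> al2" "0 \<le> al3" "0 \<le> be1" "0 \<le> be2"
    by (simp_all add: al hatA_def hatB_def)
  show "al0 + al1 + al2 + al3 + be1 + be2 = 1" "- al0 + al2 + 2 * al3 + be2 = \<xi>" "al1 + al3 - al0 - al2 = \<sigma>"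
    using upper lower by (cases "0 \<le> \<sigma>"; simp)+
qed

lemma v_near: "vA (k - 1) = j" "vA k = j + 4" "vA (k + 1) = j + 1" "vA (k + 2) = j + 5" "vB (k + 1) = j + 4"
  by (simp_all add: vA_def vB_def algebra_simps)

text \<open>The hats at \<open>A p\<close> vanish from distance 2 on and those at \<open>B p\<close>
  from distance 1 on, so four vertices \<open>A\<close> and two vertices \<open>B\<close>
  contribute.\<close>

lemma w_cell:
  "wA x y $ i = (if i = j then al0 else 0) + (if i = j + 4 then al1 else 0) + (if i = j + 1 then al2 else 0) + (if i = j + 5 then al3 else 0)"
  "wB x y $ i = (if i = j then be1 else 0) + (if i = j + 4 then be2 else 0)"
proof -
  have sub: "{k-1, k, k+1, k+2} \<subseteq> {-30..30}" using k by auto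
  have "wA x y $ i = (\<Sum>p\<in>{k-1, k, k+1, k+2}. if vA p = i then hA p x y else 0)"
    unfolding wA_def vec_lambda_beta
  proof (rule sum.mono_neutral_right[OF _ sub])
    show "\<forall>p\<in>{-30..30} - {k-1, k, k+1, k+2}. (if vA p = i then hA p x y else 0) = 0"
    proof
      fix p assume "p \<in> {-30..30} - {k-1, k, k+1, k+2}"
      then have "p \<le> k - 2 \<or> k + 3 \<le> p" by auto
      then have "2 \<le> \<bar>x - of_int p\<bar>" using xi by (auto simp: abs_if)
      then show "(if vA p = i then hA p x y else 0) = 0" using hA_zero y by simp
    qed
  qed simp
  then show "wA x y $ i = (if i = j then al0 else 0) + (if i = j + 4 then al1 else 0) + (if i = j + 1 then al2 else 0) + (if i = j + 5 then al3 else 0)"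
    by (simp add: v_near al0_def al1_def al2_def al3_def eq_commute[of i])
  have sub: "{k, k+1} \<subseteq> {-30..30}" using k by auto
  have "wB x y $ i = (\<Sum>p\<in>{k, k+1}. if vB p = i then hB p x y else 0)"
    unfolding wB_def vec_lambda_beta
  proof (rule sum.mono_neutral_right[OF _ sub])
    show "\<forall>p\<in>{-30..30} - {k, k+1}. (if vB p = i then hB p x y else 0) = 0"
    proof
      fix p assume "p \<in> {-30..30} - {k, k+1}"
      then have "p \<le> k - 1 \<or> k + 2 \<le> p" by auto
      then have "1 \<le> \<bar>x - of_int p\<bar>" using xi by (auto simp: abs_if)
      then show "(if vB p = i then hB p x y else 0) = 0" using hB_zero by simp
    qed
  qed simp
  then show "wB x y $ i = (if i = j then be1 else 0) + (if i = j + 4 then be2 else 0)"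
    by (simp add: v_near be1_def be2_def eq_commute[of i])
qed

lemma w_table:
  "wA x y $ j = al0" "wA x y $ (j+1) = al2" "wA x y $ (j+2) = 0" "wA x y $ (j+3) = 0" "wA x y $ (j+4) = al1"
  "wA x y $ (j+5) = al3" "wA x y $ (j+6) = 0"
  "wB x y $ j = be1" "wB x y $ (j+1) = 0" "wB x y $ (j+2) = 0" "wB x y $ (j+3) = 0" "wB x y $ (j+4) = be2"
  "wB x y $ (j+5) = 0" "wB x y $ (j+6) = 0"
  by (simp_all add: w_cell)

end

text \<open>Translation by 7 preserves the residue \<open>4 p\<close> but changes the parity of
  \<open>p\<close>; the sign of \<open>tau\<close> compensates that of \<open>y\<close>. This is the
  twist of the strip.\<close>

lemma w_period:
  assumes "cell k \<xi> y" "k \<le> 13"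
  shows "wA (of_int k + \<xi> + 7) (- y) = wA (of_int k + \<xi>) y" "wB (of_int k + \<xi> + 7) (- y) = wB (of_int k + \<xi>) y"
proof -
  interpret z: cell k \<xi> y by fact
  interpret z': cell "k + 7" \<xi> "- y" using z.xi z.y z.k assms(2) by unfold_locales auto
  have v: "vB (k + 7) = vB k" by (simp add: vB_def algebra_simps)
  have s: "z'.\<sigma> = z.\<sigma>" by (simp add: z.\<sigma>_def z'.\<sigma>_def tau_def)
  have x: "of_int k + \<xi> + 7 = of_int (k + 7) + \<xi>" by simp
  show "wA (of_int k + \<xi> + 7) (- y) = wA (of_int k + \<xi>) y" "wB (of_int k + \<xi> + 7) (- y) = wB (of_int k + \<xi>) y"
    unfolding x vec_eq_iff z.w_cell z'.w_cell z.al z'.al s v by simp_all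
qed

text \<open>The vertices \<open>A p\<close> that touch the two cells have \<open>p\<close> among
  seven consecutive integers, which \<open>4 p\<close> distinguishes modulo 7. So equality of
  weights holds vertex by vertex, and \<open>position\<close> recovers the point.\<close>

lemma w_local_inj:
  assumes z: "cell k \<xi> y" "cell (k + d) \<xi>' y'" and d: "d \<in> {-3, -2, -1, 0, 1, 2, 3}"
    and e: "wA (of_int k + \<xi>) y = wA (of_int (k + d) + \<xi>') y'" "wB (of_int k + \<xi>) y = wB (of_int (k + d) + \<xi>') y'"
  shows "\<xi> = of_int d + \<xi>' \<and> y = y'"
proof -
  interpret z: cell k \<xi> y by fact
  interpret z': cell "k + d" \<xi>' y' by fact
  define j where "j = vB k"
  have j': "vB (k + d) = j + 4 * of_int d" by (simp add: j_def vB_def algebra_simps)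
  have sg: "z'.\<sigma> = (if even d then tau k * y' else - (tau k * y'))" by (simp add: z'.\<sigma>_def tau_def)
  note A = z.w_table[folded j_def, unfolded e]
  note p = z.position z'.position
  have "\<xi> = of_int d + \<xi>' \<and> z.\<sigma> = tau k * y'"
    using d A[unfolded z'.w_cell j'] p sg
    by (elim insertE emptyE; simp; linarith)
  moreover then have "tau k * (tau k * y) = tau k * (tau k * y')" by (simp add: z.\<sigma>_def)
  then have "y = y'" using tau_abs(2)[of k] by (simp add: mult.assoc[symmetric])
  ultimately show ?thesis by simp
qed

lemma strip_cell_ex:
  fixes x :: real
  assumes "0 \<le> x" "x \<le> 7"
  shows "\<exists>k::int. \<exists>\<xi>. x = of_int k + \<xi> \<and> 0 \<le> \<xi> \<and> \<xi> \<le> 1 \<and> 0 \<le> k \<and> k \<le> 6"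
proof -
  define k where "k = min \<lfloor>x\<rfloor> 6"
  have "0 \<le> \<lfloor>x\<rfloor>" using assms by simp
  moreover have "of_int \<lfloor>x\<rfloor> \<le> x" "x - of_int \<lfloor>x\<rfloor> \<le> 1" by linarith+
  ultimately show ?thesis using assms
    by (intro exI[of _ k] exI[of _ "x - of_int k"]) (auto simp: k_def min_def not_le)
qed

text \<open>Cells at most 3 apart are compared directly. Otherwise translation by -7 brings the
  later point within 3 cells of the earlier one, and equality leaves only the two ends of the
  strip.\<close>

lemma w_global_inj:
  assumes x: "0 \<le> x" "x \<le> 7" "\<bar>y\<bar> \<le> 1" and x': "0 \<le> x'" "x' \<le> 7" "\<bar>y'\<bar> \<le> 1"
    and e: "wA x y = wA x' y'" "wB x y = wB x' y'"
  shows "(x = x' \<and> y = y') \<or> (y' = - y \<and> (x = 0 \<and> x' = 7 \<or> x = 7 \<and> x' = 0))"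
proof -
  have far: "x = 0 \<and> x' = 7 \<and> y' = - y"
    if X: "x = of_int k + \<xi>" "0 \<le> \<xi>" "\<xi> \<le> 1" "0 \<le> k" and y: "\<bar>y\<bar> \<le> 1"
      and X': "x' = of_int k' + \<xi>'" "0 \<le> \<xi>'" "\<xi>' \<le> 1" "k' \<le> 6" "x' \<le> 7" and y': "\<bar>y'\<bar> \<le> 1"
      and e: "wA x y = wA x' y'" "wB x y = wB x' y'" and d: "4 \<le> k' - k" for x x' y y' \<xi> \<xi>' and k k' :: int
  proof -
    have c: "cell k \<xi> y" "cell (k' - 7) \<xi>' (- y')" using X X' y y' d by (auto simp: cell_def)
    have "x' = of_int (k' - 7) + \<xi>' + 7" using X' by simp
    then have p: "wA x' y' = wA (of_int (k' - 7) + \<xi>') (- y')" "wB x' y' = wB (of_int (k' - 7) + \<xi>') (- y')"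
      using w_period[OF c(2)] X'(4) by simp_all
    have "k' - k \<in> {4, 5, 6}" using d X'(4) X(4) by auto
    then have "k' - 7 - k \<in> {-3, -2, -1, 0, 1, 2, 3}" by auto
    moreover have "k' - 7 = k + (k' - 7 - k)" by simp
    ultimately have "\<xi> = of_int (k' - 7 - k) + \<xi>' \<and> y = - y'"
      using w_local_inj[of k \<xi> y "k' - 7 - k" \<xi>' "- y'"] c e unfolding X(1) p by simp
    then show ?thesis using X X' by auto
  qed
  obtain k \<xi> where X: "x = of_int k + \<xi>" "0 \<le> \<xi>" "\<xi> \<le> 1" "0 \<le> k" "k \<le> 6" using strip_cell_ex[OF x(1,2)] by blast
  obtain k' \<xi>' where X': "x' = of_int k' + \<xi>'" "0 \<le> \<xi>'" "\<xi>' \<le> 1" "0 \<le> k'" "k' \<le> 6" using strip_cell_ex[OF x'(1,2)] by blast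
  consider "4 \<le> k' - k" | "4 \<le> k - k'" | "k' - k \<in> {-3, -2, -1, 0, 1, 2, 3}" by fastforce
  then show ?thesis
  proof cases
    case 1
    then show ?thesis using far[OF X(1-4) x(3) X'(1-3,5) x'(2,3) e] by simp
  next
    case 2
    then show ?thesis using far[OF X'(1-4) x'(3) X(1-3,5) x(2,3) e[symmetric]] by simp
  next
    case 3
    have c: "cell k \<xi> y" "cell (k + (k' - k)) \<xi>' y'" using X X' x x' by (auto simp: cell_def)
    have "\<xi> = of_int (k' - k) + \<xi>' \<and> y = y'"
      by (rule w_local_inj[OF c 3]) (use e X X' in simp_all)
    then show ?thesis using X X' by simp
  qed
qed

lemma w_ends: "\<bar>y\<bar> \<le> 1 \<Longrightarrow> wA 7 (- y) = wA 0 y \<and> wB 7 (- y) = wB 0 y"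
  using w_period[of 0 0 y] by (simp add: cell_def)

lemma continuous_on_hats:
  "continuous_on S (\<lambda>z. hA p (fst z) (snd z))" "continuous_on S (\<lambda>z. hB p (fst z) (snd z))"
  unfolding hA_def hB_def hatA_def hatB_def by (auto intro!: continuous_intros)

lemma continuous_on_weights:
  "continuous_on S (\<lambda>z. wA (fst z) (snd z) $ i)" "continuous_on S (\<lambda>z. wB (fst z) (snd z) $ i)"
proof -
  have "continuous_on S (\<lambda>z. if Q then hA p (fst z) (snd z) else 0)" "continuous_on S (\<lambda>z. if Q then hB p (fst z) (snd z) else 0)" for p Q
    by (cases Q; simp add: continuous_on_hats)+
  then show "continuous_on S (\<lambda>z. wA (fst z) (snd z) $ i)" "continuous_on S (\<lambda>z. wB (fst z) (snd z) $ i)"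
    unfolding wA_def wB_def vec_lambda_beta by (intro continuous_on_sum; blast)+
qed

definition drop7 :: "7 \<Rightarrow> real^7 \<Rightarrow> real^7" where "drop7 j B = (\<chi> i. if i = j then 0 else B $ i)"

lemma vB_surj: "\<exists>k. 0 \<le> k \<and> k \<le> 6 \<and> vB k = j"
proof -
  have "vB 0 = 0" "vB 2 = 1" "vB 4 = 2" "vB 6 = 3" "vB 1 = 4" "vB 3 = 5" "vB 5 = 6" by (simp_all add: vB_def)
  then show ?thesis
    by (cases j "0::7" rule: cases7) (rule exI[of _ 0], simp, rule exI[of _ 2], simp, rule exI[of _ 4], simp,
      rule exI[of _ 6], simp, rule exI[of _ 1], simp, rule exI[of _ 3], simp, rule exI[of _ 5], simp)
qed

lemma drop7_nth: "drop7 q B $ i = (if i = q then 0 else B $ i)"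
  by (simp add: drop7_def)

context alternating
begin

lemma comb_drop: "comb A B = B $ j *\<^sub>R U j + comb A (drop7 j B)"
proof -
  have "(\<Sum>i\<in>UNIV. B $ i *\<^sub>R U i) = B $ j *\<^sub>R U j + (\<Sum>i\<in>UNIV. drop7 j B $ i *\<^sub>R U i)"
    unfolding sum7_shift[of _ j] by (simp add: drop7_def)
  then show ?thesis by (simp add: comb_def)
qed

definition band :: "(real^5) set" where
  "band = {x \<in> R. \<exists>j. {j, j+2} \<subseteq> Z x \<or> {j, j+3} \<subseteq> Z x}"

text \<open>The point lies on a triangle, or on a quadrilateral and in one of its halves: a quadrilateral is the cone
  with apex \<open>U (j+4)\<close> over two of its edges.\<close>

definition shapeM :: "real^7 \<Rightarrow> real^7 \<Rightarrow> bool" where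
  "shapeM A B \<longleftrightarrow> nonneg A \<and> nonneg B \<and> (\<Sum>i\<in>UNIV. A $ i) + (\<Sum>i\<in>UNIV. B $ i) = 1 \<and>
    ((\<exists>i. {i, i+2} \<subseteq> Z (comb A B)) \<or>
     (\<exists>j. {j+1, j+4} \<subseteq> Z (comb A B) \<and>
       ({j+1, j+3} \<subseteq> Z (comb A (drop7 (j+4) B)) \<or> {j+2, j+4} \<subseteq> Z (comb A (drop7 (j+4) B)))))"

lemma drop7_nonneg: "nonneg B \<Longrightarrow> nonneg (drop7 j B)"
  by (simp add: nonneg_def drop7_def)

text \<open>Four triangles of the cover meet a cell; the sign of \<sigma> and the argument of the
  maximum select one. Two of them are halves of quadrilaterals, with apex \<open>U j\<close> for the
  upper and \<open>U (j+4)\<close> for the lower one.\<close>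

lemma cell_shape:
  assumes "cell k \<xi> y"
  shows "shapeM (wA (of_int k + \<xi>) y) (wB (of_int k + \<xi>) y)"
proof -
  interpret z: cell k \<xi> y by fact
  define j where "j = vB k"
  define A B where "A = wA (of_int k + \<xi>) y" and "B = wB (of_int k + \<xi>) y"
  note w = z.w_table[folded j_def A_def B_def]
  have nA: "nonneg A" unfolding nonneg_def all7_shift[of _ j] w using z.position by simp
  have nB: "nonneg B" unfolding nonneg_def all7_shift[of _ j] w using z.position by simp
  have s: "(\<Sum>i\<in>UNIV. A $ i) + (\<Sum>i\<in>UNIV. B $ i) = 1"
    unfolding sum7_shift[of _ j] w using z.position by simp
  have ZT: "i \<in> Z (comb A B) \<longleftrightarrow> (\<forall>t. A $ t = 0 \<or> i \<in> zV t) \<and> (\<forall>t. B $ t = 0 \<or> i \<in> zU t)" for i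
    unfolding Z_def using f_comb_zero[OF nA nB] by simp
  have ZD: "i \<in> Z (comb A (drop7 q B)) \<longleftrightarrow> (\<forall>t. A $ t = 0 \<or> i \<in> zV t) \<and> (\<forall>t. drop7 q B $ t = 0 \<or> i \<in> zU t)" for i q
    unfolding Z_def using f_comb_zero[OF nA drop7_nonneg[OF nB]] by simp
  note ev = ZT ZD all7_shift[of _ j] w drop7_nth zV_def zU_def
  have "(\<exists>i. {i, i+2} \<subseteq> Z (comb A B)) \<or>
     (\<exists>j. {j+1, j+4} \<subseteq> Z (comb A B) \<and>
       ({j+1, j+3} \<subseteq> Z (comb A (drop7 (j+4) B)) \<or> {j+2, j+4} \<subseteq> Z (comb A (drop7 (j+4) B))))"
  proof (cases "0 \<le> z.\<sigma>")
    case True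
    note u = z.upper[OF True]
    show ?thesis
    proof (cases "\<xi> + z.\<sigma> - 1 \<le> 0")
      case m: True
      have "{(j+3)+1, (j+3)+4} \<subseteq> Z (comb A B) \<and> {(j+3)+2, (j+3)+4} \<subseteq> Z (comb A (drop7 ((j+3)+4) B))"
        using u m by (simp add: ev)
      then show ?thesis by blast
    next
      case False
      have "{j+5, (j+5)+2} \<subseteq> Z (comb A B)" using u False by (simp add: ev)
      then show ?thesis by blast
    qed
  next
    case False
    then have "z.\<sigma> \<le> 0" by simp
    note u = z.lower[OF this]
    show ?thesis
    proof (cases "- z.\<sigma> - \<xi> \<le> 0")
      case m: True
      have "{j+1, j+4} \<subseteq> Z (comb A B) \<and> {j+1, j+3} \<subseteq> Z (comb A (drop7 (j+4) B))"
        using u m by (simp add: ev)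
      then show ?thesis by blast
    next
      case False
      have "{j+1, (j+1)+2} \<subseteq> Z (comb A B)" using u False by (simp add: ev)
      then show ?thesis by blast
    qed
  qed
  then show ?thesis using nA nB s unfolding shapeM_def A_def B_def by simp
qed

text \<open>A point common to two different quadrilaterals lies on a triangle or on an edge with
  ends of type \<open>U\<close>, hence on a simplex, where weights are unique.\<close>

lemma two_quads:
  assumes "i \<noteq> j"
  shows "\<exists>J. simplicial J \<and> J \<subseteq> {i+1, i+4, j+1, j+4}"
proof -
  have "\<exists>q. {q, q+2} \<subseteq> {i+1, i+4, j+1, j+4} \<or> {q, q+1, q+4} \<subseteq> {i+1, i+4, j+1, j+4}"
  proof (cases j i rule: cases7)
    case 2 then show ?thesis by (intro exI[of _ "i+2"]) simp
  next
    case 3 then show ?thesis by (intro exI[of _ "i+1"]) simp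
  next
    case 4 then show ?thesis by (intro exI[of _ "i"]) simp
  next
    case 5 then show ?thesis by (intro exI[of _ "i+4"]) simp
  next
    case 6 then show ?thesis by (intro exI[of _ "i+4"]) simp
  next
    case 7 then show ?thesis by (intro exI[of _ "i+1"]) simp
  qed (use assms in simp)
  then show ?thesis using simplicial2 simplicial3 by blast
qed

text \<open>On a simplex \<open>comb_unique\<close> applies. Otherwise both combinations belong to
  the same quadrilateral by \<open>two_quads\<close>; then \<open>fan_unique\<close> separates the
  weight of the apex \<open>U (j+4)\<close>, and the remainder lies on a triangle.\<close>

lemma shapeM_inj:
  assumes S: "shapeM A B" "shapeM A' B'" and e: "comb A B = comb A' B'"
  shows "A = A' \<and> B = B'"
proof -
  have n: "nonneg A" "nonneg B" "nonneg A'" "nonneg B'" using S by (simp_all add: shapeM_def)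
  show ?thesis
  proof (cases "\<exists>J. simplicial J \<and> J \<subseteq> Z (comb A B)")
    case True
    then show ?thesis using comb_unique[OF n e] by blast
  next
    case False
    then have no: "\<not> {i, i+2} \<subseteq> Z (comb A B)" for i using simplicial2 by blast
    then obtain j where j: "{j+1, j+4} \<subseteq> Z (comb A B)"
      "{j+1, j+3} \<subseteq> Z (comb A (drop7 (j+4) B)) \<or> {j+2, j+4} \<subseteq> Z (comb A (drop7 (j+4) B))"
      using S(1) unfolding shapeM_def by blast
    obtain j' where j': "{j'+1, j'+4} \<subseteq> Z (comb A' B')"
      "{j'+1, j'+3} \<subseteq> Z (comb A' (drop7 (j'+4) B')) \<or> {j'+2, j'+4} \<subseteq> Z (comb A' (drop7 (j'+4) B'))"
      using S(2) no unfolding shapeM_def e by blast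
    have "j' = j"
    proof (rule ccontr)
      assume "j' \<noteq> j"
      then obtain J where "simplicial J" "J \<subseteq> {j+1, j+4, j'+1, j'+4}" using two_quads[of j j'] by auto
      moreover have "{j+1, j+4, j'+1, j'+4} \<subseteq> Z (comb A B)" using j(1) j'(1) e by simp
      ultimately show False using False by blast
    qed
    define Y where "Y = comb A (drop7 (j+4) B)"
    define Y' where "Y' = comb A' (drop7 (j+4) B')"
    have nd: "nonneg (drop7 (j+4) B)" "nonneg (drop7 (j+4) B')" using n drop7_nonneg by simp_all
    obtain m where m: "m \<in> Z Y" "m \<notin> zU (j+4)" "\<exists>i. {i, i+2} \<subseteq> Z Y"
    proof -
      from j(2) show ?thesis
      proof
        assume "{j+1, j+3} \<subseteq> Z (comb A (drop7 (j+4) B))"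
        then have "{j+1, (j+1)+2} \<subseteq> Z Y" "j+3 \<in> Z Y" by (simp_all add: Y_def)
        moreover have "j+3 \<notin> zU (j+4)" by (simp add: zU_def)
        ultimately show ?thesis using that by blast
      next
        assume "{j+2, j+4} \<subseteq> Z (comb A (drop7 (j+4) B))"
        then have "{j+2, (j+2)+2} \<subseteq> Z Y" "j+2 \<in> Z Y" by (simp_all add: Y_def)
        moreover have "j+2 \<notin> zU (j+4)" by (simp add: zU_def)
        ultimately show ?thesis using that by blast
      qed
    qed
    obtain m' where m': "m' \<in> Z Y'" "m' \<notin> zU (j+4)"
    proof -
      have "j+3 \<notin> zU (j+4)" "j+2 \<notin> zU (j+4)" by (simp_all add: zU_def)
      then show ?thesis using j'(2) that unfolding \<open>j' = j\<close> Y'_def[symmetric] by auto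
    qed
    have "B $ (j+4) = B' $ (j+4) \<and> Y = Y'"
    proof (rule fan_unique)
      show "0 \<le> f i Y" "0 \<le> f i Y'" for i
        unfolding Y_def Y'_def using f_comb_nonneg n nd by simp_all
      show "f m Y = 0" "f m' Y' = 0" using m m' by (simp_all add: Z_def)
      show "0 < f m (U (j+4))" "0 < f m' (U (j+4))" using m m' f_U(2) by simp_all
      show "B $ (j+4) *\<^sub>R U (j+4) + Y = B' $ (j+4) *\<^sub>R U (j+4) + Y'"
        using e comb_drop[of A B "j+4"] comb_drop[of A' B' "j+4"] by (simp add: Y_def Y'_def)
    qed
    moreover then have "A = A' \<and> drop7 (j+4) B = drop7 (j+4) B'"
    proof -
      obtain i where i: "{i, i+2} \<subseteq> Z Y" using m(3) by blast
      show ?thesis if "B $ (j+4) = B' $ (j+4) \<and> Y = Y'"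
        by (rule comb_unique[OF n(1) nd(1) n(3) nd(2) _ _ simplicial2[of i]]) (use that i in \<open>simp_all add: Y_def Y'_def\<close>)
    qed
    ultimately have AB: "A = A'" "drop7 (j+4) B = drop7 (j+4) B'" "B $ (j+4) = B' $ (j+4)" by simp_all
    have "B $ i = B' $ i" for i
      using AB(3) arg_cong[OF AB(2), of "\<lambda>b. b $ i"] by (cases "i = j+4") (simp_all add: drop7_def)
    then show ?thesis using AB(1) by (simp add: vec_eq_iff)
  qed
qed

definition mob :: "real \<times> real \<Rightarrow> real^5" where "mob z = comb (wA (fst z) (snd z)) (wB (fst z) (snd z))"

definition rect :: "(real \<times> real) set" where "rect = {0..7} \<times> {-1..1}"

lemma rect_cell:
  assumes "z \<in> rect"
  shows "\<exists>k \<xi>. cell k \<xi> (snd z) \<and> fst z = of_int k + \<xi>"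
proof -
  have z: "0 \<le> fst z" "fst z \<le> 7" "\<bar>snd z\<bar> \<le> 1" using assms by (auto simp: rect_def)
  obtain k :: int and \<xi> where "fst z = of_int k + \<xi>" "0 \<le> \<xi>" "\<xi> \<le> 1" "0 \<le> k" "k \<le> 6"
    using strip_cell_ex[OF z(1,2)] by blast
  then show ?thesis using z(3) by (intro exI[of _ k] exI[of _ \<xi>]) (simp add: cell_def)
qed

lemma rect_shape: "z \<in> rect \<Longrightarrow> shapeM (wA (fst z) (snd z)) (wB (fst z) (snd z))"
  using rect_cell cell_shape by metis

lemma mob_eq_iff:
  assumes "z \<in> rect" "z' \<in> rect"
  shows "mob z = mob z' \<longleftrightarrow> z = z' \<or> ({fst z, fst z'} = {0, 7} \<and> snd z' = - snd z)"
proof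
  assume "mob z = mob z'"
  then have "wA (fst z) (snd z) = wA (fst z') (snd z') \<and> wB (fst z) (snd z) = wB (fst z') (snd z')"
    unfolding mob_def by (intro shapeM_inj rect_shape assms)
  then have "(fst z = fst z' \<and> snd z = snd z') \<or> (snd z' = - snd z \<and> (fst z = 0 \<and> fst z' = 7 \<or> fst z = 7 \<and> fst z' = 0))"
    using assms by (intro w_global_inj) (auto simp: rect_def)
  then show "z = z' \<or> ({fst z, fst z'} = {0, 7} \<and> snd z' = - snd z)" by (auto simp: prod_eq_iff)
next
  assume "z = z' \<or> ({fst z, fst z'} = {0, 7} \<and> snd z' = - snd z)"
  then show "mob z = mob z'"
  proof
    assume r: "{fst z, fst z'} = {0, 7} \<and> snd z' = - snd z"
    then have c: "fst z = 0 \<and> fst z' = 7 \<or> fst z = 7 \<and> fst z' = 0" by (auto simp: doubleton_eq_iff)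
    have "\<bar>snd z\<bar> \<le> 1" using assms by (auto simp: rect_def)
    then have "wA 7 (- snd z) = wA 0 (snd z) \<and> wB 7 (- snd z) = wB 0 (snd z)"
      "wA 7 (snd z) = wA 0 (- snd z) \<and> wB 7 (snd z) = wB 0 (- snd z)"
      using w_ends[of "snd z"] w_ends[of "- snd z"] by simp_all
    then show ?thesis using c r by (auto simp: mob_def)
  qed simp
qed

lemma mob_in_band:
  assumes "z \<in> rect"
  shows "mob z \<in> band"
proof -
  have S: "shapeM (wA (fst z) (snd z)) (wB (fst z) (snd z))" using rect_shape[OF assms] .
  then have "mob z \<in> R" unfolding mob_def by (intro comb_in_R) (simp_all add: shapeM_def)
  moreover have "\<exists>j. {j, j+2} \<subseteq> Z (mob z) \<or> {j, j+3} \<subseteq> Z (mob z)"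
  proof -
    have "(\<exists>i. {i, i+2} \<subseteq> Z (mob z)) \<or> (\<exists>j. {j+1, (j+1)+3} \<subseteq> Z (mob z))"
      using S unfolding shapeM_def mob_def by auto
    then show ?thesis by blast
  qed
  ultimately show ?thesis by (simp add: band_def)
qed

text \<open>The weights of \<open>upper\<close> in a cell whose left vertex \<open>B\<close> has the
  residue \<open>j\<close>. Retaining the height \<eta> in the conclusion makes the formula serve
  the boundary too, with \<eta> equal to 1.\<close>

lemma mob_upper:
  assumes "0 \<le> \<xi>" "\<xi> \<le> 1" "0 \<le> \<eta>" "\<eta> \<le> 1"
  defines "m \<equiv> max 0 (\<xi> + \<eta> - 1)"
  shows "(\<eta> - m/2) *\<^sub>R V (j+4) + (m/2) *\<^sub>R V (j+5) + (1 - \<eta> - \<xi> + m) *\<^sub>R U j + (\<xi> - m) *\<^sub>R U (j+4) \<in> mob ` {z \<in> rect. \<bar>snd z\<bar> = \<eta>}"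
proof -
  obtain k where k: "0 \<le> k" "k \<le> 6" "vB k = j" using vB_surj by blast
  define y where "y = tau k * \<eta>"
  have yn: "\<bar>y\<bar> = \<eta>" using assms by (simp add: y_def abs_mult tau_abs)
  then have y: "\<bar>y\<bar> \<le> 1" using assms by simp
  interpret z: cell k \<xi> y using assms k y by unfold_locales auto
  have s: "z.\<sigma> = \<eta>" unfolding z.\<sigma>_def by (simp add: y_def mult.assoc[symmetric] tau_abs)
  note u = z.upper[unfolded s, OF assms(3), folded m_def]
  note w = z.w_table[unfolded k(3)]
  have "mob (of_int k + \<xi>, y) = (\<eta> - m/2) *\<^sub>R V (j+4) + (m/2) *\<^sub>R V (j+5) + (1 - \<eta> - \<xi> + m) *\<^sub>R U j + (\<xi> - m) *\<^sub>R U (j+4)"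
    unfolding mob_def comb_def fst_conv snd_conv sum7_shift[of _ j] w u by simp
  moreover have "(of_int k + \<xi>, y) \<in> rect" using k assms y by (auto simp: rect_def abs_le_iff)
  ultimately show ?thesis using yn by (intro image_eqI[where x = "(of_int k + \<xi>, y)"]) simp_all
qed

lemma mob_lower:
  assumes "0 \<le> \<xi>" "\<xi> \<le> 1" "0 \<le> \<eta>" "\<eta> \<le> 1"
  defines "m \<equiv> max 0 (\<eta> - \<xi>)"
  shows "(\<eta> - m/2) *\<^sub>R V (j+1) + (m/2) *\<^sub>R V j + (1 - \<xi> - m) *\<^sub>R U j + (\<xi> - \<eta> + m) *\<^sub>R U (j+4) \<in> mob ` {z \<in> rect. \<bar>snd z\<bar> = \<eta>}"
proof -
  obtain k where k: "0 \<le> k" "k \<le> 6" "vB k = j" using vB_surj by blast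
  define y where "y = - (tau k * \<eta>)"
  have yn: "\<bar>y\<bar> = \<eta>" using assms by (simp add: y_def abs_mult tau_abs)
  then have y: "\<bar>y\<bar> \<le> 1" using assms by simp
  interpret z: cell k \<xi> y using assms k y by unfold_locales auto
  have s: "z.\<sigma> = - \<eta>" unfolding z.\<sigma>_def by (simp add: y_def mult.assoc[symmetric] tau_abs)
  have "z.\<sigma> \<le> 0" using s assms(3) by simp
  note u = z.lower[OF this, unfolded s minus_minus, folded m_def]
  note w = z.w_table[unfolded k(3)]
  have "mob (of_int k + \<xi>, y) = (\<eta> - m/2) *\<^sub>R V (j+1) + (m/2) *\<^sub>R V j + (1 - \<xi> - m) *\<^sub>R U j + (\<xi> - \<eta> + m) *\<^sub>R U (j+4)"
    unfolding mob_def comb_def fst_conv snd_conv sum7_shift[of _ j] w u by simp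
  moreover have "(of_int k + \<xi>, y) \<in> rect" using k assms y by (auto simp: rect_def abs_le_iff)
  ultimately show ?thesis using yn by (intro image_eqI[where x = "(of_int k + \<xi>, y)"]) simp_all
qed

lemmas mob_upper_rect = subsetD[OF image_mono[OF Collect_restrict] mob_upper]
lemmas mob_lower_rect = subsetD[OF image_mono[OF Collect_restrict] mob_lower]

lemma band_subset: "band \<subseteq> mob ` rect"
proof
  fix x assume "x \<in> band"
  then have xR: "x \<in> R" and c: "(\<exists>j. {j, j+2} \<subseteq> Z x) \<or> (\<exists>j. {j, j+3} \<subseteq> Z x)" by (auto simp: band_def)
  from c show "x \<in> mob ` rect"
  proof
    assume "\<exists>j. {j, j+2} \<subseteq> Z x"
    then obtain j' where "{j', j'+2} \<subseteq> Z x" by blast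
    moreover define j where "j = j' + 6"
    ultimately have "x \<in> FC {j+1, j+3}" using xR by (simp add: FC_iff)
    moreover have "{k. {j+1, j+3} \<subseteq> zV k} = {j, j+1}"
    proof (rule set_eqI)
      show "k \<in> {k. {j+1, j+3} \<subseteq> zV k} \<longleftrightarrow> k \<in> {j, j+1}" for k by (cases k j rule: cases7; simp add: zV_def)
    qed
    moreover have "{k. {j+1, j+3} \<subseteq> zU k} = {j}"
    proof (rule set_eqI)
      show "k \<in> {k. {j+1, j+3} \<subseteq> zU k} \<longleftrightarrow> k \<in> {j}" for k by (cases k j rule: cases7; simp add: zU_def)
    qed
    moreover have "V ` {j, j+1} \<union> U ` {j} = {V j, V (j+1), U j}" by auto
    ultimately obtain p q r where pqr: "0 \<le> p" "0 \<le> q" "0 \<le> r" "p + q + r = 1" "x = p *\<^sub>R V j + q *\<^sub>R V (j+1) + r *\<^sub>R U j"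
      using FC_triangle by metis
    \<comment> \<open>The triangle spans two cells of the cover, separated by the line
      \<open>p = q\<close> through the vertex of type \<open>B\<close>. The arguments below are the
      horizontal offset and the height of the point with weights \<open>p\<close>, \<open>q\<close>,
      \<open>r\<close>.\<close>
    show ?thesis
    proof (cases "q \<le> p")
      case True
      have m: "max 0 ((r + 2 * q) + (p + q) - 1) = 2 * q" using pqr by (simp add: max_def)
      have "(p + q - 2*q/2) *\<^sub>R V ((j+3)+4) + (2*q/2) *\<^sub>R V ((j+3)+5) + (1 - (p+q) - (r+2*q) + 2*q) *\<^sub>R U (j+3) + (r + 2*q - 2*q) *\<^sub>R U ((j+3)+4) \<in> mob ` rect"
        using mob_upper_rect[of "r + 2*q" "p + q" "j+3", unfolded m] pqr True by simp
      moreover have "1 - (p+q) - (r+2*q) + 2*q = 0" using pqr(4) by simp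
      ultimately show ?thesis unfolding pqr(5) by simp
    next
      case False
      have m: "max 0 ((p + q) - (q - p)) = 2 * p" using pqr by (simp add: max_def)
      have "(p + q - 2*p/2) *\<^sub>R V (j+1) + (2*p/2) *\<^sub>R V j + (1 - (q-p) - 2*p) *\<^sub>R U j + (q - p - (p+q) + 2*p) *\<^sub>R U (j+4) \<in> mob ` rect"
        using mob_lower_rect[of "q - p" "p + q" j, unfolded m] pqr False by simp
      moreover have "1 - (q-p) - 2*p = r" using pqr(4) by simp
      ultimately show ?thesis unfolding pqr(5) by (simp add: add.commute)
    qed
  next
    assume "\<exists>j. {j, j+3} \<subseteq> Z x"
    then obtain j' where "{j', j'+3} \<subseteq> Z x" by blast
    moreover define j where "j = j' + 6"
    ultimately have zx: "{j+1, j+4} \<subseteq> Z x" by simp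
    \<comment> \<open>The quadrilateral is swept by segments from the apex \<open>U (j+4)\<close> to
      the two edges that avoid it.\<close>
    obtain t y where t: "0 \<le> t" "t \<le> 1" "x = (1 - t) *\<^sub>R U (j+4) + t *\<^sub>R y" "y \<in> FC {j+1, j+4, j+2} \<or> y \<in> FC {j+1, j+4, j+3}"
    proof (cases "x = U (j+4)")
      case True
      have "V (j+1) \<in> FC {j+1, j+4, j+2}" by (simp add: FC_iff V_in_R Z_V zV_def)
      then show ?thesis using that[of 0 "V (j+1)"] True by simp
    next
      case False
      then obtain t y m where y: "0 < t" "t \<le> 1" "y \<in> R" "x = (1 - t) *\<^sub>R U (j+4) + t *\<^sub>R y"
        "Z x \<inter> Z (U (j+4)) \<subseteq> Z y" "m \<in> Z y" "m \<notin> Z (U (j+4))"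
        using exit_point[OF U_in_R xR] by blast
      have "{j+1, j+4} \<subseteq> Z (U (j+4))" by (simp add: Z_U zU_def)
      then have zy: "{j+1, j+4} \<subseteq> Z y" using zx y(5) by blast
      \<comment> \<open>Here \<open>(j+4)+4\<close> is \<open>j+1\<close>, so a zero at
        \<open>j+6\<close> would complete a forbidden triple.\<close>
      have "\<not> {j+4, (j+4)+2, (j+4)+4} \<subseteq> Z y" using good_Z[OF y(3), unfolded good_def, rule_format, of "j+4"] by simp
      then have "m \<noteq> j+6" using zy y(6) by auto
      then have "m = j+2 \<or> m = j+3" using y(7) unfolding Z_U by (cases m j rule: cases7) (simp_all add: zU_def)
      then have "y \<in> FC {j+1, j+4, j+2} \<or> y \<in> FC {j+1, j+4, j+3}" using zy y(3,6) by (auto simp: FC_iff)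
      then show ?thesis using that[of t y] y by simp
    qed
    from t(4) show ?thesis
    proof
      assume y: "y \<in> FC {j+1, j+4, j+2}"
      have sV: "{k. {j+1, j+4, j+2} \<subseteq> zV k} = {j+1}"
      proof (rule set_eqI)
        show "k \<in> {k. {j+1, j+4, j+2} \<subseteq> zV k} \<longleftrightarrow> k \<in> {j+1}" for k by (cases k j rule: cases7; simp add: zV_def)
      qed
      have sU: "{k. {j+1, j+4, j+2} \<subseteq> zU k} = {j+1}"
      proof (rule set_eqI)
        show "k \<in> {k. {j+1, j+4, j+2} \<subseteq> zU k} \<longleftrightarrow> k \<in> {j+1}" for k by (cases k j rule: cases7; simp add: zU_def)
      qed
      have "V ` {j+1} \<union> U ` {j+1} = {V (j+1), U (j+1)}" by auto
      from FC_edge[OF sV sU this y] obtain p q where pq: "0 \<le> p" "0 \<le> q" "p + q = 1" "y = p *\<^sub>R V (j+1) + q *\<^sub>R U (j+1)" by blast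
      have tt: "t * p + t * q = t" using pq(3) by (metis distrib_left mult.right_neutral)
      have b: "0 \<le> t * p" "0 \<le> t * q" using t pq by simp_all
      have m: "max 0 (t * q + t * p - 1) = 0" using tt t by (simp add: max_def)
      have M: "(t*p - 0/2) *\<^sub>R V ((j+4)+4) + (0/2) *\<^sub>R V ((j+4)+5) + (1 - t*p - t*q + 0) *\<^sub>R U (j+4) + (t*q - 0) *\<^sub>R U ((j+4)+4) \<in> mob ` rect"
        using mob_upper_rect[of "t*q" "t*p" "j+4", unfolded m] b tt t by simp
      have e: "1 - t*p - t*q + 0 = 1 - t" using tt by simp
      show ?thesis using M unfolding t(3) pq(4) e by (simp add: scaleR_add_right ac_simps)
    next
      assume y: "y \<in> FC {j+1, j+4, j+3}"
      have sV: "{k. {j+1, j+4, j+3} \<subseteq> zV k} = {j+1}"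
      proof (rule set_eqI)
        show "k \<in> {k. {j+1, j+4, j+3} \<subseteq> zV k} \<longleftrightarrow> k \<in> {j+1}" for k by (cases k j rule: cases7; simp add: zV_def)
      qed
      have sU: "{k. {j+1, j+4, j+3} \<subseteq> zU k} = {j}"
      proof (rule set_eqI)
        show "k \<in> {k. {j+1, j+4, j+3} \<subseteq> zU k} \<longleftrightarrow> k \<in> {j}" for k by (cases k j rule: cases7; simp add: zU_def)
      qed
      have "V ` {j+1} \<union> U ` {j} = {V (j+1), U j}" by auto
      from FC_edge[OF sV sU this y] obtain p q where pq: "0 \<le> p" "0 \<le> q" "p + q = 1" "y = p *\<^sub>R V (j+1) + q *\<^sub>R U j" by blast
      have tt: "t * p + t * q = t" using pq(3) by (metis distrib_left mult.right_neutral)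
      have b: "0 \<le> t * p" "0 \<le> t * q" using t pq by simp_all
      have m: "max 0 (t * p - (1 - t * q)) = 0" using tt t by (simp add: max_def)
      have M: "(t*p - 0/2) *\<^sub>R V (j+1) + (0/2) *\<^sub>R V j + (1 - (1 - t*q) - 0) *\<^sub>R U j + ((1 - t*q) - t*p + 0) *\<^sub>R U (j+4) \<in> mob ` rect"
        using mob_lower_rect[of "1 - t*q" "t*p" j, unfolded m] b tt t by simp
      have e: "(1 - t*q) - t*p + 0 = 1 - t" "1 - (1 - t*q) - 0 = t*q" using tt by simp_all
      show ?thesis using M unfolding t(3) pq(4) e by (simp add: scaleR_add_right ac_simps)
    qed
  qed
qed

lemma mob_image: "mob ` rect = band"
  using mob_in_band band_subset by blast

lemma cont_mob: "continuous_on S mob"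
  unfolding mob_def comb_def
  by (intro continuous_on_add continuous_on_sum continuous_on_scaleR continuous_on_const continuous_on_weights)

lemma cell_boundary:
  assumes "cell k \<xi> y" "\<bar>y\<bar> = 1"
  shows "mob (of_int k + \<xi>, y) \<in> Cset"
proof -
  interpret z: cell k \<xi> y by fact
  define j where "j = vB k"
  define A B where "A = wA (of_int k + \<xi>) y" and "B = wB (of_int k + \<xi>) y"
  note w = z.w_table[folded j_def A_def B_def]
  have S: "shapeM A B" unfolding A_def B_def using cell_shape[OF assms(1)] .
  then have n: "nonneg A" "nonneg B" by (simp_all add: shapeM_def)
  have AB: "mob (of_int k + \<xi>, y) = comb A B" by (simp add: mob_def A_def B_def)
  have "mob (of_int k + \<xi>, y) \<in> R" unfolding AB using S by (intro comb_in_R) (simp_all add: shapeM_def)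
  moreover have ZT: "i \<in> Z (comb A B) \<longleftrightarrow> (\<forall>t. A $ t = 0 \<or> i \<in> zV t) \<and> (\<forall>t. B $ t = 0 \<or> i \<in> zU t)" for i
    unfolding Z_def using f_comb_zero[OF n] by simp
  note ev = ZT all7_shift[of _ j] w zV_def zU_def
  have "z.\<sigma> = 1 \<or> z.\<sigma> = -1" using assms(2) by (auto simp: z.\<sigma>_def tau_def abs_if split: if_splits)
  then have "\<exists>i. {i, i+1, i+2} \<subseteq> Z (comb A B)"
  proof
    assume s: "z.\<sigma> = 1"
    have u: "z.al0 = 0" "z.al2 = 0" "z.be1 = 0" "z.be2 = 0"
      using z.upper s z.xi by (simp_all add: max_def)
    have "{j+5, (j+5)+1, (j+5)+2} \<subseteq> Z (comb A B)" using u by (simp add: ev)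
    then show ?thesis by blast
  next
    assume s: "z.\<sigma> = -1"
    have u: "z.al1 = 0" "z.al3 = 0" "z.be1 = 0" "z.be2 = 0"
      using z.lower s z.xi by (simp_all add: max_def)
    have "{j+1, (j+1)+1, (j+1)+2} \<subseteq> Z (comb A B)" using u by (simp add: ev)
    then show ?thesis by blast
  qed
  ultimately show ?thesis by (simp add: Cset_def AB)
qed

text \<open>A special edge lifts to the boundary edge from \<open>A (p-1)\<close> to
  \<open>A (p+1)\<close>, which spans two cells; hence the two cases for its halves.\<close>

lemma mob_boundary: "mob ` {z \<in> rect. \<bar>snd z\<bar> = 1} = Cset"
proof
  show "mob ` {z \<in> rect. \<bar>snd z\<bar> = 1} \<subseteq> Cset"
  proof
    fix x assume "x \<in> mob ` {z \<in> rect. \<bar>snd z\<bar> = 1}"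
    then obtain z where z: "z \<in> rect" "\<bar>snd z\<bar> = 1" "x = mob z" by blast
    then obtain k \<xi> where "cell k \<xi> (snd z)" "fst z = of_int k + \<xi>" using rect_cell by blast
    then show "x \<in> Cset" using cell_boundary[of k \<xi> "snd z"] z by (metis prod.collapse)
  qed
  show "Cset \<subseteq> mob ` {z \<in> rect. \<bar>snd z\<bar> = 1}"
  proof
    fix x assume "x \<in> Cset"
    then obtain k where k: "x \<in> R" "{k, k+1, k+2} \<subseteq> Z x" by (auto simp: Cset_def)
    have sV: "{i. {k, k+1, k+2} \<subseteq> zV i} = {k+6, k}"
    proof (rule set_eqI)
      show "i \<in> {i. {k, k+1, k+2} \<subseteq> zV i} \<longleftrightarrow> i \<in> {k+6, k}" for i by (cases i k rule: cases7; simp add: zV_def)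
    qed
    have sU: "{i. {k, k+1, k+2} \<subseteq> zU i} = {}"
    proof (rule set_eqI)
      show "i \<in> {i. {k, k+1, k+2} \<subseteq> zU i} \<longleftrightarrow> i \<in> {}" for i by (cases i k rule: cases7; simp add: zU_def)
    qed
    have im: "V ` {k+6, k} \<union> U ` {} = {V (k+6), V k}" by auto
    have "x \<in> FC {k, k+1, k+2}" using k by (simp add: FC_iff)
    from FC_edge[OF sV sU im this] obtain p q where pq: "0 \<le> p" "0 \<le> q" "p + q = 1" "x = p *\<^sub>R V (k+6) + q *\<^sub>R V k" by blast
    show "x \<in> mob ` {z \<in> rect. \<bar>snd z\<bar> = 1}"
    proof (cases "q \<le> p")
      case True
      have m: "max 0 (2 * q + 1 - 1) = 2 * q" using pq by (simp add: max_def)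
      have p: "p = 1 - q" using pq(3) by simp
      show ?thesis using mob_upper[of "2*q" 1 "k+2", unfolded m] pq(1,2) True unfolding pq(4) p by simp
    next
      case False
      have m: "max 0 (1 - (1 - 2 * p)) = 2 * p" using pq by (simp add: max_def)
      have q: "q = 1 - p" using pq(3) by simp
      show ?thesis using mob_lower[of "1 - 2*p" 1 "k+6", unfolded m] pq(1,2) False unfolding pq(4) q by (simp add: add.commute)
    qed
  qed
qed

lemma band_R: "band \<subseteq> R" by (auto simp: band_def)

text \<open>A continuous surjection from a compact space to a Hausdorff space is a quotient map.
  Stretching \<open>[0,1]\<close> to \<open>[0,7]\<close> turns the required identification into
  \<open>mob_eq_iff\<close>.\<close>

lemma moebius: "moebius_strip_with_boundary (abs_pspace ` band) (abs_pspace ` Cset)"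
proof -
  define g where "g z = mob (7 * fst z, snd z)" for z :: "real \<times> real"
  define D :: "(real \<times> real) set" where "D = {0..1} \<times> {-1..1}"
  have img: "(\<lambda>z. (7 * fst z, snd z)) ` D = rect"
  proof
    show "rect \<subseteq> (\<lambda>z. (7 * fst z, snd z)) ` D"
    proof
      fix z assume "z \<in> rect"
      then show "z \<in> (\<lambda>z. (7 * fst z, snd z)) ` D"
        by (intro image_eqI[where x = "(fst z / 7, snd z)"]) (auto simp: rect_def D_def)
    qed
  qed (auto simp: rect_def D_def)
  have gD: "g ` D = band"
    unfolding mob_image[symmetric] img[symmetric] image_image g_def ..
  have gB: "g ` ({0..1} \<times> {-1, 1}) = Cset"
  proof -
    have "{0..1} \<times> {-1, 1} = {z \<in> D. \<bar>snd z\<bar> = 1}" by (auto simp: D_def abs_if split: if_splits)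
    moreover have "(\<lambda>z. (7 * fst z, snd z)) ` {z \<in> D. \<bar>snd z\<bar> = 1} = {z \<in> rect. \<bar>snd z\<bar> = 1}"
      unfolding img[symmetric] by force
    moreover have "g ` X = mob ` (\<lambda>z. (7 * fst z, snd z)) ` X" for X unfolding image_image g_def ..
    ultimately show ?thesis unfolding mob_boundary[symmetric] by simp
  qed
  have cg: "continuous_on D g"
    unfolding g_def by (intro continuous_on_compose2[OF cont_mob[of UNIV]] continuous_intros) auto
  have q1: "quotient_map (top_of_set D) (top_of_set band) g"
  proof (rule continuous_imp_quotient_map)
    show "continuous_map (top_of_set D) (top_of_set band) g"
      using cg gD by (auto simp: continuous_map_in_subtopology)
    show "compact_space (top_of_set D)"
      by (simp add: compact_space_subtopology D_def compact_Times)
    show "Hausdorff_space (top_of_set band)" by (simp add: Hausdorff_space_subtopology)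
    show "g ` topspace (top_of_set D) = topspace (top_of_set band)" using gD by simp
  qed
  have h: "homeomorphism band (abs_pspace ` band) abs_pspace (chart hv)"
    using chart_homeo[OF band_R] homeomorphism_symD by blast
  then have "homeomorphic_maps (top_of_set band) (top_of_set (abs_pspace ` band)) abs_pspace (chart hv)"
    unfolding homeomorphic_maps_def homeomorphism_def continuous_map_in_subtopology by auto
  then have "homeomorphic_map (top_of_set band) (top_of_set (abs_pspace ` band)) abs_pspace"
    using homeomorphic_maps_map by blast
  then have q2: "quotient_map (top_of_set band) (top_of_set (abs_pspace ` band)) abs_pspace"
    by (simp add: homeomorphic_map_def)
  have ij: "inj_on abs_pspace band" by (rule inj_on_inverseI[of _ "chart hv"]) (rule homeomorphism_apply1[OF h])
  show ?thesis
    unfolding moebius_strip_with_boundary_def D_def[symmetric]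
  proof (intro exI[of _ "abs_pspace \<circ> g"] conjI ballI)
    show "quotient_map (top_of_set D) (top_of_set (abs_pspace ` band)) (abs_pspace \<circ> g)"
      using quotient_map_compose[OF q1 q2] .
    show "(abs_pspace \<circ> g) ` ({0..1} \<times> {-1, 1}) = abs_pspace ` Cset" unfolding image_comp[symmetric] gB ..
    fix z z' assume z: "z \<in> D" "z' \<in> D"
    have b: "g z \<in> band" "g z' \<in> band" using z gD by blast+
    have r: "(7 * fst z, snd z) \<in> rect" "(7 * fst z', snd z') \<in> rect" using z by (auto simp: D_def rect_def)
    have "(abs_pspace \<circ> g) z = (abs_pspace \<circ> g) z' \<longleftrightarrow> g z = g z'"
      using inj_on_eq_iff[OF ij b] by simp
    also have "\<dots> \<longleftrightarrow> (7 * fst z, snd z) = (7 * fst z', snd z') \<or> ({7 * fst z, 7 * fst z'} = {0, 7} \<and> snd z' = - snd z)"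
      unfolding g_def using mob_eq_iff[OF r] by simp
    also have "\<dots> \<longleftrightarrow> z = z' \<or> ({fst z, fst z'} = {0, 1} \<and> snd z' = - snd z)"
      by (simp add: prod_eq_iff doubleton_eq_iff)
    finally show "(abs_pspace \<circ> g) z = (abs_pspace \<circ> g) z' \<longleftrightarrow> z = z' \<or> ({fst z, fst z'} = {0, 1} \<and> snd z' = - snd z)" .
  qed
qed

end

section \<open>The moment curve\<close>

text \<open>The sum is the coefficient of highest degree in the Lagrange interpolation polynomial of \<open>p\<close>.\<close>

lemma divided_difference_zero:
  fixes p :: "real poly"
  assumes S: "finite S" "degree p + 1 < card S"
  shows "(\<Sum>s\<in>S. poly p s / (\<Prod>r\<in>S-{s}. s - r)) = 0"
proof -
  define N where "N s = (\<Prod>r\<in>S-{s}. [:- r, 1:])" for s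
  define L where "L = (\<Sum>s\<in>S. smult (poly p s / (\<Prod>r\<in>S-{s}. s - r)) (N s))"
  have pN: "poly (N s) x = (\<Prod>r\<in>S-{s}. x - r)" for s x by (simp add: N_def poly_prod)
  have dN: "degree (N s) = card S - 1" if "s \<in> S" for s
    using that S by (simp add: N_def degree_prod_sum_eq)
  have cN: "poly.coeff (N s) (card S - 1) = 1" if "s \<in> S" for s
    using lead_coeff_prod[of "\<lambda>r. [:- r, 1:]" "S - {s}"] dN[OF that] by (simp add: N_def)
  have N0: "poly (N s) x = (if s = x then (\<Prod>r\<in>S-{s}. s - r) else 0)" if "s \<in> S" "x \<in> S" for s x
    using that S(1) by (auto simp: pN)
  have nz: "(\<Prod>r\<in>S-{s}. s - r) \<noteq> 0" for s using S(1) by simp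
  have "L = p"
  proof (rule poly_eqI_degree)
    show "poly L x = poly p x" if "x \<in> S" for x
    proof -
      have "poly L x = (\<Sum>s\<in>S. if s = x then poly p s else 0)"
        unfolding L_def poly_sum poly_smult using N0[OF _ that] nz by (intro sum.cong) auto
      then show ?thesis using that S(1) by simp
    qed
    have "degree L \<le> card S - 1"
      unfolding L_def by (rule degree_sum_le[OF S(1)]) (use dN degree_smult_le in metis)
    then show "degree L < card S" using S by simp
  qed (use S in simp)
  then have "poly.coeff L (card S - 1) = 0" using S by (simp add: coeff_eq_0)
  moreover have "poly.coeff L (card S - 1) = (\<Sum>s\<in>S. poly p s / (\<Prod>r\<in>S-{s}. s - r))"
    unfolding L_def coeff_sum coeff_smult using cN by simp
  ultimately show ?thesis by simp
qed

text \<open>The coefficient of a node in the divided difference has the sign given by the parity of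
  the number of larger nodes, so the signs alternate.\<close>

lemma alternating_relation:
  fixes x1 x2 x3 x4 x5 x6 :: real
  assumes "x1 < x2" "x2 < x3" "x3 < x4" "x4 < x5" "x5 < x6"
  obtains c1 c2 c3 c4 c5 c6 where "c1 > 0" "c2 > 0" "c3 > 0" "c4 > 0" "c5 > 0" "c6 > 0"
    "\<And>p. degree p \<le> 4 \<Longrightarrow> c1 * poly p x1 + c3 * poly p x3 + c5 * poly p x5 = c2 * poly p x2 + c4 * poly p x4 + c6 * poly p x6"
proof -
  define S where "S = {x1, x2, x3, x4, x5, x6}"
  define w where "w s = (\<Prod>r\<in>S-{s}. s - r)" for s
  have lt: "x1 < x2" "x1 < x3" "x1 < x4" "x1 < x5" "x1 < x6" "x2 < x3" "x2 < x4" "x2 < x5" "x2 < x6"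
    "x3 < x4" "x3 < x5" "x3 < x6" "x4 < x5" "x4 < x6" "x5 < x6" using assms by linarith+
  note ne = lt[THEN less_imp_neq] lt[THEN less_imp_neq, symmetric]
  have c: "card S = 6" "finite S" by (simp_all add: S_def ne)
  have D: "S - {x1} = {x2, x3, x4, x5, x6}" "S - {x2} = {x1, x3, x4, x5, x6}" "S - {x3} = {x1, x2, x4, x5, x6}"
    "S - {x4} = {x1, x2, x3, x5, x6}" "S - {x5} = {x1, x2, x3, x4, x6}" "S - {x6} = {x1, x2, x3, x4, x5}"
    unfolding S_def using ne by auto
  have s: "w x1 < 0" "0 < w x2" "w x3 < 0" "0 < w x4" "w x5 < 0" "0 < w x6"
    unfolding w_def D by (simp_all add: ne lt zero_less_mult_iff mult_less_0_iff)
  show ?thesis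
  proof -
    have pos: "0 < - 1 / w x1" "0 < 1 / w x2" "0 < - 1 / w x3" "0 < 1 / w x4" "0 < - 1 / w x5" "0 < 1 / w x6"
      using s by (simp_all add: divide_neg_neg)
    have "- 1 / w x1 * poly p x1 + - 1 / w x3 * poly p x3 + - 1 / w x5 * poly p x5
        = 1 / w x2 * poly p x2 + 1 / w x4 * poly p x4 + 1 / w x6 * poly p x6" if dp: "degree p \<le> 4" for p
    proof -
    have "(\<Sum>s\<in>S. poly p s / w s) = 0" unfolding w_def using c dp by (intro divided_difference_zero) simp_all
    moreover have "(\<Sum>s\<in>S. poly p s / w s) = poly p x1 / w x1 + poly p x2 / w x2 + poly p x3 / w x3
        + poly p x4 / w x4 + poly p x5 / w x5 + poly p x6 / w x6"
      by (simp add: S_def ne)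
    ultimately show "- 1 / w x1 * poly p x1 + - 1 / w x3 * poly p x3 + - 1 / w x5 * poly p x5
        = 1 / w x2 * poly p x2 + 1 / w x4 * poly p x4 + 1 / w x6 * poly p x6"
      by simp
    qed
    with that[OF pos] show ?thesis .
  qed
qed

lemma UNIV_5: "(UNIV::5 set) = {0,1,2,3,4}"
  by (rule sym, rule card_subset_eq) simp_all

definition form_poly :: "real^5 \<Rightarrow> real poly" where
  "form_poly x = [:x $ 0, x $ 1, x $ 2, x $ 3, x $ 4:]"

lemma form_poly: "poly (form_poly x) s = form s x" "degree (form_poly x) \<le> 4"
  by (simp_all add: form_poly_def form_def power2_eq_square power3_eq_cube power4_eq_xxxx algebra_simps)

lemma form_poly_0: "form_poly x = 0 \<Longrightarrow> x = 0"
proof -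
  assume "form_poly x = 0"
  then have "\<forall>i\<in>UNIV. x $ i = 0" unfolding UNIV_5 by (simp add: form_poly_def)
  then show "x = 0" by (simp add: vec_eq_iff)
qed

definition moment :: "real \<Rightarrow> real^5" where
  "moment s = (\<chi> i. if i = 0 then 1 else if i = 1 then s else if i = 2 then s^2 else if i = 3 then s^3 else s^4)"

lemma moment_inner: "moment s \<bullet> x = form s x"
  unfolding inner_vec_def UNIV_5 by (simp add: moment_def form_def)

text \<open>The index 7 becomes the residue 0, covered by the last branch.\<close>

definition node :: "(nat \<Rightarrow> real) \<Rightarrow> 7 \<Rightarrow> real" where
  "node t i = (if i = 1 then t 1 else if i = 2 then t 2 else if i = 3 then t 3 else if i = 4 then t 4
    else if i = 5 then t 5 else if i = 6 then t 6 else t 7)"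

lemma index_cases: "k \<in> {1..7} \<longleftrightarrow> k = 1 \<or> k = 2 \<or> k = 3 \<or> k = 4 \<or> k = 5 \<or> k = 6 \<or> k = (7::nat)"
  by auto

lemma node_of_nat: "k \<in> {1..7} \<Longrightarrow> node t (of_nat k) = t k"
  unfolding index_cases by (elim disjE) (simp_all add: node_def)

lemma of_nat_image: "of_nat ` {1..7::nat} = (UNIV :: 7 set)"
proof -
  have "(i::7) \<in> of_nat ` {1..7::nat}" for i
    by (cases i "0::7" rule: cases7)
      (intro image_eqI[of _ _ 7] image_eqI[of _ _ 1] image_eqI[of _ _ 2] image_eqI[of _ _ 3] image_eqI[of _ _ 4]
        image_eqI[of _ _ 5] image_eqI[of _ _ 6]; simp; fail)+
  then show ?thesis by blast
qed

lemma inj_of_nat7: "inj_on (of_nat :: nat \<Rightarrow> 7) {1..7}"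
  by (rule eq_card_imp_inj_on) (simp_all only: of_nat_image, simp_all)

lemma of_nat_nxt: "k \<in> {1..7} \<Longrightarrow> of_nat (nxt k) = (of_nat k + 1 :: 7)"
  unfolding index_cases by (elim disjE) (simp_all add: nxt_def)

lemma nxt_range: "nxt k \<in> {1..7}"
  using mod_less_divisor[of 7 k] by (simp add: nxt_def)

lemma form_relation:
  fixes x1 x2 x3 x4 x5 x6 :: real
  assumes "x1 < x2" "x2 < x3" "x3 < x4" "x4 < x5" "x5 < x6"
  obtains c1 c2 c3 c4 c5 c6 where "c1 > 0" "c2 > 0" "c3 > 0" "c4 > 0" "c5 > 0" "c6 > 0"
    "\<And>x. c1 * form x1 x + c3 * form x3 x + c5 * form x5 x = c2 * form x2 x + c4 * form x4 x + c6 * form x6 x"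
proof (rule alternating_relation[OF assms])
  fix c1 c2 c3 c4 c5 c6 :: real
  assume c: "c1 > 0" "c2 > 0" "c3 > 0" "c4 > 0" "c5 > 0" "c6 > 0"
    "\<And>p. degree p \<le> 4 \<Longrightarrow> c1 * poly p x1 + c3 * poly p x3 + c5 * poly p x5
        = c2 * poly p x2 + c4 * poly p x4 + c6 * poly p x6"
  show thesis by (rule that[OF c(1-6)], rule c(7)[OF form_poly(2), unfolded form_poly(1)])
qed

lemma alternating_moment:
  assumes "strict_mono_on {1..7} t"
  shows "\<exists>l. alternating (\<lambda>i. moment (node t i)) l (axis 0 1)"
proof -
  have lt: "t 1 < t 2" "t 2 < t 3" "t 3 < t 4" "t 4 < t 5" "t 5 < t 6" "t 6 < t 7"
    using strict_mono_onD[OF assms] by simp_all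
  then have lt': "t 1 < t 3" "t 2 < t 4" "t 3 < t 5" "t 4 < t 6" "t 5 < t 7" by simp_all
  define F where "F i x = moment (node t i) \<bullet> x" for i x
  have F: "F 0 x = form (t 7) x" "F 1 x = form (t 1) x" "F 2 x = form (t 2) x" "F 3 x = form (t 3) x"
    "F 4 x = form (t 4) x" "F 5 x = form (t 5) x" "F 6 x = form (t 6) x" for x
    by (simp_all add: F_def moment_inner node_def)
  have choose_l: "\<exists>l. (\<forall>i::7. l i > (0::real)) \<and> (\<forall>x. l 1 * G1 x + l 3 * G3 x + l 5 * G5 x = l 2 * G2 x + l 4 * G4 x + l 6 * G6 x)"
    if "c1 > 0" "c2 > 0" "c3 > 0" "c4 > 0" "c5 > 0" "c6 > 0"
      "\<And>x. c1 * G1 x + c3 * G3 x + c5 * G5 x = c2 * G2 x + c4 * G4 x + c6 * G6 x"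
    for c1 c2 c3 c4 c5 c6 :: real and G1 G2 G3 G4 G5 G6 :: "real^5 \<Rightarrow> real"
    by (rule exI[of _ "\<lambda>i. if i = 1 then c1 else if i = 2 then c2 else if i = 3 then c3 else if i = 4 then c4
      else if i = 5 then c5 else c6"]) (use that in simp)
  have "\<forall>m::7. \<exists>l. (\<forall>i::7. l i > (0::real)) \<and> (\<forall>x. l 1 * F (m+1) x + l 3 * F (m+3) x + l 5 * F (m+5) x
      = l 2 * F (m+2) x + l 4 * F (m+4) x + l 6 * F (m+6) x)"
  proof (rule all7[THEN iffD2], intro conjI)
    obtain c1 c2 c3 c4 c5 c6 where c: "c1 > 0" "c2 > 0" "c3 > 0" "c4 > 0" "c5 > 0" "c6 > 0"
      and e: "\<And>x. c1 * form (t 1) x + c3 * form (t 3) x + c5 * form (t 5) x = c2 * form (t 2) x + c4 * form (t 4) x + c6 * form (t 6) x"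
      by (rule form_relation[OF lt(1) lt(2) lt(3) lt(4) lt(5)], rule that)
    show "\<exists>l. (\<forall>i::7. l i > (0::real)) \<and> (\<forall>x. l 1 * F (0+1) x + l 3 * F (0+3) x + l 5 * F (0+5) x
      = l 2 * F (0+2) x + l 4 * F (0+4) x + l 6 * F (0+6) x)"
      by (rule choose_l[OF c(1) c(2) c(3) c(4) c(5) c(6)]) (use e in \<open>simp add: F add.commute add.left_commute\<close>)
  next
    obtain c1 c2 c3 c4 c5 c6 where c: "c1 > 0" "c2 > 0" "c3 > 0" "c4 > 0" "c5 > 0" "c6 > 0"
      and e: "\<And>x. c1 * form (t 2) x + c3 * form (t 4) x + c5 * form (t 6) x = c2 * form (t 3) x + c4 * form (t 5) x + c6 * form (t 7) x"
      by (rule form_relation[OF lt(2) lt(3) lt(4) lt(5) lt(6)], rule that)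
    show "\<exists>l. (\<forall>i::7. l i > (0::real)) \<and> (\<forall>x. l 1 * F (1+1) x + l 3 * F (1+3) x + l 5 * F (1+5) x
      = l 2 * F (1+2) x + l 4 * F (1+4) x + l 6 * F (1+6) x)"
      by (rule choose_l[OF c(1) c(2) c(3) c(4) c(5) c(6)]) (use e in \<open>simp add: F add.commute add.left_commute\<close>)
  next
    obtain c1 c2 c3 c4 c5 c6 where c: "c1 > 0" "c2 > 0" "c3 > 0" "c4 > 0" "c5 > 0" "c6 > 0"
      and e: "\<And>x. c1 * form (t 1) x + c3 * form (t 4) x + c5 * form (t 6) x = c2 * form (t 3) x + c4 * form (t 5) x + c6 * form (t 7) x"
      by (rule form_relation[OF lt'(1) lt(3) lt(4) lt(5) lt(6)], rule that)
    show "\<exists>l. (\<forall>i::7. l i > (0::real)) \<and> (\<forall>x. l 1 * F (2+1) x + l 3 * F (2+3) x + l 5 * F (2+5) x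
      = l 2 * F (2+2) x + l 4 * F (2+4) x + l 6 * F (2+6) x)"
      \<comment> \<open>In the cyclic order that starts at \<open>m+1\<close> the increasing nodes
        appear rotated, and so do the coefficients. A rotation by an odd number of places exchanges
        the two sides, since the six places alternate.\<close>
      by (rule choose_l[OF c(2) c(3) c(4) c(5) c(6) c(1)]) (use e in \<open>simp add: F add.commute add.left_commute\<close>)
  next
    obtain c1 c2 c3 c4 c5 c6 where c: "c1 > 0" "c2 > 0" "c3 > 0" "c4 > 0" "c5 > 0" "c6 > 0"
      and e: "\<And>x. c1 * form (t 1) x + c3 * form (t 4) x + c5 * form (t 6) x = c2 * form (t 2) x + c4 * form (t 5) x + c6 * form (t 7) x"
      by (rule form_relation[OF lt(1) lt'(2) lt(4) lt(5) lt(6)], rule that)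
    show "\<exists>l. (\<forall>i::7. l i > (0::real)) \<and> (\<forall>x. l 1 * F (3+1) x + l 3 * F (3+3) x + l 5 * F (3+5) x
      = l 2 * F (3+2) x + l 4 * F (3+4) x + l 6 * F (3+6) x)"
      by (rule choose_l[OF c(3) c(4) c(5) c(6) c(1) c(2)]) (use e in \<open>simp add: F add.commute add.left_commute\<close>)
  next
    obtain c1 c2 c3 c4 c5 c6 where c: "c1 > 0" "c2 > 0" "c3 > 0" "c4 > 0" "c5 > 0" "c6 > 0"
      and e: "\<And>x. c1 * form (t 1) x + c3 * form (t 3) x + c5 * form (t 6) x = c2 * form (t 2) x + c4 * form (t 5) x + c6 * form (t 7) x"
      by (rule form_relation[OF lt(1) lt(2) lt'(3) lt(5) lt(6)], rule that)
    show "\<exists>l. (\<forall>i::7. l i > (0::real)) \<and> (\<forall>x. l 1 * F (4+1) x + l 3 * F (4+3) x + l 5 * F (4+5) x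
      = l 2 * F (4+2) x + l 4 * F (4+4) x + l 6 * F (4+6) x)"
      by (rule choose_l[OF c(4) c(5) c(6) c(1) c(2) c(3)]) (use e in \<open>simp add: F add.commute add.left_commute\<close>)
  next
    obtain c1 c2 c3 c4 c5 c6 where c: "c1 > 0" "c2 > 0" "c3 > 0" "c4 > 0" "c5 > 0" "c6 > 0"
      and e: "\<And>x. c1 * form (t 1) x + c3 * form (t 3) x + c5 * form (t 6) x = c2 * form (t 2) x + c4 * form (t 4) x + c6 * form (t 7) x"
      by (rule form_relation[OF lt(1) lt(2) lt(3) lt'(4) lt(6)], rule that)
    show "\<exists>l. (\<forall>i::7. l i > (0::real)) \<and> (\<forall>x. l 1 * F (5+1) x + l 3 * F (5+3) x + l 5 * F (5+5) x
      = l 2 * F (5+2) x + l 4 * F (5+4) x + l 6 * F (5+6) x)"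
      by (rule choose_l[OF c(5) c(6) c(1) c(2) c(3) c(4)]) (use e in \<open>simp add: F add.commute add.left_commute\<close>)
  next
    obtain c1 c2 c3 c4 c5 c6 where c: "c1 > 0" "c2 > 0" "c3 > 0" "c4 > 0" "c5 > 0" "c6 > 0"
      and e: "\<And>x. c1 * form (t 1) x + c3 * form (t 3) x + c5 * form (t 5) x = c2 * form (t 2) x + c4 * form (t 4) x + c6 * form (t 7) x"
      by (rule form_relation[OF lt(1) lt(2) lt(3) lt(4) lt'(5)], rule that)
    show "\<exists>l. (\<forall>i::7. l i > (0::real)) \<and> (\<forall>x. l 1 * F (6+1) x + l 3 * F (6+3) x + l 5 * F (6+5) x
      = l 2 * F (6+2) x + l 4 * F (6+4) x + l 6 * F (6+6) x)"
      by (rule choose_l[OF c(6) c(1) c(2) c(3) c(4) c(5)]) (use e in \<open>simp add: F add.commute add.left_commute\<close>)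
  qed
  from choice[OF this] obtain l where l: "\<And>m i::7. l m i > (0::real)"
    "\<And>m x. l m 1 * F (m+1) x + l m 3 * F (m+3) x + l m 5 * F (m+5) x = l m 2 * F (m+2) x + l m 4 * F (m+4) x + l m 6 * F (m+6) x"
    by blast
  have inj: "inj_on t {1..7}" using assms by (rule strict_mono_on_imp_inj_on)
  \<comment> \<open>The centre \<open>axis 0 1\<close> is the constant polynomial 1.\<close>
  have "alternating (\<lambda>i. moment (node t i)) l (axis 0 1)"
  proof
    show "l m i > 0" for m i by (rule l)
    show "l m 1 * (moment (node t (m+1)) \<bullet> x) + l m 3 * (moment (node t (m+3)) \<bullet> x) + l m 5 * (moment (node t (m+5)) \<bullet> x)
      = l m 2 * (moment (node t (m+2)) \<bullet> x) + l m 4 * (moment (node t (m+4)) \<bullet> x) + l m 6 * (moment (node t (m+6)) \<bullet> x)" for m x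
      using l(2) unfolding F_def .
    show "moment (node t i) \<bullet> axis 0 1 = 1" for i by (simp add: moment_inner form_def axis_def)
    fix x assume z: "\<And>i. moment (node t i) \<bullet> x = 0"
    \<comment> \<open>A polynomial of degree at most 4 with seven distinct zeros.\<close>
    have "form_poly x = 0"
    proof (rule poly_eqI_degree)
      fix s assume "s \<in> t ` {1..7}"
      then obtain k where k: "k \<in> {1..7}" "s = t k" by blast
      have "form s x = 0" using z[of "of_nat k"] k by (simp add: moment_inner node_of_nat)
      then show "poly (form_poly x) s = poly 0 s" by (simp add: form_poly(1))
    next
      have "card (t ` {1..7}) = 7" using card_image[OF inj] by simp
      then show "degree (form_poly x) < card (t ` {1..7})" "degree 0 < card (t ` {1..7})"
        using form_poly(2)[of x] by simp_all
    qed
    then show "x = 0" by (rule form_poly_0)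
  qed
  then show ?thesis by blast
qed

context alternating
begin

lemma pentagon_face: "proj_face (P {k} \<inter> P {k+1}) (P {k})" "proj_face (P {k} \<inter> P {k+1}) (P {k+1})"
  "proj_polygon 5 (P {k} \<inter> P {k+1})"
proof -
  have e: "P {k} \<inter> P {k+1} = P {k, k+1}" by (simp add: P_Int insert_commute)
  show "proj_face (P {k} \<inter> P {k+1}) (P {k})" "proj_face (P {k} \<inter> P {k+1}) (P {k+1})"
    unfolding e proj_face_P using good_card2[of k "k+1"] by auto
  show "proj_polygon 5 (P {k} \<inter> P {k+1})"
    unfolding e proj_polygon_P[OF good_card2] card_vs_pair by simp
qed

end

theorem mainTheorem2:
  fixes t :: "nat \<Rightarrow> real"
  assumes "strict_mono_on {1..7} t"
  shows
    "chamber (hyp t ` {1..7}) (CC t)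

     \<comment> \<open>(i)\<close>
     \<and> {F. proj_facet F (CC t)} = dumpling_tess t
     \<and> inj_on (DD t) {1..7}
     \<and> (\<forall>k\<in>{1..7}. dumpling (DD t k))
     \<and> three_sphere (frontier (CC t))
     \<and> tessellation 3 (dumpling_tess t) (frontier (CC t))
     \<and> (\<exists>\<phi>. comb_iso \<phi> (cells (dumpling_tess t)) (cells (dumpling_tess t))
            \<and> (\<forall>k\<in>{1..7}. \<phi> (DD t k) = DD t (nxt k)))

     \<comment> \<open>(ii)\<close>
     \<and> (\<forall>k\<in>{1..7}. proj_face (DD t k \<inter> DD t (nxt k)) (DD t k)
            \<and> proj_face (DD t k \<inter> DD t (nxt k)) (DD t (nxt k))
            \<and> proj_polygon 5 (DD t k \<inter> DD t (nxt k)))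
     \<and> inj_on (\<lambda>k. DD t k \<inter> DD t (nxt k)) {1..7}
     \<and> cells_of_dim 2 (dumpling_tess t) = (\<lambda>k. DD t k \<inter> DD t (nxt k)) ` {1..7}
            \<union> polygon_cells 3 (dumpling_tess t) \<union> polygon_cells 4 (dumpling_tess t)
     \<and> card (polygon_cells 3 (dumpling_tess t)) = 7
     \<and> card (polygon_cells 4 (dumpling_tess t)) = 7
     \<and> skeleton 2 (dumpling_tess t) = \<Union>(cells_of_dim 2 (dumpling_tess t))

     \<comment> \<open>(iii)\<close>
     \<and> (\<forall>k\<in>{1..7}. special_edge (DD t k) \<in> cells_of_dim 1 (dumpling_tess t))
     \<and> inj_on (\<lambda>k. special_edge (DD t k)) {1..7}
     \<and> circle (special_curve t)
     \<and> \<Union>(polygon_cells 3 (dumpling_tess t) \<union> polygon_cells 4 (dumpling_tess t))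
          = skeleton 2 (dumpling_tess t) - (\<Union>k\<in>{1..7}. open_cell (DD t k \<inter> DD t (nxt k)))
     \<and> moebius_strip_with_boundary
          (\<Union>(polygon_cells 3 (dumpling_tess t) \<union> polygon_cells 4 (dumpling_tess t))) (special_curve t)

     \<comment> \<open>(iv)\<close>
     \<and> (\<exists>\<S> \<subseteq> cells_of_dim 2 (dumpling_tess t). disc_with_boundary (\<Union>\<S>) (special_curve t))
     \<and> unknotted_circle_in (special_curve t) (frontier (CC t))"
proof -
  obtain l where "alternating (\<lambda>i. moment (node t i)) l (axis 0 1)"
    using alternating_moment[OF assms] by blast
  then interpret A: alternating "\<lambda>i. moment (node t i)" l "axis 0 1" .
  \<comment> \<open>The indices 1 to 7 are carried bijectively to the residues, and
    \<open>nxt\<close> becomes addition of 1; all claims are then transported from the abstract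
    setting.\<close>
  let ?n = "of_nat :: nat \<Rightarrow> 7" and ?P = "\<lambda>j. A.P {j}"
  have hyp: "hyp t k = A.hyper (?n k)" if "k \<in> {1..7}" for k
    unfolding hyp_def A.hyper_def moment_inner node_of_nat[OF that] ..
  have CC: "CC t = abs_pspace ` A.K"
  proof -
    have "(\<forall>i. 0 \<le> form (node t i) x) \<longleftrightarrow> (\<forall>i\<in>?n ` {1..7}. 0 \<le> form (node t i) x)" for x
      unfolding of_nat_image by simp
    also have "\<dots> x \<longleftrightarrow> (\<forall>k\<in>{1..7}. 0 \<le> form (t k) x)" for x
      using node_of_nat by (simp add: ball_simps)
    finally show ?thesis unfolding CC_def A.K_def moment_inner by simp
  qed
  have DD: "DD t k = ?P (?n k)" if "k \<in> {1..7}" for k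
    unfolding DD_def CC hyp[OF that] A.K_hyper ..
  have nx: "DD t (nxt k) = ?P (?n k + 1)" if "k \<in> {1..7}" for k
    unfolding DD[OF nxt_range] of_nat_nxt[OF that] ..
  have ran: "(\<lambda>k. g (?n k)) ` {1..7} = range g" for g :: "7 \<Rightarrow> 'z"
    unfolding of_nat_image[symmetric] image_image ..
  have inj: "inj_on (\<lambda>k. g (?n k)) {1..7}" if "inj g" for g :: "7 \<Rightarrow> 'z"
    using comp_inj_on[OF inj_of_nat7 inj_on_subset[OF that subset_UNIV]] by (simp add: comp_def)
  have D2: "DD t k \<inter> DD t (nxt k) = A.P {?n k, ?n k + 1}" if "k \<in> {1..7}" for k
    unfolding DD[OF that] nx[OF that] A.P_Int by (simp add: insert_commute)
  have tess: "dumpling_tess t = A.tess"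
    unfolding dumpling_tess_def ran[symmetric] by (rule image_cong[OF refl DD])
  have pent: "(\<lambda>k. DD t k \<inter> DD t (nxt k)) ` {1..7} = range (\<lambda>j. A.P {j, j+1})"
    unfolding ran[symmetric] by (rule image_cong[OF refl D2])
  have sc: "special_curve t = abs_pspace ` A.Cset"
  proof -
    have "(\<lambda>k. special_edge (DD t k)) ` {1..7} = range (\<lambda>j. special_edge (?P j))"
      unfolding ran[symmetric] by (rule image_cong[OF refl]) (simp only: DD)
    then show ?thesis unfolding special_curve_def A.special_curve_P[symmetric] by simp
  qed
  have strip: "\<Union>(polygon_cells 3 A.tess \<union> polygon_cells 4 A.tess) = abs_pspace ` A.band"
    unfolding A.strip_cells A.band_def ..
  have oc: "(\<Union>k\<in>{1..7}. open_cell (DD t k \<inter> DD t (nxt k))) = (\<Union>j. open_cell (A.P {j, j+1}))"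
  proof -
    have "(\<lambda>k. open_cell (DD t k \<inter> DD t (nxt k))) ` {1..7} = range (\<lambda>j. open_cell (A.P {j, j+1}))"
      unfolding ran[symmetric] by (rule image_cong[OF refl]) (simp only: D2)
    then show ?thesis by simp
  qed
  have fr: "frontier (CC t) = abs_pspace ` A.BR" unfolding CC by (rule A.frontier_K)
  show ?thesis
    unfolding tess pent sc oc fr
  proof (intro conjI)
    show "chamber (hyp t ` {1..7}) (CC t)"
    proof -
      have "hyp t ` {1..7} = range A.hyper" unfolding ran[symmetric] by (rule image_cong[OF refl hyp])
      then show ?thesis using A.chamber_K by (simp add: CC)
    qed
    show "{F. proj_facet F (CC t)} = A.tess" unfolding CC A.abs_K A.proj_facet_P by auto
    have "inj ?P" by (rule injI) (simp add: A.P_eq_iff A.good_card1)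
    from inj[OF this] show "inj_on (DD t) {1..7}" by (simp only: inj_on_cong[OF DD])
    show "\<forall>k\<in>{1..7}. dumpling (DD t k)" using A.dumpling_P by (simp add: DD)
    show "three_sphere (abs_pspace ` A.BR)" using unknotted_imp_three_sphere[OF A.unknotted_C] .
    show "tessellation 3 A.tess (abs_pspace ` A.BR)" using A.tessellation_tess by (simp add: A.BR_P)
    show "\<exists>\<phi>. comb_iso \<phi> (cells A.tess) (cells A.tess) \<and> (\<forall>k\<in>{1..7}. \<phi> (DD t k) = DD t (nxt k))"
    proof -
      obtain \<phi> where ph: "comb_iso \<phi> (cells A.tess) (cells A.tess)" "\<And>k. \<phi> (?P k) = ?P (k + 1)"
        using A.tess_automorphism by blast
      have "\<phi> (DD t k) = DD t (nxt k)" if "k \<in> {1..7}" for k unfolding DD[OF that] nx[OF that] ph(2) ..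
      then show ?thesis using ph(1) by blast
    qed
    show "\<forall>k\<in>{1..7}. proj_face (DD t k \<inter> DD t (nxt k)) (DD t k)
            \<and> proj_face (DD t k \<inter> DD t (nxt k)) (DD t (nxt k))
            \<and> proj_polygon 5 (DD t k \<inter> DD t (nxt k))"
    proof
      fix k :: nat assume k: "k \<in> {1..7}"
      show "proj_face (DD t k \<inter> DD t (nxt k)) (DD t k) \<and> proj_face (DD t k \<inter> DD t (nxt k)) (DD t (nxt k))
            \<and> proj_polygon 5 (DD t k \<inter> DD t (nxt k))"
        unfolding DD[OF k] nx[OF k] by (intro conjI A.pentagon_face)
    qed
    from inj[OF A.inj_P_pair(1)] show "inj_on (\<lambda>k. DD t k \<inter> DD t (nxt k)) {1..7}" by (simp only: inj_on_cong[OF D2])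
    show "cells_of_dim 2 A.tess = range (\<lambda>j. A.P {j, j+1}) \<union> polygon_cells 3 A.tess \<union> polygon_cells 4 A.tess"
      by (rule A.cells2_split)
    show "card (polygon_cells 3 A.tess) = 7" "card (polygon_cells 4 A.tess) = 7" by (rule A.card_polygon_cells)+
    show "skeleton 2 A.tess = \<Union>(cells_of_dim 2 A.tess)" by (rule A.skeleton2_cells)
    show "\<forall>k\<in>{1..7}. special_edge (DD t k) \<in> cells_of_dim 1 A.tess" using A.special_edge_cell by (simp add: DD)
    from inj[OF A.inj_special_edge] show "inj_on (\<lambda>k. special_edge (DD t k)) {1..7}"
      by (simp only: inj_on_cong[OF arg_cong[OF DD, of _ special_edge]])
    show "circle (abs_pspace ` A.Cset)" using unknotted_imp_circle[OF A.unknotted_C] .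
    show "\<Union>(polygon_cells 3 A.tess \<union> polygon_cells 4 A.tess)
        = skeleton 2 A.tess - (\<Union>j. open_cell (A.P {j, j+1}))" by (rule A.strip_skeleton)
    show "moebius_strip_with_boundary (\<Union>(polygon_cells 3 A.tess \<union> polygon_cells 4 A.tess)) (abs_pspace ` A.Cset)"
      unfolding strip by (rule A.moebius)
    show "\<exists>\<S>\<subseteq>cells_of_dim 2 A.tess. disc_with_boundary (\<Union>\<S>) (abs_pspace ` A.Cset)" by (rule A.disc_exists)
    show "unknotted_circle_in (abs_pspace ` A.Cset) (abs_pspace ` A.BR)" by (rule A.unknotted_C)
  qed
qed

end
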